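(* Consider sequences of nested $3$-gradings of simply-laced root systems (equivalently, sequences of nested binary decompositions of star-closed line systems), as defined in the context. Up to isomorphism, there is exactly one such sequence that is at once local, maximal, and not embeddable in a longer sequence of nested $3$-gradings. It is $$E_7 \rightarrow E_6 \rightarrow D_5 \rightarrow A_4 \rightarrow A_1\times A_2 .$$
   Context: **Root systems.** All root systems are finite, reduced, crystallographic and simply-laced (all roots of equal length, normalized to length $\sqrt2$), considered up to isomorphism. The irreducible ones are $A_n$ ($n\ge1$), $D_n$ ($n\ge4$), $E_6$, $E_7$, $E_8$ (and $D_3=A_3$). $\Phi\times\Psi$ denotes the orthogonal union of root systems. **3-grading.** A $3$-grading of a root system $\Phi$ is a partition $\Phi=\Phi_{-1}\,\dot\cup\,\Phi_0\,\dot\cup\,\Phi_1$ such that $\Phi\cap(\Phi_a+\Phi_b)\subset\Phi_{a+b}$ for all $a,b \in \{-1,0,1\}$ (with $\Phi_c=\varnothing$ for $c\notin\{-1,0,1\}$) and $\Phi\cap(\Phi_1-\Phi_1)=\Phi_0$. Equivalently, $\Phi_i=\{\alpha\in\Phi:\langle\alpha,q\rangle=i\}$ for a vector $q$ with $\langle\alpha,q\rangle\in\{-1,0,1\}$ for all $\alpha\in\Phi$, subject to $\Phi\cap(\Phi_1-\Phi_1)=\Phi_0$. One has $\Phi_{-1}=-\Phi_1$. **Line systems and binary decompositions.** A line system is a finite set of lines through the origin of a real Euclidean space, any two of which are orthogonal or at $60^\circ$. A star is a set of three coplanar lines pairwise at $60^\circ$. A line system is star-closed if, for any two of its nonorthogonal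 lines, it contains the third line of the star they determine. The star-closed line systems are exactly the systems $\overline{\Phi}$ of lines spanned by the roots of simply-laced root systems $\Phi$. The binary decomposition associated with a $3$-grading of $\Phi$ is the partition $\overline\Phi=\overline\Phi_0\,\dot\cup\,\overline\Phi_1$, where $\overline\Phi_i$ is the set of lines spanned by the roots of $\Phi_i$. Here $\overline\Phi_0$ is star-closed, $\overline\Phi_1$ contains no star, and $\overline\Phi$ is the smallest star-closed line system containing $\overline\Phi_1$. **Sequences of nested 3-gradings.** A sequence of nested $3$-gradings is a finite sequence, with at least one arrow, $$\Phi^{(m)}\rightarrow\Phi^{(m-1)}\rightarrow\cdots\rightarrow\Phi^{(0)}$$ of nonempty simply-laced root systems together with a $3$-grading of each $\Phi^{(k)}$, $1\le k\le m$, such that $\Phi^{(k-1)}=\Phi^{(k)}_0$. Every term $\Phi^{(k)}$ with $k\ge1$ (i.e. every term at the tail of an arrow) is required to be irreducible; the last term $\Phi^{(0)}$ may be reducible. Two sequences are identified when there is an isomorphism of the first terms carrying one sequence, with its gradings, to the other. A sequence is embeddable in a longer sequence if it occurs as a block of consecutive terms (with the same gradings, up to isomorphism) of a sequence of nested $3$-gradings with more terms, i.e. if it can be extended to the left or to the right. **Local sequence.** To an arrow $\Phi\rightarrow\Phi_0$ (a $3$-grading of an irreducible $\Phi$) attach the graph $G$ whose vertices are the lines of $\overline\Phi_1$ (equivalently, the roots of $\Phi_1$), two distinct vertices being adjacent if and only if the lines are nonorthogonal. $G$ is vertex-transitive, so the subgraph induced on the neighbours of a vertex is independent of the vertex up to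 isomorphism; it is called the local subgraph of $G$. The sequence is local if, for every arrow other than the first, its graph is isomorphic to the local subgraph of the graph of the immediately preceding arrow. **Maximal sequence.** The sequence is maximal if for each arrow $\Phi^{(k)}\rightarrow\Phi^{(k-1)}$ the chosen $3$-grading of $\Phi^{(k)}$ has $|\Phi^{(k)}_1|$ largest among all $3$-gradings of $\Phi^{(k)}$.
   Formalization: Isomorphism of sequences carries each 3-grading only up to exchanging Φ_1 and Φ_{-1}, separately for each arrow (as for binary decompositions); with labelled signs uniqueness fails, since the stabilizer W(E_6) of the E_7 grading does not reverse the E_6 grading. *)

theory Defs
  imports "HOL-Analysis.Analysis"
begin

subsection \<open>The ambient Euclidean space\<close>

text \<open>
  Root systems of arbitrary rank have to be compared within one formula, so they all live in the
  inner product space of finitely supported real sequences. Every finite-dimensional Euclidean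
  space embeds isometrically into it, hence every root system occurs here up to isomorphism.
\<close>

typedef fsvec = "{f :: nat \<Rightarrow> real. finite {i. f i \<noteq> 0}}"
  morphisms coord Abs_fsvec
  by (rule exI[of _ "\<lambda>_. 0"]) simp

setup_lifting type_definition_fsvec

lemma finite_support_coord: "finite {i. coord x i \<noteq> 0}"
  using coord[of x] by simp

lemma fsvec_eqI: "(\<And>i. coord x i = coord y i) \<Longrightarrow> x = y"
  by (metis coord_inject ext)

instantiation fsvec :: real_inner
begin

lift_definition zero_fsvec :: fsvec is "\<lambda>_. 0"
  by simp

lift_definition plus_fsvec :: "fsvec \<Rightarrow> fsvec \<Rightarrow> fsvec" is "\<lambda>f g i. f i + g i"
  subgoal for f g
    by (rule finite_subset[of _ "{i. f i \<noteq> 0} \<union> {i. g i \<noteq> 0}"]) auto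
  done

lift_definition minus_fsvec :: "fsvec \<Rightarrow> fsvec \<Rightarrow> fsvec" is "\<lambda>f g i. f i - g i"
  subgoal for f g
    by (rule finite_subset[of _ "{i. f i \<noteq> 0} \<union> {i. g i \<noteq> 0}"]) auto
  done

lift_definition uminus_fsvec :: "fsvec \<Rightarrow> fsvec" is "\<lambda>f i. - f i"
  by simp

lift_definition scaleR_fsvec :: "real \<Rightarrow> fsvec \<Rightarrow> fsvec" is "\<lambda>c f i. c * f i"
  by (simp add: finite_subset[rotated])

definition inner_fsvec :: "fsvec \<Rightarrow> fsvec \<Rightarrow> real"
  where "inner_fsvec x y = (\<Sum>i | coord x i \<noteq> 0. coord x i * coord y i)"

definition norm_fsvec :: "fsvec \<Rightarrow> real"
  where "norm_fsvec x = sqrt (inner x x)"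

definition dist_fsvec :: "fsvec \<Rightarrow> fsvec \<Rightarrow> real"
  where "dist_fsvec x y = norm (x - y)"

definition sgn_fsvec :: "fsvec \<Rightarrow> fsvec"
  where "sgn_fsvec x = inverse (norm x) *\<^sub>R x"

definition uniformity_fsvec :: "(fsvec \<times> fsvec) filter"
  where "uniformity_fsvec = (INF e\<in>{0<..}. principal {(x, y). dist x y < e})"

definition open_fsvec :: "fsvec set \<Rightarrow> bool"
  where "open_fsvec U \<longleftrightarrow> (\<forall>x\<in>U. eventually (\<lambda>(x', y). x' = x \<longrightarrow> y \<in> U) uniformity)"

instance
proof
  have inner_superset: "inner x y = (\<Sum>i\<in>S. coord x i * coord y i)"
    if "finite S" "{i. coord x i \<noteq> 0} \<subseteq> S" for x y :: fsvec and S
    unfolding inner_fsvec_def using that by (intro sum.mono_neutral_left) auto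
  fix x y z :: fsvec and a b :: real and U :: "fsvec set"
  show "x + y + z = x + (y + z)" "x + y = y + x" "0 + x = x" "- x + x = 0" "x - y = x + - y"
    "a *\<^sub>R (x + y) = a *\<^sub>R x + a *\<^sub>R y" "(a + b) *\<^sub>R x = a *\<^sub>R x + b *\<^sub>R x"
    "a *\<^sub>R b *\<^sub>R x = (a * b) *\<^sub>R x" "1 *\<^sub>R x = x"
    by (auto intro!: fsvec_eqI simp: plus_fsvec.rep_eq minus_fsvec.rep_eq uminus_fsvec.rep_eq
        zero_fsvec.rep_eq scaleR_fsvec.rep_eq algebra_simps)
  show "dist x y = norm (x - y)" "sgn x = inverse (norm x) *\<^sub>R x" "norm x = sqrt (inner x x)"
    "(uniformity :: (fsvec \<times> fsvec) filter) = (INF e\<in>{0<..}. principal {(x, y). dist x y < e})"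
    "open U \<longleftrightarrow> (\<forall>x\<in>U. eventually (\<lambda>(x', y). x' = x \<longrightarrow> y \<in> U) uniformity)"
    by (simp_all add: dist_fsvec_def sgn_fsvec_def norm_fsvec_def uniformity_fsvec_def
        open_fsvec_def)
  define S where "S = {i. coord x i \<noteq> 0} \<union> {i. coord y i \<noteq> 0} \<union> {i. coord z i \<noteq> 0}"
  have S: "finite S"
    unfolding S_def by (simp add: finite_support_coord)
  show "inner x y = inner y x"
    by (subst (1 2) inner_superset[OF S]) (auto simp: S_def mult.commute)
  have "{i. coord (x + y) i \<noteq> 0} \<subseteq> S" "{i. coord x i \<noteq> 0} \<subseteq> S" "{i. coord y i \<noteq> 0} \<subseteq> S"
    by (auto simp: S_def plus_fsvec.rep_eq)
  then show "inner (x + y) z = inner x z + inner y z"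
    by (simp add: inner_superset[OF S] plus_fsvec.rep_eq ring_distribs sum.distrib)
  have "{i. coord (a *\<^sub>R x) i \<noteq> 0} \<subseteq> S" "{i. coord x i \<noteq> 0} \<subseteq> S"
    by (auto simp: S_def scaleR_fsvec.rep_eq)
  then show "inner (a *\<^sub>R x) y = a * inner x y"
    by (simp add: inner_superset[OF S] scaleR_fsvec.rep_eq sum_distrib_left mult.assoc)
  show "0 \<le> inner x x"
    unfolding inner_fsvec_def by (intro sum_nonneg) auto
  show "inner x x = 0 \<longleftrightarrow> x = 0"
    unfolding inner_fsvec_def using finite_support_coord[of x]
    by (subst sum_nonneg_eq_0_iff) (auto intro!: fsvec_eqI simp: zero_fsvec.rep_eq)
qed

end

lift_definition basis_vec :: "nat \<Rightarrow> fsvec" is "\<lambda>i j. if j = i then 1 else 0"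
  by simp


subsection \<open>Simply-laced root systems\<close>

definition root_system :: "'a::real_inner set \<Rightarrow> bool" where
  "root_system \<Phi> \<longleftrightarrow>
     finite \<Phi> \<and> 0 \<notin> \<Phi> \<and>
     (\<forall>\<alpha>\<in>\<Phi>. \<forall>\<beta>\<in>\<Phi>. \<beta> - (2 * (\<alpha> \<bullet> \<beta>) / (\<alpha> \<bullet> \<alpha>)) *\<^sub>R \<alpha> \<in> \<Phi>) \<and>
     (\<forall>\<alpha>\<in>\<Phi>. \<forall>\<beta>\<in>\<Phi>. 2 * (\<alpha> \<bullet> \<beta>) / (\<alpha> \<bullet> \<alpha>) \<in> \<int>) \<and>
     (\<forall>\<alpha>\<in>\<Phi>. \<forall>c. c *\<^sub>R \<alpha> \<in> \<Phi> \<longrightarrow> c = 1 \<or> c = -1)"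

definition simply_laced_root_system :: "'a::real_inner set \<Rightarrow> bool" where
  "simply_laced_root_system \<Phi> \<longleftrightarrow> root_system \<Phi> \<and> (\<forall>\<alpha>\<in>\<Phi>. norm \<alpha> = sqrt 2)"

definition irreducible_system :: "'a::real_inner set \<Rightarrow> bool" where
  "irreducible_system \<Phi> \<longleftrightarrow>
     \<Phi> \<noteq> {} \<and>
     \<not> (\<exists>X Y. X \<noteq> {} \<and> Y \<noteq> {} \<and> \<Phi> = X \<union> Y \<and> (\<forall>x\<in>X. \<forall>y\<in>Y. x \<bullet> y = 0))"

text \<open>
  Only the values of \<open>f\<close> on the span of \<open>\<Phi>\<close> matter. As all roots have length \<open>sqrt 2\<close>, the inner
  products of roots are the Cartan integers.
\<close>

definition root_isomorphism ::
  "('a::real_inner \<Rightarrow> 'b::real_inner) \<Rightarrow> 'a set \<Rightarrow> 'b set \<Rightarrow> bool" where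
  "root_isomorphism f \<Phi> \<Psi> \<longleftrightarrow>
     linear f \<and> inj_on f (span \<Phi>) \<and> f ` \<Phi> = \<Psi> \<and> (\<forall>\<alpha>\<in>\<Phi>. \<forall>\<beta>\<in>\<Phi>. f \<alpha> \<bullet> f \<beta> = \<alpha> \<bullet> \<beta>)"

definition root_isomorphic :: "'a::real_inner set \<Rightarrow> 'b::real_inner set \<Rightarrow> bool" where
  "root_isomorphic \<Phi> \<Psi> \<longleftrightarrow> (\<exists>f. root_isomorphism f \<Phi> \<Psi>)"

text \<open>\<open>\<Phi>\<close> is of type \<open>\<Psi> \<times> \<Psi>'\<close>, i.e. it is an orthogonal union of a copy of \<open>\<Psi>\<close> and a copy of \<open>\<Psi>'\<close>.\<close>

definition isomorphic_to_product ::
  "'a::real_inner set \<Rightarrow> 'b::real_inner set \<Rightarrow> 'c::real_inner set \<Rightarrow> bool" where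
  "isomorphic_to_product \<Phi> \<Psi> \<Psi>' \<longleftrightarrow>
     (\<exists>X Y. \<Phi> = X \<union> Y \<and> (\<forall>x\<in>X. \<forall>y\<in>Y. x \<bullet> y = 0) \<and>
            root_isomorphic X \<Psi> \<and> root_isomorphic Y \<Psi>')"

text \<open>The standard coordinate models; for the exceptional types, those of Bourbaki (indices from 0).\<close>

definition root_A :: "nat \<Rightarrow> fsvec set" where
  "root_A n = {basis_vec i - basis_vec j | i j. i \<le> n \<and> j \<le> n \<and> i \<noteq> j}"

definition root_D :: "nat \<Rightarrow> fsvec set" where
  "root_D n = {s *\<^sub>R basis_vec i + t *\<^sub>R basis_vec j | s t i j. s \<in> {-1, 1} \<and> t \<in> {-1, 1} \<and> i < j \<and> j < n}"

definition root_E8 :: "fsvec set" where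
  "root_E8 = root_D 8 \<union>
     {x. (\<forall>i<8. coord x i \<in> {-1/2, 1/2}) \<and> (\<forall>i\<ge>8. coord x i = 0) \<and>
         even (card {i. coord x i < 0})}"

definition root_E7 :: "fsvec set" where
  "root_E7 = {x \<in> root_E8. coord x 6 = - coord x 7}"

definition root_E6 :: "fsvec set" where
  "root_E6 = {x \<in> root_E8. coord x 5 = coord x 6 \<and> coord x 6 = - coord x 7}"


subsection \<open>3-gradings\<close>

text \<open>
  A 3-grading is a family \<open>G\<close> indexed by the integers and supported in degrees \<open>-1, 0, 1\<close>.
  The last conjunct follows from the others, except that on components of type \<open>A\<^sub>1\<close> they would
  also admit a root and its negative both of degree \<open>1\<close> (or both of degree \<open>-1\<close>), because \<open>0\<close> is
  not counted as a root; such partitions are not induced by any vector \<open>q\<close>.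
\<close>

definition three_grading :: "'a::real_inner set \<Rightarrow> (int \<Rightarrow> 'a set) \<Rightarrow> bool" where
  "three_grading \<Phi> G \<longleftrightarrow>
     \<Phi> = G (-1) \<union> G 0 \<union> G 1 \<and>
     (\<forall>i j. i \<noteq> j \<longrightarrow> G i \<inter> G j = {}) \<and>
     (\<forall>i. i \<notin> {-1, 0, 1} \<longrightarrow> G i = {}) \<and>
     (\<forall>a\<in>{-1, 0, 1}. \<forall>b\<in>{-1, 0, 1}. \<Phi> \<inter> {\<alpha> + \<beta> | \<alpha> \<beta>. \<alpha> \<in> G a \<and> \<beta> \<in> G b} \<subseteq> G (a + b)) \<and>
     \<Phi> \<inter> {\<alpha> - \<beta> | \<alpha> \<beta>. \<alpha> \<in> G 1 \<and> \<beta> \<in> G 1} = G 0 \<and>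
     G (-1) = uminus ` G 1"


subsection \<open>Sequences of nested 3-gradings\<close>

text \<open>
  A sequence with \<open>m\<close> arrows is given by the list \<open>\<Phi>s\<close> of its \<open>m + 1\<close> terms, from left to right,
  and the list \<open>Gs\<close> of the 3-gradings of its first \<open>m\<close> terms. Thus \<open>\<Phi>s ! j\<close> is the term with
  superscript \<open>m - j\<close>, and \<open>Gs ! j\<close> belongs to the arrow from \<open>\<Phi>s ! j\<close> to \<open>\<Phi>s ! Suc j\<close>.
\<close>

definition nested_sequence :: "'a::real_inner set list \<Rightarrow> (int \<Rightarrow> 'a set) list \<Rightarrow> bool" where
  "nested_sequence \<Phi>s Gs \<longleftrightarrow>
     length Gs \<ge> 1 \<and> length \<Phi>s = Suc (length Gs) \<and>
     (\<forall>\<Phi>\<in>set \<Phi>s. simply_laced_root_system \<Phi> \<and> \<Phi> \<noteq> {}) \<and>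
     (\<forall>j<length Gs. irreducible_system (\<Phi>s ! j) \<and> three_grading (\<Phi>s ! j) (Gs ! j) \<and>
                    \<Phi>s ! Suc j = (Gs ! j) 0)"

text \<open>
  Two 3-gradings differing only by the exchange of the degrees \<open>1\<close> and \<open>-1\<close> have the same binary
  decomposition and are identified, independently for every arrow. Without this, uniqueness would
  fail: for instance, the stabilizer of a 3-grading of \<open>E\<^sub>7\<close> acts on the degree \<open>0\<close> part as the Weyl
  group of \<open>E\<^sub>6\<close>, which does not contain \<open>-1\<close>, so it does not carry a 3-grading of \<open>E\<^sub>6\<close> to its
  opposite.
\<close>

definition carries_grading :: "('a \<Rightarrow> 'b) \<Rightarrow> (int \<Rightarrow> 'a set) \<Rightarrow> (int \<Rightarrow> 'b set) \<Rightarrow> bool" where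
  "carries_grading f G H \<longleftrightarrow> (\<forall>i. f ` G i = H i) \<or> (\<forall>i. f ` G i = H (- i))"

definition sequence_isomorphic ::
  "'a::real_inner set list \<Rightarrow> (int \<Rightarrow> 'a set) list \<Rightarrow>
   'b::real_inner set list \<Rightarrow> (int \<Rightarrow> 'b set) list \<Rightarrow> bool" where
  "sequence_isomorphic \<Phi>s Gs \<Psi>s Hs \<longleftrightarrow>
     (\<exists>f. root_isomorphism f (hd \<Phi>s) (hd \<Psi>s) \<and>
          list_all2 (\<lambda>\<Phi> \<Psi>. f ` \<Phi> = \<Psi>) \<Phi>s \<Psi>s \<and>
          list_all2 (carries_grading f) Gs Hs)"

definition embeddable :: "fsvec set list \<Rightarrow> (int \<Rightarrow> fsvec set) list \<Rightarrow> bool" where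
  "embeddable \<Phi>s Gs \<longleftrightarrow>
     (\<exists>(\<Psi>s :: fsvec set list) Hs k. nested_sequence \<Psi>s Hs \<and> length \<Psi>s > length \<Phi>s \<and>
        k + length \<Phi>s \<le> length \<Psi>s \<and>
        sequence_isomorphic \<Phi>s Gs (take (length \<Phi>s) (drop k \<Psi>s)) (take (length Gs) (drop k Hs)))"

definition maximal_sequence :: "'a::real_inner set list \<Rightarrow> (int \<Rightarrow> 'a set) list \<Rightarrow> bool" where
  "maximal_sequence \<Phi>s Gs \<longleftrightarrow>
     (\<forall>j<length Gs. \<forall>H. three_grading (\<Phi>s ! j) H \<longrightarrow> card (H 1) \<le> card ((Gs ! j) 1))"


subsection \<open>Local sequences\<close>

text \<open>
  The graph of an arrow has vertex set \<open>G 1\<close> and adjacency relation \<open>nonorthogonal\<close>: distinct roots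
  of degree \<open>1\<close> span distinct lines. All graphs below are induced subgraphs for this relation, so
  they are given by their vertex sets.
\<close>

definition nonorthogonal :: "'a::real_inner \<Rightarrow> 'a \<Rightarrow> bool" where
  "nonorthogonal \<alpha> \<beta> \<longleftrightarrow> \<alpha> \<noteq> \<beta> \<and> \<alpha> \<bullet> \<beta> \<noteq> 0"

definition graph_isomorphic :: "'a::real_inner set \<Rightarrow> 'a set \<Rightarrow> bool" where
  "graph_isomorphic V W \<longleftrightarrow>
     (\<exists>\<phi>. bij_betw \<phi> V W \<and>
          (\<forall>x\<in>V. \<forall>y\<in>V. nonorthogonal x y \<longleftrightarrow> nonorthogonal (\<phi> x) (\<phi> y)))"

definition neighbours :: "'a::real_inner set \<Rightarrow> 'a \<Rightarrow> 'a set" where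
  "neighbours V v = {w \<in> V. nonorthogonal v w}"

definition local_sequence :: "(int \<Rightarrow> 'a::real_inner set) list \<Rightarrow> bool" where
  "local_sequence Gs \<longleftrightarrow>
     (\<forall>j. Suc j < length Gs \<longrightarrow>
        (\<forall>v\<in>(Gs ! j) 1. graph_isomorphic ((Gs ! Suc j) 1) (neighbours ((Gs ! j) 1) v)))"

end

theory Submission
  imports Defs
begin

text \<open>
  A 3-grading is given by a vector \<open>q\<close> of the span. If \<open>q \<bullet> q < 3/2\<close> for some 3-grading of the first
  term, then adjoining a vector \<open>q + c e\<close> of norm 2, with \<open>e\<close> a new direction, produces a larger root
  system with a 3-grading whose part of degree 0 is the given system, so the sequence extends to the
  left. In general, a 3-graded system is determined by the grading that a root of degree 1 induces on
  the part of degree 0, and the roots of degree 1 for the induced grading do not contain three that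
  are pairwise orthogonal. Hence descending along induced gradings leads to type \<open>A\<close> at once or ends
  with a part of type \<open>A\<^sub>1 \<times> A\<^sub>l\<close>. As the norms of \<open>q\<close> and of the induced weight \<open>p\<close> obey
  \<open>p \<bullet> p = 2 - 1 / (q \<bullet> q)\<close>, the only system without a 3-grading of norm less than \<open>3/2\<close> is \<open>E\<^sub>7\<close>,
  four steps above \<open>A\<^sub>1 \<times> A\<^sub>2\<close>. In the terms of its sequence, the weights modulo the roots form cyclic
  groups of order 2, 3, 4, 5, and a maximal 3-grading is congruent to plus or minus a generator. It is
  therefore induced, up to sign, by a root of degree 1 of the preceding term, and reflections that
  fix the preceding gradings move it to the standard one.
\<close>

section \<open>Integral spans\<close>

text \<open>No classification of root systems is available, so lattices carry the argument: a
  simply-laced root system is the set of all norm 2 vectors of its integral span, and statements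
  about roots reduce to statements about a few generators. The bound \<open>3/2\<close> is where a
  degree 2 root can appear. With \<open>h \<bullet> h = 3/2\<close> the new direction contributes
  \<open>c * c = 1/2\<close>, and a vector of degree 2 then has norm at least
  \<open>4 * (1/2) = 2\<close>, which is attained by a root of E8. This borderline case is exactly
  E7. Solved for \<open>q \<bullet> q\<close>, the relation between the two norms is the map x ->
  1/(2 - x) applied to \<open>p \<bullet> p\<close>. A weight and its negative usually lie in
  different cosets of the root lattice, so gradings can be matched only up to one sign for each
  arrow.\<close>

inductive_set zspan :: "'a::real_vector set \<Rightarrow> 'a set" for S where
  zero: "0 \<in> zspan S"
| add: "x \<in> zspan S \<Longrightarrow> s \<in> S \<Longrightarrow> x + s \<in> zspan S"
| diff: "x \<in> zspan S \<Longrightarrow> s \<in> S \<Longrightarrow> x - s \<in> zspan S"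

lemma zspan_base: "s \<in> S \<Longrightarrow> s \<in> zspan S"
  using zspan.add[OF zspan.zero] by fastforce

lemma zspan_add: "x \<in> zspan S \<Longrightarrow> y \<in> zspan S \<Longrightarrow> x + y \<in> zspan S"
  by (rotate_tac, induction rule: zspan.induct)
     (auto simp: add.assoc[symmetric] add_diff_eq intro: zspan.intros)

lemma zspan_minus: "x \<in> zspan S \<Longrightarrow> - x \<in> zspan S"
proof (induction rule: zspan.induct)
  case (add x s)
  then show ?case using zspan.diff[of "- x" S s] by simp
next
  case (diff x s)
  then show ?case using zspan.add[of "- x" S s] by simp
qed (simp add: zspan.zero)

lemma zspan_diff: "x \<in> zspan S \<Longrightarrow> y \<in> zspan S \<Longrightarrow> x - y \<in> zspan S"
  using zspan_add[of x S "- y"] zspan_minus[of y S] by simp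

lemma zspan_of_nat: "x \<in> zspan S \<Longrightarrow> of_nat n *\<^sub>R x \<in> zspan S"
  by (induction n) (auto simp: algebra_simps intro: zspan_add zspan.zero)

lemma zspan_of_int: "x \<in> zspan S \<Longrightarrow> of_int k *\<^sub>R x \<in> zspan S"
  using zspan_of_nat[of x S "nat k"] zspan_minus[OF zspan_of_nat[of x S "nat (- k)"]]
  by (cases "k \<ge> 0") auto

lemma zspan_Ints: "x \<in> zspan S \<Longrightarrow> c \<in> \<int> \<Longrightarrow> c *\<^sub>R x \<in> zspan S"
  by (metis Ints_cases zspan_of_int)

lemma zspan_le: "S \<subseteq> zspan T \<Longrightarrow> x \<in> zspan S \<Longrightarrow> x \<in> zspan T"
  by (rotate_tac, induction rule: zspan.induct) (auto intro: zspan.zero zspan_add zspan_diff)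

lemma zspan_mono: "S \<subseteq> T \<Longrightarrow> zspan S \<subseteq> zspan T"
  by (meson subsetD subsetI zspan_base zspan_le)

lemma zspan_subset_span: "zspan S \<subseteq> span S"
proof
  fix x assume "x \<in> zspan S"
  then show "x \<in> span S"
    by induction (auto intro: span_zero span_add span_diff span_base)
qed

text \<open>The integer \<open>k\<close> later serves as a degree: pairing with a vector that is 1
  on \<open>v\<close> and 0 on \<open>S\<close> reads it off.\<close>

lemma zspan_insertE:
  assumes "x \<in> zspan (insert v S)"
  obtains k :: int and y where "y \<in> zspan S" "x = of_int k *\<^sub>R v + y"
proof -
  have "\<exists>(k::int) y. y \<in> zspan S \<and> x = of_int k *\<^sub>R v + y"
    using assms
  proof induction
    case zero
    show ?case by (rule exI[of _ 0]) (auto intro: zspan.zero)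
  next
    case (add x s)
    then obtain k :: int and y where y: "y \<in> zspan S" "x = of_int k *\<^sub>R v + y" by blast
    show ?case
    proof (cases "s = v")
      case True
      then show ?thesis
        using y by (intro exI[of _ "k + 1"] exI[of _ y]) (simp add: algebra_simps)
    next
      case False
      then show ?thesis
        using y add by (intro exI[of _ k] exI[of _ "y + s"]) (auto simp: add.assoc intro: zspan.add)
    qed
  next
    case (diff x s)
    then obtain k :: int and y where y: "y \<in> zspan S" "x = of_int k *\<^sub>R v + y" by blast
    show ?case
    proof (cases "s = v")
      case True
      then show ?thesis
        using y by (intro exI[of _ "k - 1"] exI[of _ y]) (simp add: algebra_simps)
    next
      case False
      then show ?thesis
        using y diff by (intro exI[of _ k] exI[of _ "y - s"]) (auto simp: add_diff_eq intro: zspan.diff)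
    qed
  qed
  then show ?thesis using that by blast
qed

lemma zspan_inner_eq:
  fixes f g :: "'a::real_inner"
  assumes "x \<in> zspan S" "\<And>s. s \<in> S \<Longrightarrow> f \<bullet> s = g \<bullet> s"
  shows "f \<bullet> x = g \<bullet> x"
  using assms(1) by induction (auto simp: inner_add_right inner_diff_right assms(2))

lemma zspan_inner_0:
  fixes f :: "'a::real_inner"
  assumes "x \<in> zspan S" "\<And>s. s \<in> S \<Longrightarrow> f \<bullet> s = 0"
  shows "f \<bullet> x = 0"
  using assms(1) by induction (auto simp: inner_add_right inner_diff_right assms(2))

lemma zspan_inner_Ints:
  fixes f :: "'a::real_inner"
  assumes "x \<in> zspan S" "\<And>s. s \<in> S \<Longrightarrow> f \<bullet> s \<in> \<int>"
  shows "f \<bullet> x \<in> \<int>"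
  using assms(1) by induction (auto simp: inner_add_right inner_diff_right assms(2))

lemma zspan_inner_Ints2:
  fixes x :: "'a::real_inner"
  assumes "x \<in> zspan S" "y \<in> zspan S" "\<And>s t. s \<in> S \<Longrightarrow> t \<in> S \<Longrightarrow> s \<bullet> t \<in> \<int>"
  shows "x \<bullet> y \<in> \<int>"
  by (metis assms inner_commute zspan_inner_Ints)

lemma span_orthogonal_0:
  fixes x :: "'a::real_inner"
  assumes "x \<in> span S" "\<And>s. s \<in> S \<Longrightarrow> x \<bullet> s = 0"
  shows "x = 0"
proof -
  have "x \<bullet> y = 0" if "y \<in> span S" for y
    using that by (induction rule: span_induct_alt) (auto simp: inner_add_right assms(2))
  from this[OF assms(1)] show ?thesis by simp
qed

lemma span_inner_eqI:
  fixes x :: "'a::real_inner"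
  assumes "x \<in> span S" "y \<in> span S" "\<And>s. s \<in> S \<Longrightarrow> x \<bullet> s = y \<bullet> s"
  shows "x = y"
  using span_orthogonal_0[of "x - y" S] assms by (simp add: span_diff inner_diff_left)

lemma zspan_image:
  assumes "linear f"
  shows "f ` zspan S = zspan (f ` S)"
proof (rule set_eqI, rule iffI)
  fix x assume "x \<in> f ` zspan S"
  then obtain y where y: "y \<in> zspan S" "x = f y" by auto
  have "f y \<in> zspan (f ` S)"
    using y(1) by induction (auto simp: linear_0 linear_add linear_diff assms intro: zspan.intros)
  then show "x \<in> zspan (f ` S)" using y by simp
next
  fix x assume "x \<in> zspan (f ` S)"
  then show "x \<in> f ` zspan S"
  proof induction
    case zero
    then show ?case using linear_0[OF assms] by (metis image_eqI zspan.zero)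
  next
    case (add x s)
    then obtain y t where "y \<in> zspan S" "x = f y" "t \<in> S" "s = f t" by auto
    then show ?case using linear_add[OF assms, of y t] by (metis image_eqI zspan.add)
  next
    case (diff x s)
    then obtain y t where "y \<in> zspan S" "x = f y" "t \<in> S" "s = f t" by auto
    then show ?case using linear_diff[OF assms, of y t] by (metis image_eqI zspan.diff)
  qed
qed

lemma square_less_4: "k * k < 4 \<Longrightarrow> k \<in> {-1, 0, 1}" for k :: int
proof -
  assume "k * k < 4"
  then have "k < 2" "- 2 < k"
    using mult_mono[of 2 k 2 k] mult_mono[of 2 "- k" 2 "- k"] by linarith+
  then show ?thesis by auto
qed

section \<open>Simply-laced root systems\<close>

abbreviation "slrs \<equiv> simply_laced_root_system"

lemma root_norm: "slrs \<Phi> \<Longrightarrow> \<alpha> \<in> \<Phi> \<Longrightarrow> \<alpha> \<bullet> \<alpha> = 2"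
  unfolding simply_laced_root_system_def norm_eq_sqrt_inner by force

lemma root_finite: "slrs \<Phi> \<Longrightarrow> finite \<Phi>"
  unfolding simply_laced_root_system_def root_system_def by simp

lemma root_reflect:
  assumes "slrs \<Phi>" "\<alpha> \<in> \<Phi>" "\<beta> \<in> \<Phi>"
  shows "\<beta> - (\<alpha> \<bullet> \<beta>) *\<^sub>R \<alpha> \<in> \<Phi>"
proof -
  have "\<beta> - (2 * (\<alpha> \<bullet> \<beta>) / (\<alpha> \<bullet> \<alpha>)) *\<^sub>R \<alpha> \<in> \<Phi>"
    using assms unfolding simply_laced_root_system_def root_system_def by simp
  then show ?thesis using root_norm[OF assms(1,2)] by simp
qed

lemma root_inner_Ints:
  assumes "slrs \<Phi>" "\<alpha> \<in> \<Phi>" "\<beta> \<in> \<Phi>"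
  shows "\<alpha> \<bullet> \<beta> \<in> \<int>"
proof -
  have "2 * (\<alpha> \<bullet> \<beta>) / (\<alpha> \<bullet> \<alpha>) \<in> \<int>"
    using assms unfolding simply_laced_root_system_def root_system_def by simp
  then show ?thesis using root_norm[OF assms(1,2)] by simp
qed

lemma root_minus: 
  assumes "slrs \<Phi>" "\<alpha> \<in> \<Phi>"
  shows "- \<alpha> \<in> \<Phi>"
  using root_reflect[OF assms assms(2)] root_norm[OF assms] by (simp add: scaleR_2)

lemma root_diff: "slrs \<Phi> \<Longrightarrow> \<alpha> \<in> \<Phi> \<Longrightarrow> \<beta> \<in> \<Phi> \<Longrightarrow> \<alpha> \<bullet> \<beta> = 1 \<Longrightarrow> \<alpha> - \<beta> \<in> \<Phi>"
  using root_reflect[of \<Phi> \<beta> \<alpha>] by (simp add: inner_commute)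

lemma root_add: "slrs \<Phi> \<Longrightarrow> \<alpha> \<in> \<Phi> \<Longrightarrow> \<beta> \<in> \<Phi> \<Longrightarrow> \<alpha> \<bullet> \<beta> = -1 \<Longrightarrow> \<alpha> + \<beta> \<in> \<Phi>"
  using root_reflect[of \<Phi> \<beta> \<alpha>] by (simp add: inner_commute)

lemma root_inner_cases:
  assumes "slrs \<Phi>" "\<alpha> \<in> \<Phi>" "\<beta> \<in> \<Phi>"
  obtains "\<beta> = \<alpha>" "\<alpha> \<bullet> \<beta> = 2" | "\<alpha> \<bullet> \<beta> = 1" | "\<alpha> \<bullet> \<beta> = 0" | "\<alpha> \<bullet> \<beta> = -1" | "\<beta> = -\<alpha>" "\<alpha> \<bullet> \<beta> = -2"
proof -
  obtain k where k: "\<alpha> \<bullet> \<beta> = of_int k"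
    using root_inner_Ints[OF assms] by (auto elim: Ints_cases)
  have 1: "(\<alpha> - \<beta>) \<bullet> (\<alpha> - \<beta>) = 4 - 2 * of_int k" "(\<alpha> + \<beta>) \<bullet> (\<alpha> + \<beta>) = 4 + 2 * of_int k"
    using k root_norm[OF assms(1)] assms
    by (simp_all add: inner_diff_left inner_diff_right inner_add_left inner_add_right inner_commute)
  have "k \<le> 2" "-2 \<le> k"
    using 1 inner_ge_zero[of "\<alpha> - \<beta>"] inner_ge_zero[of "\<alpha> + \<beta>"] by linarith+
  then consider "k = 2" | "k = 1" | "k = 0" | "k = -1" | "k = -2" by linarith
  then show ?thesis
  proof cases
    case 1
    then have "\<alpha> - \<beta> = 0" using \<open>(\<alpha> - \<beta>) \<bullet> (\<alpha> - \<beta>) = 4 - 2 * of_int k\<close> by simp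
    then show ?thesis using that(1) k 1 by simp
  next
    case 5
    then have "\<alpha> + \<beta> = 0" using \<open>(\<alpha> + \<beta>) \<bullet> (\<alpha> + \<beta>) = 4 + 2 * of_int k\<close> by simp
    then have "\<beta> = - \<alpha>" by (metis neg_eq_iff_add_eq_0)
    then show ?thesis using that(5) k 5 by simp
  qed (use that k in auto)
qed

lemma root_eqI:
  assumes "slrs \<Phi>" "\<alpha> \<in> \<Phi>" "\<beta> \<in> \<Phi>" "\<alpha> \<bullet> \<beta> = 2"
  shows "\<alpha> = \<beta>"
  by (rule root_inner_cases[OF assms(1-3)]) (use assms(4) in auto)

lemma slrsI:
  assumes "finite \<Phi>" "\<And>\<alpha>. \<alpha> \<in> \<Phi> \<Longrightarrow> \<alpha> \<bullet> \<alpha> = 2"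
    "\<And>\<alpha> \<beta>. \<alpha> \<in> \<Phi> \<Longrightarrow> \<beta> \<in> \<Phi> \<Longrightarrow> \<alpha> \<bullet> \<beta> \<in> \<int>"
    "\<And>\<alpha> \<beta>. \<alpha> \<in> \<Phi> \<Longrightarrow> \<beta> \<in> \<Phi> \<Longrightarrow> \<beta> - (\<alpha> \<bullet> \<beta>) *\<^sub>R \<alpha> \<in> \<Phi>"
  shows "slrs \<Phi>"
  unfolding simply_laced_root_system_def root_system_def
proof (intro conjI ballI allI impI)
  show "0 \<notin> \<Phi>" using assms(2)[of 0] by auto
  fix \<alpha> assume a: "\<alpha> \<in> \<Phi>"
  show "norm \<alpha> = sqrt 2" using assms(2)[OF a] by (simp add: norm_eq_sqrt_inner)
  fix c assume "c *\<^sub>R \<alpha> \<in> \<Phi>"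
  from assms(2)[OF this] assms(2)[OF a] have "c * c = 1" by simp
  then show "c = 1 \<or> c = - 1" by (simp add: square_eq_1_iff)
qed (use assms in auto)

text \<open>Reflection in a norm 2 vector subtracts an integral multiple of it, so it preserves an
  integral lattice as well as norms. The systems built by extension and the coordinate model of E7
  are obtained in this form.\<close>

lemma slrs_lattice:
  assumes "finite \<Phi>" "\<Phi> = {x \<in> L. x \<bullet> x = 2}" "\<And>x y. x \<in> L \<Longrightarrow> y \<in> L \<Longrightarrow> x - y \<in> L"
    "\<And>x y. x \<in> L \<Longrightarrow> y \<in> L \<Longrightarrow> x \<bullet> y \<in> \<int>"
  shows "slrs \<Phi>"
proof (rule slrsI)
  fix \<alpha> \<beta> assume ab: "\<alpha> \<in> \<Phi>" "\<beta> \<in> \<Phi>"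
  then have L: "\<alpha> \<in> L" "\<beta> \<in> L" using assms(2) by auto
  have zspan: "x \<in> L" if "x \<in> zspan {\<alpha>, \<beta>}" for x
    using that
  proof induction
    case zero
    then show ?case using assms(3)[OF L(1) L(1)] by simp
  next
    case (add x s)
    have "s \<in> L" using add L by auto
    then have "- s \<in> L" using assms(3)[of "s - s" s] assms(3)[of s s] by simp
    then show ?case using assms(3)[of x "- s"] add by simp
  next
    case (diff x s)
    then show ?case using assms(3)[of x s] L by auto
  qed
  have "(\<alpha> \<bullet> \<beta>) *\<^sub>R \<alpha> \<in> zspan {\<alpha>, \<beta>}" "\<beta> \<in> zspan {\<alpha>, \<beta>}"
    using assms(4)[OF L] by (auto intro: zspan_Ints zspan_base)
  then have "\<beta> - (\<alpha> \<bullet> \<beta>) *\<^sub>R \<alpha> \<in> L" by (intro zspan zspan_diff)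
  moreover have "(\<beta> - (\<alpha> \<bullet> \<beta>) *\<^sub>R \<alpha>) \<bullet> (\<beta> - (\<alpha> \<bullet> \<beta>) *\<^sub>R \<alpha>) = 2"
    using ab assms(2) by (simp add: inner_diff_left inner_diff_right inner_commute)
  ultimately show "\<beta> - (\<alpha> \<bullet> \<beta>) *\<^sub>R \<alpha> \<in> \<Phi>" using assms(2) by simp
qed (use assms in auto)

definition layer :: "'a::real_inner set \<Rightarrow> 'a \<Rightarrow> real \<Rightarrow> 'a set" where
  "layer \<Phi> q c = {\<alpha> \<in> \<Phi>. q \<bullet> \<alpha> = c}"

lemma slrs_layer_0:
  assumes "slrs \<Phi>" shows "slrs (layer \<Phi> q 0)"
  by (rule slrsI)
     (use assms root_norm root_inner_Ints root_reflect finite_subset[OF _ root_finite[OF assms]] in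
      \<open>auto simp: layer_def inner_diff_right\<close>)

section \<open>Lattice vectors as sums of roots with nonnegative inner products\<close>

lemma not_sorted_wrt_mset:
  assumes "\<not> sorted_wrt P xs"
  obtains a b ys where "mset xs = add_mset a (add_mset b (mset ys))" "\<not> P a b"
proof -
  have "\<exists>a b ys. mset xs = add_mset a (add_mset b (mset ys)) \<and> \<not> P a b"
    using assms
  proof (induction xs)
    case (Cons x xs)
    show ?case
    proof (cases "\<forall>y\<in>set xs. P x y")
      case True
      then obtain a b ys where "mset xs = add_mset a (add_mset b (mset ys))" "\<not> P a b"
        using Cons by auto
      then show ?thesis
        by (intro exI[of _ a] exI[of _ b] exI[of _ "x # ys"]) (simp add: add_mset_commute)
    next
      case False
      then obtain y where y: "y \<in> set xs" "\<not> P x y" by auto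
      then show ?thesis
        by (intro exI[of _ x] exI[of _ y] exI[of _ "remove1 y xs"]) simp
    qed
  qed simp
  then show ?thesis using that by blast
qed

lemma sum_list_mset_eq: "mset xs = mset ys \<Longrightarrow> sum_list xs = (sum_list ys :: 'a::comm_monoid_add)"
  by (metis sum_mset_sum_list)

text \<open>Replacing two summands of negative inner product by their sum shortens an expression.\<close>

lemma root_list_nonneg:
  fixes xs :: "'a::real_inner list"
  assumes "slrs \<Phi>" "set xs \<subseteq> \<Phi>"
  shows "\<exists>ys. set ys \<subseteq> \<Phi> \<and> sum_list ys = sum_list xs \<and> sorted_wrt (\<lambda>a b. a \<bullet> b \<ge> 0) ys"
  using assms(2)
proof (induction xs rule: length_induct)
  case (1 xs)
  show ?case
  proof (cases "sorted_wrt (\<lambda>a b. a \<bullet> b \<ge> 0) xs")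
    case True
    then show ?thesis using 1 by blast
  next
    case False
    then obtain a b ys where ab: "mset xs = add_mset a (add_mset b (mset ys))" "\<not> a \<bullet> b \<ge> 0"
      by (rule not_sorted_wrt_mset)
    then have "mset xs = mset (a # b # ys)" by simp
    from mset_eq_length[OF this] mset_eq_setD[OF this] sum_list_mset_eq[OF this]
    have xs: "length xs = Suc (Suc (length ys))" "a \<in> \<Phi>" "b \<in> \<Phi>" "set ys \<subseteq> \<Phi>"
      "sum_list xs = a + b + sum_list ys"
      using 1(2) by (auto simp: add.assoc)
    show ?thesis
    proof (rule root_inner_cases[OF assms(1) xs(2,3)])
      assume "a \<bullet> b = -1"
      then have "a + b \<in> \<Phi>" using root_add assms(1) xs by blast
      then show ?thesis
        using 1(1)[rule_format, of "(a + b) # ys"] xs by auto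
    next
      assume "b = - a"
      then show ?thesis
        using 1(1)[rule_format, of ys] xs by auto
    qed (use ab(2) in auto)
  qed
qed

lemma zspan_root_list:
  assumes "slrs \<Phi>" "x \<in> zspan \<Phi>"
  obtains xs where "set xs \<subseteq> \<Phi>" "x = sum_list xs" "sorted_wrt (\<lambda>a b. a \<bullet> b \<ge> 0) xs"
proof -
  have "\<exists>xs. set xs \<subseteq> \<Phi> \<and> x = sum_list xs"
    using assms(2)
  proof induction
    case zero
    then show ?case by (intro exI[of _ "[]"]) simp
  next
    case (add x s)
    then obtain xs where "set xs \<subseteq> \<Phi>" "x = sum_list xs" by auto
    then show ?case using add by (intro exI[of _ "s # xs"]) (auto simp: add.commute)
  next
    case (diff x s)
    then obtain xs where "set xs \<subseteq> \<Phi>" "x = sum_list xs" by auto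
    then show ?case using diff root_minus[OF assms(1)] by (intro exI[of _ "- s # xs"]) auto
  qed
  then show ?thesis using root_list_nonneg[OF assms(1)] that by metis
qed

text \<open>In the expanded square each diagonal term is 2 and no cross term is negative.\<close>

lemma sum_list_norm_ge:
  fixes xs :: "'a::real_inner list"
  assumes "sorted_wrt (\<lambda>a b. a \<bullet> b \<ge> 0) xs" "\<forall>x\<in>set xs. x \<bullet> x = 2"
  shows "sum_list xs \<bullet> sum_list xs \<ge> 2 * real (length xs)"
  using assms
proof (induction xs)
  case (Cons a xs)
  have "a \<bullet> sum_list xs \<ge> 0"
    using Cons(2) by (auto, induction xs) (auto simp: inner_add_right)
  moreover have "sum_list xs \<bullet> sum_list xs \<ge> 2 * real (length xs)" using Cons by simp
  ultimately show ?case using Cons(3)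
    by (simp add: inner_add_left inner_add_right inner_commute)
qed simp

text \<open>A sum of \<open>n\<close> roots with nonnegative inner products has norm at least
  \<open>2 * n\<close>, so norm 2 leaves a single summand. Hence a root system is determined by its
  lattice.\<close>

lemma zspan_norm_2:
  assumes "slrs \<Phi>" "x \<in> zspan \<Phi>" "x \<bullet> x = 2"
  shows "x \<in> \<Phi>"
proof -
  obtain xs where xs: "set xs \<subseteq> \<Phi>" "x = sum_list xs" "sorted_wrt (\<lambda>a b. a \<bullet> b \<ge> 0) xs"
    using zspan_root_list[OF assms(1,2)] .
  have "2 * real (length xs) \<le> 2"
    using sum_list_norm_ge[OF xs(3)] xs assms root_norm by (metis subsetD)
  then have "length xs \<le> 1" by simp
  then consider "xs = []" | a where "xs = [a]"
    by (cases xs) auto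
  then show ?thesis using xs assms(3) by cases auto
qed

text \<open>Write \<open>l\<close> as a sum of \<open>n\<close> roots with nonnegative inner
  products. Then \<open>l \<bullet> l\<close> is at least \<open>2 * n\<close>, while
  \<open>2 * (h \<bullet> l)\<close> is at least \<open>- 2 * n\<close>. So the weight of a grading
  is shortest in its coset of the root lattice.\<close>

lemma minuscule_minimal_norm:
  assumes "slrs \<Phi>" "l \<in> zspan \<Phi>" "\<forall>\<alpha>\<in>\<Phi>. h \<bullet> \<alpha> \<in> {-1, 0, 1}"
  shows "h \<bullet> h \<le> (h + l) \<bullet> (h + l)"
proof -
  obtain xs where xs: "set xs \<subseteq> \<Phi>" "l = sum_list xs" "sorted_wrt (\<lambda>a b. a \<bullet> b \<ge> 0) xs"
    using zspan_root_list[OF assms(1,2)] .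
  have "2 * real (length xs) \<le> l \<bullet> l"
    using sum_list_norm_ge[OF xs(3)] xs assms root_norm by (metis subsetD)
  moreover have "h \<bullet> sum_list xs \<ge> - real (length xs)"
    using xs(1)
  proof (induction xs)
    case (Cons a xs)
    have "h \<bullet> a \<ge> - 1" using Cons(2) assms(3) by force
    then show ?case using Cons by (simp add: inner_add_right)
  qed simp
  ultimately show ?thesis
    using xs(2) by (simp add: inner_add_left inner_add_right inner_commute)
qed

section \<open>Gradings by vectors\<close>

lemma irreducible_cases:
  assumes "irreducible_system \<Phi>" "\<Phi> = X \<union> Y" "\<And>x y. x \<in> X \<Longrightarrow> y \<in> Y \<Longrightarrow> x \<bullet> y = 0"
  shows "X = {} \<or> Y = {}"
  using assms unfolding irreducible_system_def by blast

text \<open>The vector \<open>q\<close> need not lie in the span of \<Phi>. This lets a root of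
  degree 1 itself act as a grading vector on the part of degree 0.\<close>

definition graded :: "'a::real_inner set \<Rightarrow> 'a \<Rightarrow> bool" where
  "graded \<Phi> q \<longleftrightarrow> slrs \<Phi> \<and> irreducible_system \<Phi> \<and>
     (\<forall>\<alpha>\<in>\<Phi>. q \<bullet> \<alpha> \<in> {-1, 0, 1}) \<and> (\<exists>\<alpha>\<in>\<Phi>. q \<bullet> \<alpha> \<noteq> 0)"

lemma graded_slrs: "graded \<Phi> q \<Longrightarrow> slrs \<Phi>"
  and graded_irreducible: "graded \<Phi> q \<Longrightarrow> irreducible_system \<Phi>"
  and graded_value: "graded \<Phi> q \<Longrightarrow> \<alpha> \<in> \<Phi> \<Longrightarrow> q \<bullet> \<alpha> \<in> {-1, 0, 1}"
  by (auto simp: graded_def)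

lemma graded_cases:
  assumes "graded \<Phi> q" "\<alpha> \<in> \<Phi>"
  obtains "\<alpha> \<in> layer \<Phi> q 1" | "\<alpha> \<in> layer \<Phi> q 0" | "- \<alpha> \<in> layer \<Phi> q 1"
  using graded_value[OF assms] assms root_minus[OF graded_slrs[OF assms(1)]] by (auto simp: layer_def)

lemma graded_cong:
  "(\<And>\<alpha>. \<alpha> \<in> \<Phi> \<Longrightarrow> q \<bullet> \<alpha> = q' \<bullet> \<alpha>) \<Longrightarrow> graded \<Phi> q \<longleftrightarrow> graded \<Phi> q'"
  unfolding graded_def by simp

lemma layer_cong:
  "(\<And>\<alpha>. \<alpha> \<in> \<Phi> \<Longrightarrow> q \<bullet> \<alpha> = q' \<bullet> \<alpha>) \<Longrightarrow> layer \<Phi> q c = layer \<Phi> q' c"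
  unfolding layer_def by auto

lemma layer_minus: "layer \<Phi> (- q) c = layer \<Phi> q (- c)"
  unfolding layer_def by auto

lemma layer_1_nonempty:
  assumes "graded \<Phi> q"
  obtains v where "v \<in> layer \<Phi> q 1"
proof -
  obtain \<alpha> where "\<alpha> \<in> \<Phi>" "q \<bullet> \<alpha> \<noteq> 0" using assms unfolding graded_def by auto
  then have "\<alpha> \<in> layer \<Phi> q 1 \<or> - \<alpha> \<in> layer \<Phi> q 1"
    by (elim graded_cases[OF assms, of \<alpha>]) (auto simp: layer_def)
  then show ?thesis using that by blast
qed

lemma layer_1_inner:
  assumes "graded \<Phi> q" "a \<in> layer \<Phi> q 1" "b \<in> layer \<Phi> q 1"
  obtains "b = a" "a \<bullet> b = 2" | "a \<bullet> b = 1" | "a \<bullet> b = 0"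
proof -
  have ab: "a \<in> \<Phi>" "b \<in> \<Phi>" "q \<bullet> a = 1" "q \<bullet> b = 1" using assms by (auto simp: layer_def)
  show ?thesis
  proof (rule root_inner_cases[OF graded_slrs[OF assms(1)] ab(1,2)])
    assume "a \<bullet> b = -1"
    then have "a + b \<in> \<Phi>" using root_add graded_slrs assms(1) ab by blast
    then show ?thesis using graded_value[OF assms(1)] ab by (force simp: inner_add_right)
  next
    assume "b = - a"
    then show ?thesis using ab by simp
  qed (use that in auto)
qed

lemma layer_10_inner:
  assumes "graded \<Phi> q" "a \<in> layer \<Phi> q 1" "b \<in> layer \<Phi> q 0"
  shows "a \<bullet> b \<in> {-1, 0, 1}"
proof -
  have ab: "a \<in> \<Phi>" "b \<in> \<Phi>" "q \<bullet> a = 1" "q \<bullet> b = 0" using assms by (auto simp: layer_def)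
  then show ?thesis
    by (elim root_inner_cases[OF graded_slrs[OF assms(1)], of a b]) auto
qed

lemma layer_1_diff:
  assumes "graded \<Phi> q" "a \<in> layer \<Phi> q 1" "b \<in> layer \<Phi> q 0" "a \<bullet> b = 1"
  shows "a - b \<in> layer \<Phi> q 1"
  using assms root_diff[OF graded_slrs[OF assms(1)], of a b] by (auto simp: layer_def inner_diff_right)

text \<open>The graph on the roots of degree 1 is connected, since its components generate orthogonal parts
  of the root system.\<close>

lemma layer_1_induct [consumes 3, case_names base step]:
  assumes "graded \<Phi> q" "v \<in> layer \<Phi> q 1" "w \<in> layer \<Phi> q 1"
    and "P v"
    and "\<And>u \<gamma>. u \<in> layer \<Phi> q 1 \<Longrightarrow> \<gamma> \<in> layer \<Phi> q 0 \<Longrightarrow> u \<bullet> \<gamma> = 1 \<Longrightarrow>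
           u - \<gamma> \<in> layer \<Phi> q 1 \<Longrightarrow> P u \<Longrightarrow> P (u - \<gamma>)"
  shows "P w"
proof -
  note sl = graded_slrs[OF assms(1)]
  define r where "r = {(u, w). u \<in> layer \<Phi> q 1 \<and> w \<in> layer \<Phi> q 1 \<and> u \<bullet> w = 1}"
  define C where "C = {u \<in> layer \<Phi> q 1. (v, u) \<in> r\<^sup>*}"
  define X where "X = {\<alpha> \<in> \<Phi>. \<exists>u\<in>C. \<alpha> \<bullet> u \<noteq> 0}"
  have C: "x \<in> C" if "x \<in> layer \<Phi> q 1" "u \<in> C" "x \<bullet> u \<noteq> 0" for x u
  proof -
    have u: "u \<in> layer \<Phi> q 1" using that by (auto simp: C_def)
    show ?thesis
    proof (rule layer_1_inner[OF assms(1) u that(1)])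
      assume "u \<bullet> x = 1"
      then have "(u, x) \<in> r" using u that by (auto simp: r_def)
      then show ?thesis using that by (auto simp: C_def intro: rtrancl_into_rtrancl)
    qed (use that in \<open>auto simp: inner_commute\<close>)
  qed
  have "X = {} \<or> \<Phi> - X = {}"
  proof (rule irreducible_cases[OF graded_irreducible[OF assms(1)]])
    fix x y assume x: "x \<in> X" and y: "y \<in> \<Phi> - X"
    then have yC: "u \<bullet> y = 0" if "u \<in> C" for u
      using that unfolding X_def by (auto simp: inner_commute)
    obtain u where u: "u \<in> C" "x \<bullet> u \<noteq> 0" "x \<in> \<Phi>" using x by (auto simp: X_def)
    then have u1: "u \<in> layer \<Phi> q 1" by (simp add: C_def)
    show "x \<bullet> y = 0"
    proof (rule graded_cases[OF assms(1) u(3)])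
      assume "x \<in> layer \<Phi> q 1"
      then show ?thesis using C u yC by blast
    next
      assume "- x \<in> layer \<Phi> q 1"
      then have "- x \<in> C" by (rule C[OF _ u(1)]) (use u in auto)
      then show ?thesis using yC[of "- x"] by simp
    next
      \<comment> \<open>Up to sign, \<open>x\<close> is the difference of \<open>u\<close> and a
        neighbour \<open>u - z\<close>. Both belong to the component \<open>C\<close>, so both are
        orthogonal to \<open>y\<close>.\<close>
      assume x0: "x \<in> layer \<Phi> q 0"
      then have mx0: "- x \<in> layer \<Phi> q 0" using root_minus[OF sl] by (auto simp: layer_def)
      have "\<exists>z \<in> {x, - x}. u \<bullet> z = 1 \<and> z \<in> layer \<Phi> q 0"
        using layer_10_inner[OF assms(1) u1 x0] u(2) x0 mx0 by (auto simp: inner_commute)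
      then obtain z where z: "z \<in> {x, - x}" "u \<bullet> z = 1" "z \<in> layer \<Phi> q 0" by blast
      have "(u - z) \<bullet> u = 1"
        using z root_norm[OF sl, of u] u1 by (auto simp: inner_diff_left inner_diff_right layer_def inner_commute)
      then have "u - z \<in> C"
        by (intro C[OF layer_1_diff[OF assms(1) u1 z(3,2)] u(1)]) auto
      then have "z \<bullet> y = 0" using yC[of "u - z"] yC[OF u(1)] by (simp add: inner_diff_left)
      then show ?thesis using z(1) by auto
    qed
  qed (auto simp: X_def)
  moreover have "v \<in> X"
    using assms(2) root_norm[OF sl, of v] by (auto simp: X_def C_def layer_def intro!: bexI[of _ v])
  ultimately have "w \<in> X" using assms(3) by (auto simp: layer_def)
  then have "w \<in> C" using C[OF assms(3)] by (auto simp: X_def)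
  then have "(v, w) \<in> r\<^sup>*" by (simp add: C_def)
  then show ?thesis
  proof induction
    case (step u w)
    then have uw: "u \<in> layer \<Phi> q 1" "w \<in> layer \<Phi> q 1" "u \<bullet> w = 1" by (auto simp: r_def)
    then have "u - w \<in> layer \<Phi> q 0" 
      using root_diff[OF sl, of u w] by (auto simp: layer_def inner_diff_right)
    moreover have "u \<bullet> (u - w) = 1"
      using uw root_norm[OF sl, of u] by (simp add: layer_def inner_diff_right)
    ultimately show ?case using assms(5)[of u "u - w"] uw step by simp
  qed (rule assms(4))
qed

text \<open>Subtracting the three roots from \<open>v\<close> one after the other stays in degree 1
  and ends at a root whose inner product with \<open>v\<close> is 2 - 3 = -1. Two roots of degree 1
  never have a negative product, since their sum would be a root of degree 2.\<close>

lemma no_orthogonal_triple: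
  assumes "graded \<Phi> q" "v \<in> layer \<Phi> q 1"
    "a \<in> layer \<Phi> q 0" "b \<in> layer \<Phi> q 0" "c \<in> layer \<Phi> q 0"
    "v \<bullet> a = 1" "v \<bullet> b = 1" "v \<bullet> c = 1" "a \<bullet> b = 0" "a \<bullet> c = 0" "b \<bullet> c = 0"
  shows False
proof -
  have 1: "v - a \<in> layer \<Phi> q 1" by (intro layer_1_diff[OF assms(1)] assms)
  have 2: "v - a - b \<in> layer \<Phi> q 1"
    by (intro layer_1_diff[OF assms(1)] 1 assms) (simp add: assms inner_diff_left)
  have 3: "v - a - b - c \<in> layer \<Phi> q 1"
    by (intro layer_1_diff[OF assms(1)] 2 assms) (simp add: assms inner_diff_left)
  have "v \<bullet> (v - a - b - c) = -1"
    using assms root_norm[OF graded_slrs[OF assms(1)], of v] by (simp add: layer_def inner_diff_right)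
  then show False
    using layer_1_inner[OF assms(1,2) 3, of False] by simp
qed

lemma graded_subset_zspan:
  assumes "graded \<Phi> q" "v \<in> layer \<Phi> q 1"
  shows "\<Phi> \<subseteq> zspan (insert v (layer \<Phi> q 0))"
proof
  have 1: "w \<in> zspan (insert v (layer \<Phi> q 0))" if "w \<in> layer \<Phi> q 1" for w
    using assms that
    by (induction rule: layer_1_induct) (auto intro: zspan_base zspan_diff)
  fix \<alpha> assume "\<alpha> \<in> \<Phi>"
  then show "\<alpha> \<in> zspan (insert v (layer \<Phi> q 0))"
    using 1 zspan_minus[of "- \<alpha>"]
    by (elim graded_cases[OF assms(1)]) (auto intro: zspan_base)
qed

text \<open>If \<open>v\<close> were orthogonal to \<open>X\<close>, every move \<open>u\<close> to
  \<open>u - \<gamma>\<close> starting from \<open>v\<close> would use some \<open>\<gamma>\<close>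
  in \<open>Y\<close> and preserve orthogonality to \<open>X\<close>. By connectedness all roots of
  degree 1 would be orthogonal to \<open>X\<close>, which would then split off from \<Phi>.\<close>

lemma layer_0_nonorth:
  assumes "graded \<Phi> q" "v \<in> layer \<Phi> q 1" "layer \<Phi> q 0 = X \<union> Y"
    "\<And>x y. x \<in> X \<Longrightarrow> y \<in> Y \<Longrightarrow> x \<bullet> y = 0" "X \<noteq> {}"
  shows "\<exists>\<alpha>\<in>X. v \<bullet> \<alpha> = 1"
proof (rule ccontr)
  assume neg: "\<not> ?thesis"
  have v0: "v \<bullet> \<alpha> = 0" if "\<alpha> \<in> X" for \<alpha>
  proof (rule ccontr)
    assume "v \<bullet> \<alpha> \<noteq> 0"
    moreover have a0: "\<alpha> \<in> layer \<Phi> q 0" using that assms(3) by auto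
    ultimately have m: "v \<bullet> \<alpha> = -1" using layer_10_inner[OF assms(1,2) a0] neg that by auto
    have "- \<alpha> \<in> X \<union> Y"
      using a0 root_minus[OF graded_slrs[OF assms(1)]] assms(3) by (auto simp: layer_def)
    moreover have "- \<alpha> \<notin> X" using neg m by auto
    ultimately have "- \<alpha> \<in> Y" by auto
    then have "\<alpha> \<bullet> (- \<alpha>) = 0" using assms(4) that by blast
    then show False using root_norm[OF graded_slrs[OF assms(1)], of \<alpha>] a0 by (simp add: layer_def)
  qed
  have 1: "\<forall>\<alpha>\<in>X. w \<bullet> \<alpha> = 0" if "w \<in> layer \<Phi> q 1" for w
    using assms(1,2) that
  proof (induction rule: layer_1_induct)
    case (step u \<gamma>)
    show ?case
    proof
      fix \<alpha> assume "\<alpha> \<in> X"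
      moreover have "\<gamma> \<in> Y" using step assms(3) by force
      ultimately show "(u - \<gamma>) \<bullet> \<alpha> = 0"
        using step(5) assms(4) by (simp add: inner_diff_left inner_diff_right inner_commute)
    qed
  qed (use v0 in simp)
  have X: "X \<subseteq> \<Phi>" using assms(3) by (auto simp: layer_def)
  have "X = {} \<or> \<Phi> - X = {}"
  proof (rule irreducible_cases[OF graded_irreducible[OF assms(1)]])
    fix x y assume x: "x \<in> X" and y: "y \<in> \<Phi> - X"
    from y have "y \<in> \<Phi>" by simp
    then show "x \<bullet> y = 0"
      using 1[of y] 1[of "- y"] x y assms(3,4) by (elim graded_cases[OF assms(1)]) (auto simp: inner_commute)
  qed (use X in auto)
  moreover have "v \<notin> layer \<Phi> q 0" "v \<in> \<Phi>" using assms(2) by (auto simp: layer_def)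
  then have "v \<in> \<Phi> - X" using assms(3) by blast
  ultimately show False using assms(5) by blast
qed

text \<open>This yields the condition that degree 0 consists of the differences of roots of degree
  1: \<alpha> is \<open>u - (u - \<alpha>)\<close>. The roots of degree 0 orthogonal to everything
  in degree 1 would form an orthogonal summand of degree 0 that \<open>v\<close> does not
  meet.\<close>

lemma layer_0_difference:
  assumes "graded \<Phi> q" "\<alpha> \<in> layer \<Phi> q 0"
  shows "\<exists>u\<in>layer \<Phi> q 1. u \<bullet> \<alpha> = 1"
proof (rule ccontr)
  assume neg: "\<not> ?thesis"
  note sl = graded_slrs[OF assms(1)]
  obtain v where v: "v \<in> layer \<Phi> q 1" using layer_1_nonempty[OF assms(1)] .
  define X where "X = {\<alpha> \<in> layer \<Phi> q 0. \<forall>u\<in>layer \<Phi> q 1. u \<bullet> \<alpha> = 0}"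
  have "\<exists>\<alpha>\<in>X. v \<bullet> \<alpha> = 1"
  proof (rule layer_0_nonorth[OF assms(1) v, of X "layer \<Phi> q 0 - X"])
    \<comment> \<open>Up to sign, \<open>y\<close> is a difference of two roots of degree 1, and
      \<open>x\<close> is orthogonal to both.\<close>
    fix x y assume x: "x \<in> X" and y: "y \<in> layer \<Phi> q 0 - X"
    then obtain u where u: "u \<in> layer \<Phi> q 1" "u \<bullet> y \<noteq> 0" by (auto simp: X_def)
    have y0: "y \<in> layer \<Phi> q 0" "- y \<in> layer \<Phi> q 0" using y root_minus[OF sl] by (auto simp: layer_def)
    have "u \<bullet> y = 1 \<or> u \<bullet> (- y) = 1" using layer_10_inner[OF assms(1) u(1) y0(1)] u(2) by auto
    then have "u - y \<in> layer \<Phi> q 1 \<or> u - (- y) \<in> layer \<Phi> q 1"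
      using layer_1_diff[OF assms(1) u(1)] y0 by blast
    then have "(u - y) \<bullet> x = 0 \<or> (u - (- y)) \<bullet> x = 0" using x by (auto simp: X_def)
    then show "x \<bullet> y = 0" using u x by (auto simp: X_def inner_diff_left inner_add_left inner_commute[of x])
  next
    have "u \<bullet> \<alpha> = 0" if "u \<in> layer \<Phi> q 1" for u
    proof (rule ccontr)
      assume "u \<bullet> \<alpha> \<noteq> 0"
      then have m: "u \<bullet> \<alpha> = -1" using layer_10_inner[OF assms(1) that assms(2)] neg that by auto
      have "- \<alpha> \<in> layer \<Phi> q 0" using assms(2) root_minus[OF sl] by (auto simp: layer_def)
      from layer_1_diff[OF assms(1) that this] m have "u + \<alpha> \<in> layer \<Phi> q 1" by simp
      moreover have "(u + \<alpha>) \<bullet> \<alpha> = 1"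
        using m root_norm[OF sl, of \<alpha>] assms(2) by (simp add: inner_add_left layer_def)
      ultimately show False using neg by blast
    qed
    then have "\<alpha> \<in> X" using assms(2) by (simp add: X_def)
    then show "X \<noteq> {}" by auto
  qed (auto simp: X_def)
  then show False using v by (auto simp: X_def)
qed

lemma graded_local:
  assumes "graded \<Phi> q" "v \<in> layer \<Phi> q 1" "irreducible_system (layer \<Phi> q 0)"
  shows "graded (layer \<Phi> q 0) v"
  unfolding graded_def
proof (intro conjI ballI)
  have "\<exists>\<alpha>\<in>layer \<Phi> q 0. v \<bullet> \<alpha> = 1"
    by (rule layer_0_nonorth[OF assms(1,2), of _ "{}"]) (use assms(3) in \<open>auto simp: irreducible_system_def\<close>)
  then show "\<exists>\<alpha>\<in>layer \<Phi> q 0. v \<bullet> \<alpha> \<noteq> 0" by force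
qed (use assms slrs_layer_0 graded_slrs layer_10_inner[OF assms(1,2)] in auto)

subsection \<open>Reflections\<close>

text \<open>The usual denominator is absent because \<beta> is always taken of norm 2.\<close>

definition reflect :: "'a::real_inner \<Rightarrow> 'a \<Rightarrow> 'a" where
  "reflect \<beta> x = x - (\<beta> \<bullet> x) *\<^sub>R \<beta>"

lemma reflect_orthogonal_transformation:
  assumes "\<beta> \<bullet> \<beta> = 2"
  shows "orthogonal_transformation (reflect \<beta>)"
  unfolding orthogonal_transformation_def
proof (intro conjI allI)
  show "linear (reflect \<beta>)"
    by (rule linearI) (simp_all add: reflect_def inner_add_right algebra_simps)
  show "reflect \<beta> v \<bullet> reflect \<beta> w = v \<bullet> w" for v w
    using assms by (simp add: reflect_def inner_diff_left inner_diff_right inner_commute)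
qed

lemma reflect_reflect: "\<beta> \<bullet> \<beta> = 2 \<Longrightarrow> reflect \<beta> (reflect \<beta> x) = x"
  by (simp add: reflect_def inner_diff_right algebra_simps)

lemma reflect_image:
  assumes "slrs \<Phi>" "\<beta> \<in> \<Phi>"
  shows "reflect \<beta> ` \<Phi> = \<Phi>"
proof -
  have "reflect \<beta> ` \<Phi> \<subseteq> \<Phi>" using root_reflect[OF assms] by (auto simp: reflect_def)
  moreover have "\<Phi> \<subseteq> reflect \<beta> ` \<Phi>"
    using reflect_reflect[OF root_norm[OF assms]] root_reflect[OF assms]
    by (metis image_iff reflect_def subsetI)
  ultimately show ?thesis by auto
qed

lemma reflect_bij: "slrs \<Phi> \<Longrightarrow> \<beta> \<in> \<Phi> \<Longrightarrow> bij_betw (reflect \<beta>) \<Phi> \<Phi>"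
  using reflect_image[of \<Phi> \<beta>] reflect_reflect[OF root_norm, of \<Phi> \<beta>]
  by (metis bij_betw_def inj_on_def)

text \<open>If \<open>u \<bullet> \<gamma> = 1\<close>, the reflection in \<gamma> maps
  \<open>u\<close> to \<open>u - \<gamma>\<close>, so a path in the graph gives a product of
  reflections in roots of degree 0. Such a product fixes whatever is orthogonal to degree 0, in
  particular \<open>q\<close>.\<close>

lemma layer_1_transitive:
  assumes "graded \<Phi> q" "v \<in> layer \<Phi> q 1" "w \<in> layer \<Phi> q 1"
  obtains \<sigma> where "orthogonal_transformation \<sigma>" "\<sigma> v = w" "\<sigma> ` \<Phi> = \<Phi>"
    "\<And>x. (\<forall>\<alpha>\<in>layer \<Phi> q 0. x \<bullet> \<alpha> = 0) \<Longrightarrow> \<sigma> x = x"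
proof -
  have "\<exists>\<sigma>. orthogonal_transformation \<sigma> \<and> \<sigma> v = w \<and> \<sigma> ` \<Phi> = \<Phi> \<and>
      (\<forall>x. (\<forall>\<alpha>\<in>layer \<Phi> q 0. x \<bullet> \<alpha> = 0) \<longrightarrow> \<sigma> x = x)"
    using assms
  proof (induction rule: layer_1_induct)
    case base
    show ?case
      by (rule exI[of _ "\<lambda>x. x"]) (simp add: orthogonal_transformation_def linear_iff)
  next
    case (step u \<gamma>)
    then obtain \<sigma> where \<sigma>: "orthogonal_transformation \<sigma>" "\<sigma> v = u" "\<sigma> ` \<Phi> = \<Phi>"
      "\<And>x. (\<forall>\<alpha>\<in>layer \<Phi> q 0. x \<bullet> \<alpha> = 0) \<Longrightarrow> \<sigma> x = x" by blast
    have \<gamma>: "\<gamma> \<in> \<Phi>" "\<gamma> \<bullet> \<gamma> = 2"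
      using step root_norm[OF graded_slrs[OF assms(1)]] by (auto simp: layer_def)
    show ?case
    proof (intro exI[of _ "reflect \<gamma> \<circ> \<sigma>"] conjI allI impI)
      show "orthogonal_transformation (reflect \<gamma> \<circ> \<sigma>)"
        by (intro orthogonal_transformation_compose reflect_orthogonal_transformation \<sigma> \<gamma>)
      show "(reflect \<gamma> \<circ> \<sigma>) v = u - \<gamma>"
        using step \<sigma> by (simp add: reflect_def inner_commute)
      show "(reflect \<gamma> \<circ> \<sigma>) ` \<Phi> = \<Phi>"
        using \<sigma>(3) reflect_image[OF graded_slrs[OF assms(1)] \<gamma>(1)] by (metis image_comp)
      show "(reflect \<gamma> \<circ> \<sigma>) x = x" if "\<forall>\<alpha>\<in>layer \<Phi> q 0. x \<bullet> \<alpha> = 0" for x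
        using \<sigma>(4)[OF that] that step(2) by (simp add: reflect_def inner_commute)
    qed
  qed
  then show ?thesis using that by blast
qed

subsection \<open>The induced weight on the part of degree 0\<close>

lemma inner_span_layer_0: "y \<in> span (layer \<Phi> q 0) \<Longrightarrow> q \<bullet> y = 0"
  by (induction rule: span_induct_alt) (auto simp: inner_add_right layer_def)

text \<open>The orthogonal projection of \<open>v\<close> onto the complement of \<open>q\<close>,
  given that \<open>q \<bullet> v = 1\<close>. It induces on degree 0 the same grading as
  \<open>v\<close>, but lies in the span of degree 0, so that norms can be compared.\<close>

definition local_weight :: "'a::real_inner \<Rightarrow> 'a \<Rightarrow> 'a" where
  "local_weight q v = v - (1 / (q \<bullet> q)) *\<^sub>R q"

text \<open>Since \<Phi> is spanned by \<open>v\<close> and the roots of degree 0, some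
  \<open>q - t *\<^sub>R v\<close> lies in the span of degree 0. Pairing with \<open>q\<close> gives
  \<open>t = q \<bullet> q\<close>, and the projection is a multiple of that vector.\<close>

lemma local_weight:
  assumes "graded \<Phi> q" "v \<in> layer \<Phi> q 1" "q \<in> span \<Phi>"
  shows "local_weight q v \<in> span (layer \<Phi> q 0)"
    and "\<alpha> \<in> layer \<Phi> q 0 \<Longrightarrow> local_weight q v \<bullet> \<alpha> = v \<bullet> \<alpha>"
    and "local_weight q v \<bullet> local_weight q v = 2 - 1 / (q \<bullet> q)"
    and "q \<bullet> q > 0"
proof -
  have v: "v \<in> \<Phi>" "q \<bullet> v = 1" using assms by (auto simp: layer_def)
  have q0: "q \<noteq> 0" using v by auto
  show "q \<bullet> q > 0" using q0 by simp
  have "\<Phi> \<subseteq> span (insert v (layer \<Phi> q 0))"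
    using graded_subset_zspan[OF assms(1,2)] zspan_subset_span by blast
  then have "q \<in> span (insert v (layer \<Phi> q 0))"
    using assms(3) span_minimal[OF _ subspace_span] by blast
  then obtain t where t: "q - t *\<^sub>R v \<in> span (layer \<Phi> q 0)"
    by (auto simp: span_breakdown_eq)
  from inner_span_layer_0[OF t] have "t = q \<bullet> q" using v by (simp add: inner_diff_right)
  then have "local_weight q v = (- 1 / t) *\<^sub>R (q - t *\<^sub>R v)"
    using q0 by (simp add: local_weight_def scaleR_diff_right)
  then show "local_weight q v \<in> span (layer \<Phi> q 0)" using span_scale[OF t] by metis
  show "\<alpha> \<in> layer \<Phi> q 0 \<Longrightarrow> local_weight q v \<bullet> \<alpha> = v \<bullet> \<alpha>"
    by (simp add: local_weight_def inner_diff_left layer_def)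
  show "local_weight q v \<bullet> local_weight q v = 2 - 1 / (q \<bullet> q)"
    using v q0 root_norm[OF graded_slrs[OF assms(1)] v(1)]
    by (simp add: local_weight_def inner_diff_left inner_diff_right inner_commute field_simps)
qed

subsection \<open>3-gradings and vectors\<close>

lemma root_sum_reflect:
  assumes "slrs \<Phi>" "\<beta> \<in> \<Phi>"
  shows "(\<Sum>\<alpha>\<in>\<Phi>. f (reflect \<beta> \<alpha>)) = (\<Sum>\<alpha>\<in>\<Phi>. f \<alpha>)"
  using sum.reindex_bij_betw[OF reflect_bij[OF assms]] .

lemma reflect_inner_self: "\<beta> \<bullet> \<beta> = 2 \<Longrightarrow> reflect \<beta> \<alpha> \<bullet> \<beta> = - (\<alpha> \<bullet> \<beta>)"
  by (simp add: reflect_def inner_diff_left inner_commute[of \<beta> \<alpha>])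

text \<open>Reindexing the sum by the reflection in \<beta> shows that each root \<beta> is an
  eigenvector of the symmetric operator \<open>T\<close>. Roots with different eigenvalues are
  orthogonal, so irreducibility leaves only one eigenvalue.\<close>

lemma root_sum_eigen:
  assumes "slrs \<Phi>" "irreducible_system \<Phi>"
  obtains K where "K > 0" "\<And>x. x \<in> span \<Phi> \<Longrightarrow> (\<Sum>\<alpha>\<in>\<Phi>. (\<alpha> \<bullet> x) *\<^sub>R \<alpha>) = K *\<^sub>R x"
    "\<And>\<beta>. \<beta> \<in> \<Phi> \<Longrightarrow> (\<Sum>\<alpha>\<in>\<Phi>. (\<alpha> \<bullet> \<beta>)\<^sup>2) = 2 * K"
proof -
  define k where "k \<beta> = (\<Sum>\<alpha>\<in>\<Phi>. (\<alpha> \<bullet> \<beta>)\<^sup>2) / 2" for \<beta>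
  define T where "T x = (\<Sum>\<alpha>\<in>\<Phi>. (\<alpha> \<bullet> x) *\<^sub>R \<alpha>)" for x
  have T: "T \<beta> = k \<beta> *\<^sub>R \<beta>" if "\<beta> \<in> \<Phi>" for \<beta>
  proof -
    note b = root_norm[OF assms(1) that]
    have "T \<beta> = (\<Sum>\<alpha>\<in>\<Phi>. (reflect \<beta> \<alpha> \<bullet> \<beta>) *\<^sub>R reflect \<beta> \<alpha>)"
      unfolding T_def using root_sum_reflect[OF assms(1) that, of "\<lambda>\<alpha>. (\<alpha> \<bullet> \<beta>) *\<^sub>R \<alpha>"] by simp
    also have "\<dots> = (\<Sum>\<alpha>\<in>\<Phi>. ((\<alpha> \<bullet> \<beta>)\<^sup>2) *\<^sub>R \<beta> - (\<alpha> \<bullet> \<beta>) *\<^sub>R \<alpha>)"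
      by (intro sum.cong refl)
         (simp add: reflect_inner_self[OF b], simp add: reflect_def algebra_simps inner_commute power2_eq_square)
    also have "\<dots> = (2 * k \<beta>) *\<^sub>R \<beta> - T \<beta>"
      by (simp add: sum_subtractf T_def k_def scaleR_sum_left)
    finally have "2 *\<^sub>R T \<beta> = (2 * k \<beta>) *\<^sub>R \<beta>" by (simp add: scaleR_2 eq_diff_eq)
    then have "(1 / 2) *\<^sub>R (2 *\<^sub>R T \<beta>) = (1 / 2) *\<^sub>R ((2 * k \<beta>) *\<^sub>R \<beta>)" by (rule arg_cong)
    then show ?thesis by simp
  qed
  have sym: "T x \<bullet> y = T y \<bullet> x" for x y
    by (simp add: T_def inner_sum_left mult.commute)
  obtain \<beta>0 where b0: "\<beta>0 \<in> \<Phi>" using assms(2) by (auto simp: irreducible_system_def)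
  define X where "X = {\<beta> \<in> \<Phi>. k \<beta> = k \<beta>0}"
  have "X = {} \<or> \<Phi> - X = {}"
  proof (rule irreducible_cases[OF assms(2)])
    fix x y assume "x \<in> X" "y \<in> \<Phi> - X"
    then have "x \<in> \<Phi>" "y \<in> \<Phi>" "k x \<noteq> k y" by (auto simp: X_def)
    then show "x \<bullet> y = 0" using sym[of x y] T by (simp add: inner_commute)
  qed (auto simp: X_def)
  then have X: "X = \<Phi>" using b0 by (auto simp: X_def)
  show ?thesis
  proof (rule that[of "k \<beta>0"])
    have "(\<beta>0 \<bullet> \<beta>0)\<^sup>2 \<le> (\<Sum>\<alpha>\<in>\<Phi>. (\<alpha> \<bullet> \<beta>0)\<^sup>2)"
      by (rule member_le_sum[OF b0]) (use root_finite[OF assms(1)] in auto)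
    then show "k \<beta>0 > 0" using root_norm[OF assms(1) b0] by (simp add: k_def)
    show "(\<Sum>\<alpha>\<in>\<Phi>. (\<alpha> \<bullet> \<beta>)\<^sup>2) = 2 * k \<beta>0" if "\<beta> \<in> \<Phi>" for \<beta>
      using that X by (auto simp: X_def k_def)
    fix x assume "x \<in> span \<Phi>"
    then have "T x = k \<beta>0 *\<^sub>R x"
    proof (induction rule: span_induct_alt)
      case (step c y z)
      then have "T y = k \<beta>0 *\<^sub>R y" using T X by (auto simp: X_def)
      moreover have "T (c *\<^sub>R y + z) = c *\<^sub>R T y + T z"
        by (simp add: T_def inner_add_right scaleR_add_left sum.distrib scaleR_sum_right)
      ultimately show ?case using step by (simp add: algebra_simps)
    qed (simp add: T_def)
    then show "(\<Sum>\<alpha>\<in>\<Phi>. (\<alpha> \<bullet> x) *\<^sub>R \<alpha>) = k \<beta>0 *\<^sub>R x" by (simp add: T_def)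
  qed
qed

section \<open>Counting the roots of degree 1\<close>

lemma finite_layer: "slrs \<Phi> \<Longrightarrow> finite (layer \<Phi> q c)"
  using root_finite[of \<Phi>] by (auto simp: layer_def intro: finite_subset)

lemma card_layer_minus:
  assumes "slrs \<Phi>"
  shows "card (layer \<Phi> q (-1)) = card (layer \<Phi> q 1)"
proof -
  have "layer \<Phi> q (-1) = uminus ` layer \<Phi> q 1"
  proof (intro set_eqI iffI)
    fix x assume "x \<in> layer \<Phi> q (-1)"
    then have "- x \<in> layer \<Phi> q 1" using root_minus[OF assms] by (auto simp: layer_def)
    then show "x \<in> uminus ` layer \<Phi> q 1" by (metis imageI minus_minus)
  qed (use root_minus[OF assms] in \<open>auto simp: layer_def\<close>)
  then show ?thesis by (simp add: card_image)
qed

text \<open>The sum of \<open>(h \<bullet> \<alpha>)\<^sup>2\<close> over all roots counts those of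
  degree 1 and -1, and it is also a fixed multiple of \<open>h \<bullet> h\<close>. Thus a grading
  is maximal exactly when its vector is longest.\<close>

lemma card_layer_norm:
  assumes "slrs \<Phi>" "irreducible_system \<Phi>"
  obtains K where "K > 0"
    "\<And>h. h \<in> span \<Phi> \<Longrightarrow> (\<forall>\<alpha>\<in>\<Phi>. h \<bullet> \<alpha> \<in> {-1, 0, 1}) \<Longrightarrow> real (card (layer \<Phi> h 1)) = K * (h \<bullet> h)"
proof -
  obtain K where K: "K > 0" "\<And>x. x \<in> span \<Phi> \<Longrightarrow> (\<Sum>\<alpha>\<in>\<Phi>. (\<alpha> \<bullet> x) *\<^sub>R \<alpha>) = K *\<^sub>R x"
    using root_sum_eigen[OF assms] by metis
  show ?thesis
  proof (rule that[of "K / 2"])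
    fix h assume h: "h \<in> span \<Phi>" "\<forall>\<alpha>\<in>\<Phi>. h \<bullet> \<alpha> \<in> {-1, 0, 1}"
    have fin: "finite \<Phi>" using root_finite assms by blast
    have "K * (h \<bullet> h) = (\<Sum>\<alpha>\<in>\<Phi>. (\<alpha> \<bullet> h) *\<^sub>R \<alpha>) \<bullet> h" using K(2)[OF h(1)] by simp
    also have "\<dots> = (\<Sum>\<alpha>\<in>\<Phi>. (h \<bullet> \<alpha>)\<^sup>2)"
      by (simp add: inner_sum_left power2_eq_square inner_commute[of h])
    also have "\<dots> = (\<Sum>\<alpha>\<in>layer \<Phi> h 1 \<union> layer \<Phi> h (-1). 1)"
      by (rule sum.mono_neutral_cong_right) (use fin h in \<open>auto simp: layer_def\<close>)
    also have "\<dots> = real (card (layer \<Phi> h 1) + card (layer \<Phi> h (-1)))"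
      by (subst card_Un_disjoint[symmetric]) (use finite_layer[OF assms(1)] in \<open>auto simp: layer_def\<close>)
    finally show "real (card (layer \<Phi> h 1)) = K / 2 * (h \<bullet> h)"
      using card_layer_minus[OF assms(1), of h] by simp
  qed (use K in auto)
qed

text \<open>If the degree is given by a vector \<open>h\<close>, then summing \<open>deg \<alpha> \<alpha>\<close> over all roots yields a multiple
  of \<open>h\<close>; this recovers the vector.\<close>

lemma three_grading_vector:
  assumes "slrs \<Phi>" "irreducible_system \<Phi>" "three_grading \<Phi> G"
  obtains h where "graded \<Phi> h" "h \<in> span \<Phi>" "\<And>i. G i = layer \<Phi> h (of_int i)"
proof -
  have un: "\<Phi> = G (-1) \<union> G 0 \<union> G 1"
    and disj: "\<And>i j. i \<noteq> j \<Longrightarrow> G i \<inter> G j = {}"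
    and out: "\<And>i. i \<notin> {-1, 0, 1} \<Longrightarrow> G i = {}"
    and plus: "\<And>a b \<alpha> \<beta>. a \<in> {-1, 0, 1} \<Longrightarrow> b \<in> {-1, 0, 1} \<Longrightarrow> \<alpha> \<in> G a \<Longrightarrow> \<beta> \<in> G b \<Longrightarrow>
      \<alpha> + \<beta> \<in> \<Phi> \<Longrightarrow> \<alpha> + \<beta> \<in> G (a + b)"
    and zero: "\<Phi> \<inter> {\<alpha> - \<beta> | \<alpha> \<beta>. \<alpha> \<in> G 1 \<and> \<beta> \<in> G 1} = G 0"
    and neg: "G (-1) = uminus ` G 1"
  proof -
    note * = assms(3)[unfolded three_grading_def]
    show "\<Phi> = G (-1) \<union> G 0 \<union> G 1" using * by (elim conjE)
    show "\<Phi> \<inter> {\<alpha> - \<beta> | \<alpha> \<beta>. \<alpha> \<in> G 1 \<and> \<beta> \<in> G 1} = G 0" using * by (elim conjE)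
    show "G (-1) = uminus ` G 1" using * by (elim conjE)
    show "G i \<inter> G j = {}" if "i \<noteq> j" for i j using * that by (elim conjE) simp
    show "G i = {}" if "i \<notin> {-1, 0, 1}" for i using * that by (elim conjE) simp
    fix a b \<alpha> \<beta>
    assume ab: "a \<in> {-1, 0, 1}" "b \<in> {-1, 0, 1}" "\<alpha> \<in> G a" "\<beta> \<in> G b" "\<alpha> + \<beta> \<in> \<Phi>"
    have "\<forall>a\<in>{-1, 0, 1}. \<forall>b\<in>{-1, 0, 1}. \<Phi> \<inter> {\<alpha> + \<beta> | \<alpha> \<beta>. \<alpha> \<in> G a \<and> \<beta> \<in> G b} \<subseteq> G (a + b)"
      using * by (elim conjE)
    from bspec[OF bspec[OF this ab(1)] ab(2)] show "\<alpha> + \<beta> \<in> G (a + b)" using ab by blast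
  qed
  obtain K where K: "K > 0" "\<And>\<beta>. \<beta> \<in> \<Phi> \<Longrightarrow> (\<Sum>\<alpha>\<in>\<Phi>. (\<alpha> \<bullet> \<beta>)\<^sup>2) = 2 * K"
    using root_sum_eigen[OF assms(1,2)] by metis
  define d :: "'a \<Rightarrow> real" where "d \<alpha> = (if \<alpha> \<in> G 1 then 1 else if \<alpha> \<in> G (-1) then -1 else 0)" for \<alpha>
  have d: "d \<alpha> = of_int i" if "\<alpha> \<in> G i" for \<alpha> i
  proof -
    have "i \<in> {-1, 0, 1}" using that out by blast
    moreover have "i = 1" if "\<alpha> \<in> G 1" using that \<open>\<alpha> \<in> G i\<close> disj by blast
    moreover have "i = -1" if "\<alpha> \<in> G (-1)" using that \<open>\<alpha> \<in> G i\<close> disj by blast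
    ultimately show ?thesis using that by (auto simp: d_def)
  qed
  have dG: "\<exists>i\<in>{-1, 0, 1}. \<alpha> \<in> G i" if "\<alpha> \<in> \<Phi>" for \<alpha> using that un by auto
  have minus: "- \<alpha> \<in> G (- i)" if "\<alpha> \<in> G i" for \<alpha> i
  proof -
    have "i \<in> {-1, 0, 1}" using that out by blast
    then consider "i = 1" | "i = -1" | "i = 0" by auto
    then show ?thesis
    proof cases
      case 3
      have "- \<alpha> \<in> \<Phi>" using that 3 un root_minus[OF assms(1)] by blast
      moreover have "- \<alpha> \<notin> G 1" using neg that disj[of "-1" 0] 3 by (auto simp: image_iff)
      moreover have "- \<alpha> \<notin> G (-1)" using neg that disj[of 1 0] 3 by auto
      ultimately show ?thesis using un 3 by auto
    qed (use that neg in auto)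
  qed
  have ddiff: "d (\<alpha> - \<beta>) = d \<alpha> - d \<beta>" if "\<alpha> \<in> \<Phi>" "\<beta> \<in> \<Phi>" "\<alpha> - \<beta> \<in> \<Phi>" for \<alpha> \<beta>
  proof -
    obtain a b where ab: "a \<in> {-1, 0, 1}" "b \<in> {-1, 0, 1}" "\<alpha> \<in> G a" "\<beta> \<in> G b"
      using dG[OF \<open>\<alpha> \<in> \<Phi>\<close>] dG[OF \<open>\<beta> \<in> \<Phi>\<close>] by blast
    have "\<alpha> + - \<beta> \<in> G (a + - b)"
      by (rule plus) (use ab minus that in auto)
    then have "d (\<alpha> - \<beta>) = of_int (a + - b)" using d by simp
    then show ?thesis using d[OF ab(3)] d[OF ab(4)] by simp
  qed
  have dminus: "d (- \<alpha>) = - d \<alpha>" if "\<alpha> \<in> \<Phi>" for \<alpha>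
    using dG[OF that] d minus by force
  \<comment> \<open>On roots the degree behaves like a linear functional under reflections; this is
    the only linearity needed to recover \<open>h\<close>.\<close>
  have dreflect: "d (reflect \<beta> \<alpha>) = d \<alpha> - (\<alpha> \<bullet> \<beta>) * d \<beta>" if "\<alpha> \<in> \<Phi>" "\<beta> \<in> \<Phi>" for \<alpha> \<beta>
  proof (rule root_inner_cases[OF assms(1) that(2,1)])
    assume "\<beta> \<bullet> \<alpha> = 1"
    then show ?thesis using ddiff[OF that] root_diff[OF assms(1) that] by (simp add: reflect_def inner_commute)
  next
    assume *: "\<beta> \<bullet> \<alpha> = -1"
    then have "\<alpha> - (- \<beta>) \<in> \<Phi>" using root_add[OF assms(1) that] by (simp add: inner_commute)
    then show ?thesis
      using ddiff[OF that(1), of "- \<beta>"] root_minus[OF assms(1) that(2)] dminus[OF that(2)] *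
      by (simp add: reflect_def inner_commute)
  qed (use dminus that root_norm[OF assms(1) that(2)] in \<open>auto simp: reflect_def inner_commute scaleR_2\<close>)
  define h where "h = (1 / K) *\<^sub>R (\<Sum>\<alpha>\<in>\<Phi>. d \<alpha> *\<^sub>R \<alpha>)"
  have h: "h \<bullet> \<beta> = d \<beta>" if "\<beta> \<in> \<Phi>" for \<beta>
  proof -
    let ?S = "\<Sum>\<alpha>\<in>\<Phi>. d \<alpha> * (\<alpha> \<bullet> \<beta>)"
    have "?S = (\<Sum>\<alpha>\<in>\<Phi>. d (reflect \<beta> \<alpha>) * (reflect \<beta> \<alpha> \<bullet> \<beta>))"
      using root_sum_reflect[OF assms(1) that, of "\<lambda>\<alpha>. d \<alpha> * (\<alpha> \<bullet> \<beta>)"] by simp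
    also have "\<dots> = (\<Sum>\<alpha>\<in>\<Phi>. d \<beta> * (\<alpha> \<bullet> \<beta>)\<^sup>2 - d \<alpha> * (\<alpha> \<bullet> \<beta>))"
      by (intro sum.cong refl)
         (simp add: dreflect that reflect_inner_self[OF root_norm[OF assms(1) that]] algebra_simps power2_eq_square)
    also have "\<dots> = d \<beta> * (2 * K) - ?S"
      using K(2)[OF that] by (simp add: sum_subtractf sum_distrib_left[symmetric])
    finally have "?S = d \<beta> * K" by simp
    then show ?thesis using K(1) by (simp add: h_def inner_sum_left)
  qed
  show ?thesis
  proof (rule that[of h])
    have "\<exists>\<alpha>\<in>\<Phi>. h \<bullet> \<alpha> \<noteq> 0"
    \<comment> \<open>If all degrees vanished, degree 1 would be empty, hence so would its set of
      differences, which is degree 0, and \<Phi> would be empty.\<close>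
    proof (rule ccontr)
      assume "\<not> ?thesis"
      then have "d \<alpha> = 0" if "\<alpha> \<in> \<Phi>" for \<alpha> using h that by auto
      then have "G 1 = {}" using d un by fastforce
      then show False using zero neg un assms(2) by (auto simp: irreducible_system_def)
    qed
    moreover have "h \<bullet> \<alpha> \<in> {-1, 0, 1}" if "\<alpha> \<in> \<Phi>" for \<alpha> using h[OF that] by (auto simp: d_def)
    ultimately show "graded \<Phi> h" using assms by (simp add: graded_def)
    show "h \<in> span \<Phi>" unfolding h_def by (intro span_scale span_sum span_base)
    fix i
    show "G i = layer \<Phi> h (of_int i)"
    proof (intro set_eqI iffI)
      fix \<alpha> assume a: "\<alpha> \<in> G i"
      then have "\<alpha> \<in> \<Phi>" using out[of i] un by blast
      then show "\<alpha> \<in> layer \<Phi> h (of_int i)" using h d[OF a] by (simp add: layer_def)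
    next
      fix \<alpha> assume a: "\<alpha> \<in> layer \<Phi> h (of_int i)"
      then obtain j where j: "\<alpha> \<in> G j" using dG by (auto simp: layer_def)
      then have "real_of_int i = real_of_int j" using a h d[OF j] by (auto simp: layer_def)
      then show "\<alpha> \<in> G i" using j by simp
    qed
  qed
qed

lemma three_grading_layer:
  assumes "graded \<Phi> h"
  shows "three_grading \<Phi> (\<lambda>i. layer \<Phi> h (of_int i))"
  unfolding three_grading_def
proof (intro conjI allI impI ballI)
  note sl = graded_slrs[OF assms]
  show "\<Phi> = layer \<Phi> h (of_int (- 1)) \<union> layer \<Phi> h (of_int 0) \<union> layer \<Phi> h (of_int 1)"
    using graded_value[OF assms] by (auto simp: layer_def)
  show "layer \<Phi> h (of_int i) \<inter> layer \<Phi> h (of_int j) = {}" if "i \<noteq> j" for i j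
    using that by (auto simp: layer_def)
  show "layer \<Phi> h (of_int i) = {}" if "i \<notin> {-1, 0, 1}" for i
  proof -
    have "real_of_int i \<noteq> h \<bullet> \<alpha>" if "\<alpha> \<in> \<Phi>" for \<alpha>
      using graded_value[OF assms that] \<open>i \<notin> {-1, 0, 1}\<close> by auto
    then show ?thesis unfolding layer_def by force
  qed
  show "\<Phi> \<inter> {\<alpha> + \<beta> |\<alpha> \<beta>. \<alpha> \<in> layer \<Phi> h (of_int a) \<and> \<beta> \<in> layer \<Phi> h (of_int b)}
      \<subseteq> layer \<Phi> h (of_int (a + b))" for a b
    by (auto simp: layer_def inner_add_right)
  show "layer \<Phi> h (of_int (- 1)) = uminus ` layer \<Phi> h (of_int 1)"
  proof (intro set_eqI iffI)
    fix x assume "x \<in> layer \<Phi> h (of_int (- 1))"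
    then have "- x \<in> layer \<Phi> h (of_int 1)" using root_minus[OF sl] by (auto simp: layer_def)
    then show "x \<in> uminus ` layer \<Phi> h (of_int 1)" by (metis imageI minus_minus)
  qed (use root_minus[OF sl] in \<open>auto simp: layer_def\<close>)
  show "\<Phi> \<inter> {\<alpha> - \<beta> |\<alpha> \<beta>. \<alpha> \<in> layer \<Phi> h (of_int 1) \<and> \<beta> \<in> layer \<Phi> h (of_int 1)} = layer \<Phi> h (of_int 0)"
  proof (intro set_eqI iffI)
    fix x assume x: "x \<in> layer \<Phi> h (of_int 0)"
    then have x0: "x \<in> layer \<Phi> h 0" by simp
    obtain u where u: "u \<in> layer \<Phi> h 1" "u \<bullet> x = 1" using layer_0_difference[OF assms x0] by auto
    have "u - x \<in> layer \<Phi> h 1" using layer_1_diff[OF assms u(1) x0 u(2)] .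
    then have "x = u - (u - x) \<and> u \<in> layer \<Phi> h (of_int 1) \<and> u - x \<in> layer \<Phi> h (of_int 1)"
      using u by simp
    then have "\<exists>\<alpha> \<beta>. x = \<alpha> - \<beta> \<and> \<alpha> \<in> layer \<Phi> h (of_int 1) \<and> \<beta> \<in> layer \<Phi> h (of_int 1)" by blast
    moreover have "x \<in> \<Phi>" using x by (simp add: layer_def)
    ultimately show "x \<in> \<Phi> \<inter> {\<alpha> - \<beta> |\<alpha> \<beta>. \<alpha> \<in> layer \<Phi> h (of_int 1) \<and> \<beta> \<in> layer \<Phi> h (of_int 1)}"
      by simp
  qed (auto simp: layer_def inner_diff_right)
qed

section \<open>Isometries\<close>

definition isometry_on :: "('a::real_inner \<Rightarrow> 'b::real_inner) \<Rightarrow> 'a set \<Rightarrow> bool" where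
  "isometry_on f \<Phi> \<longleftrightarrow> linear f \<and> (\<forall>x\<in>span \<Phi>. \<forall>y\<in>span \<Phi>. f x \<bullet> f y = x \<bullet> y)"

lemma isometry_onI:
  assumes "linear f" "\<And>\<alpha> \<beta>. \<alpha> \<in> S \<Longrightarrow> \<beta> \<in> S \<Longrightarrow> f \<alpha> \<bullet> f \<beta> = \<alpha> \<bullet> \<beta>"
  shows "isometry_on f S"
  unfolding isometry_on_def
proof (intro conjI ballI)
  have 1: "f x \<bullet> f \<beta> = x \<bullet> \<beta>" if "x \<in> span S" "\<beta> \<in> S" for x \<beta>
    using that(1)
    by (induction rule: span_induct_alt)
       (auto simp: linear_0[OF assms(1)] linear_add[OF assms(1)] linear_scale[OF assms(1)]
          inner_add_left assms(2) that(2))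
  show "f x \<bullet> f y = x \<bullet> y" if "x \<in> span S" "y \<in> span S" for x y
    using that(2)
    by (induction rule: span_induct_alt)
       (auto simp: linear_0[OF assms(1)] linear_add[OF assms(1)] linear_scale[OF assms(1)]
          inner_add_right 1[OF that(1)])
qed (rule assms)

lemma isometry_on_linear: "isometry_on f \<Phi> \<Longrightarrow> linear f"
  and isometry_on_inner: "isometry_on f \<Phi> \<Longrightarrow> x \<in> span \<Phi> \<Longrightarrow> y \<in> span \<Phi> \<Longrightarrow> f x \<bullet> f y = x \<bullet> y"
  by (auto simp: isometry_on_def)

lemma isometry_on_inj: "isometry_on f \<Phi> \<Longrightarrow> inj_on f (span \<Phi>)"
proof (rule inj_onI)
  fix x y assume f: "isometry_on f \<Phi>" and xy: "x \<in> span \<Phi>" "y \<in> span \<Phi>" "f x = f y"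
  then have "f (x - y) \<bullet> f (x - y) = (x - y) \<bullet> (x - y)"
    by (intro isometry_on_inner[OF f] span_diff)
  then show "x = y" using xy linear_diff[OF isometry_on_linear[OF f], of x y] by simp
qed

lemma root_isomorphism_iff: "root_isomorphism f \<Phi> \<Psi> \<longleftrightarrow> isometry_on f \<Phi> \<and> f ` \<Phi> = \<Psi>"
proof
  assume "root_isomorphism f \<Phi> \<Psi>"
  then show "isometry_on f \<Phi> \<and> f ` \<Phi> = \<Psi>"
    unfolding root_isomorphism_def by (auto intro: isometry_onI)
next
  assume "isometry_on f \<Phi> \<and> f ` \<Phi> = \<Psi>"
  then show "root_isomorphism f \<Phi> \<Psi>"
    unfolding root_isomorphism_def using isometry_on_inj isometry_on_inner
    by (auto simp: isometry_on_def span_base)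
qed

lemma isometry_on_subset: "isometry_on f \<Phi> \<Longrightarrow> S \<subseteq> span \<Phi> \<Longrightarrow> isometry_on f S"
  unfolding isometry_on_def by (meson span_minimal subset_iff subspace_span)

lemma isometry_on_id: "isometry_on (\<lambda>x. x) \<Phi>"
  by (auto simp: isometry_on_def linear_iff)

lemma orthogonal_transformation_isometry_on: "orthogonal_transformation f \<Longrightarrow> isometry_on f \<Phi>"
  by (auto simp: orthogonal_transformation_def isometry_on_def)

lemma slrs_image:
  assumes "isometry_on f \<Phi>" "slrs \<Phi>"
  shows "slrs (f ` \<Phi>)"
proof (rule slrsI)
  note lin = isometry_on_linear[OF assms(1)]
  have ip: "f \<alpha> \<bullet> f \<beta> = \<alpha> \<bullet> \<beta>" if "\<alpha> \<in> \<Phi>" "\<beta> \<in> \<Phi>" for \<alpha> \<beta>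
    using isometry_on_inner[OF assms(1)] that span_base by blast
  show "finite (f ` \<Phi>)" using root_finite[OF assms(2)] by simp
  show "\<alpha> \<bullet> \<alpha> = 2" if "\<alpha> \<in> f ` \<Phi>" for \<alpha> using that ip root_norm[OF assms(2)] by auto
  show "\<alpha> \<bullet> \<beta> \<in> \<int>" if "\<alpha> \<in> f ` \<Phi>" "\<beta> \<in> f ` \<Phi>" for \<alpha> \<beta>
    using that ip root_inner_Ints[OF assms(2)] by auto
  show "\<beta> - (\<alpha> \<bullet> \<beta>) *\<^sub>R \<alpha> \<in> f ` \<Phi>" if ab: "\<alpha> \<in> f ` \<Phi>" "\<beta> \<in> f ` \<Phi>" for \<alpha> \<beta>
  proof -
    obtain a b where "a \<in> \<Phi>" "b \<in> \<Phi>" "\<alpha> = f a" "\<beta> = f b" using ab by auto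
    then have "\<beta> - (\<alpha> \<bullet> \<beta>) *\<^sub>R \<alpha> = f (b - (a \<bullet> b) *\<^sub>R a)"
      using ip by (simp add: linear_diff[OF lin] linear_scale[OF lin])
    then show ?thesis using root_reflect[OF assms(2) \<open>a \<in> \<Phi>\<close> \<open>b \<in> \<Phi>\<close>] by auto
  qed
qed

lemma irreducible_image:
  assumes "isometry_on f \<Phi>" "irreducible_system \<Phi>"
  shows "irreducible_system (f ` \<Phi>)"
  unfolding irreducible_system_def
proof (intro conjI notI)
  assume "f ` \<Phi> = {}"
  then show False using assms(2) by (auto simp: irreducible_system_def)
next
  assume "\<exists>X Y. X \<noteq> {} \<and> Y \<noteq> {} \<and> f ` \<Phi> = X \<union> Y \<and> (\<forall>x\<in>X. \<forall>y\<in>Y. x \<bullet> y = 0)"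
  then obtain X Y where XY: "X \<noteq> {}" "Y \<noteq> {}" "f ` \<Phi> = X \<union> Y" "\<forall>x\<in>X. \<forall>y\<in>Y. x \<bullet> y = 0"
    by (elim exE conjE) (rule that)
  have "{\<alpha> \<in> \<Phi>. f \<alpha> \<in> X} = {} \<or> {\<alpha> \<in> \<Phi>. f \<alpha> \<in> Y} = {}"
  proof (rule irreducible_cases[OF assms(2)])
    have "f \<alpha> \<in> X \<or> f \<alpha> \<in> Y" if "\<alpha> \<in> \<Phi>" for \<alpha> using XY(3) that by (metis UnE imageI)
    then show "\<Phi> = {\<alpha> \<in> \<Phi>. f \<alpha> \<in> X} \<union> {\<alpha> \<in> \<Phi>. f \<alpha> \<in> Y}" by auto
    fix x y assume "x \<in> {\<alpha> \<in> \<Phi>. f \<alpha> \<in> X}" "y \<in> {\<alpha> \<in> \<Phi>. f \<alpha> \<in> Y}"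
    then have "f x \<bullet> f y = 0" "x \<in> span \<Phi>" "y \<in> span \<Phi>" using XY(4) by (simp_all add: span_base)
    then show "x \<bullet> y = 0" using isometry_on_inner[OF assms(1), of x y] by simp
  qed
  moreover have "X \<subseteq> f ` \<Phi>" "Y \<subseteq> f ` \<Phi>" using XY(3) by auto
  ultimately show False using XY(1,2) by blast
qed

lemma layer_image:
  assumes "isometry_on f \<Phi>" "q \<in> span \<Phi>"
  shows "layer (f ` \<Phi>) (f q) c = f ` layer \<Phi> q c"
  using isometry_on_inner[OF assms] by (auto simp: layer_def span_base)

lemma graded_image:
  assumes "isometry_on f \<Phi>" "q \<in> span \<Phi>" "graded \<Phi> q"
  shows "graded (f ` \<Phi>) (f q)"
proof -
  have "f q \<bullet> f \<alpha> = q \<bullet> \<alpha>" if "\<alpha> \<in> \<Phi>" for \<alpha>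
    using isometry_on_inner[OF assms(1,2)] that span_base by blast
  moreover have "slrs (f ` \<Phi>)" "irreducible_system (f ` \<Phi>)"
    using slrs_image irreducible_image assms graded_slrs graded_irreducible by blast+
  ultimately show ?thesis using assms(3) unfolding graded_def by simp
qed

section \<open>Extension to the left\<close>

text \<open>Only finiteness needs an argument: a norm 2 vector of the lattice is determined by its
  inner products with the finitely many generators, and these are integers between -2 and 2.\<close>

lemma slrs_zspan:
  assumes "finite S" "\<And>s. s \<in> S \<Longrightarrow> s \<bullet> s = 2" "\<And>s t. s \<in> S \<Longrightarrow> t \<in> S \<Longrightarrow> s \<bullet> t \<in> \<int>"
  shows "slrs {x \<in> zspan S. x \<bullet> x = 2}"
proof (rule slrs_lattice[OF _ refl])
  let ?F = "\<lambda>x. \<lambda>s\<in>S. x \<bullet> s"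
  let ?L = "{x \<in> zspan S. x \<bullet> x = 2}"
  have "?F ` ?L \<subseteq> (\<Pi>\<^sub>E s\<in>S. {-2, -1, 0, 1, 2})"
  proof -
    have "x \<bullet> s \<in> {-2, -1, 0, 1, 2}" if x: "x \<in> zspan S" "x \<bullet> x = 2" and s: "s \<in> S" for x s
    proof -
      have "s \<bullet> x \<in> \<int>" using zspan_inner_Ints[OF x(1)] assms(3) s by blast
      then obtain k where k: "x \<bullet> s = of_int k" by (auto elim: Ints_cases simp: inner_commute)
      have "(x - s) \<bullet> (x - s) = 4 - 2 * of_int k" "(x + s) \<bullet> (x + s) = 4 + 2 * of_int k"
        using k x assms(2)[OF s]
        by (simp_all add: inner_diff_left inner_diff_right inner_add_left inner_add_right inner_commute)
      then have "k \<le> 2" "-2 \<le> k"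
        using inner_ge_zero[of "x - s"] inner_ge_zero[of "x + s"] by linarith+
      then have "k = 2 \<or> k = 1 \<or> k = 0 \<or> k = -1 \<or> k = -2" by linarith
      then show ?thesis using k by auto
    qed
    then show ?thesis by (intro image_subsetI) (simp only: restrict_PiE_iff mem_Collect_eq, blast)
  qed
  moreover have "inj_on ?F ?L"
  proof (rule inj_onI)
    fix x y assume x: "x \<in> ?L" and y: "y \<in> ?L" and e: "?F x = ?F y"
    show "x = y"
    proof (rule span_inner_eqI[of _ S])
      show "x \<bullet> s = y \<bullet> s" if "s \<in> S" for s using fun_cong[OF e, of s] that by simp
    qed (use x y zspan_subset_span in auto)
  qed
  ultimately show "finite ?L"
    using assms(1) by (meson finite.emptyI finite.insertI finite_PiE finite_subset inj_on_finite)
qed (use zspan_diff zspan_inner_Ints2[OF _ _ assms(3)] in auto)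

text \<open>In an orthogonal decomposition of \<Phi> the irreducible subsystem \<Psi> lies on one
  side. An element of the other side is outside \<Psi> but orthogonal to all of it.\<close>

lemma irreducible_grow:
  assumes "irreducible_system \<Psi>" "\<Psi> \<subseteq> \<Phi>"
    "\<And>\<beta>. \<beta> \<in> \<Phi> \<Longrightarrow> \<beta> \<notin> \<Psi> \<Longrightarrow> \<exists>\<alpha>\<in>\<Psi>. \<alpha> \<bullet> \<beta> \<noteq> 0"
  shows "irreducible_system \<Phi>"
  unfolding irreducible_system_def
proof (intro conjI notI)
  have ne: "\<Psi> \<noteq> {}" using assms(1) by (simp add: irreducible_system_def)
  then show "\<Phi> = {} \<Longrightarrow> False" using assms(2) by auto
  have *: False if XY: "X \<noteq> {}" "Y \<noteq> {}" "\<Phi> = X \<union> Y" "\<And>x y. x \<in> X \<Longrightarrow> y \<in> Y \<Longrightarrow> x \<bullet> y = 0" 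
      and empty: "\<Psi> \<inter> X = {}" for X Y
  proof -
    obtain x where x: "x \<in> X" using XY by auto
    then have "x \<notin> \<Psi>" "x \<in> \<Phi>" using empty XY by auto
    then obtain \<alpha> where "\<alpha> \<in> \<Psi>" "\<alpha> \<bullet> x \<noteq> 0" using assms(3) by blast
    moreover have "\<alpha> \<in> Y" using \<open>\<alpha> \<in> \<Psi>\<close> empty assms(2) XY by auto
    ultimately show False using XY(4)[OF x, of \<alpha>] by (simp add: inner_commute)
  qed
  assume "\<exists>X Y. X \<noteq> {} \<and> Y \<noteq> {} \<and> \<Phi> = X \<union> Y \<and> (\<forall>x\<in>X. \<forall>y\<in>Y. x \<bullet> y = 0)"
  then obtain X Y where XY: "X \<noteq> {}" "Y \<noteq> {}" "\<Phi> = X \<union> Y" "\<And>x y. x \<in> X \<Longrightarrow> y \<in> Y \<Longrightarrow> x \<bullet> y = 0"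
    by blast
  have "\<Psi> \<inter> X = {} \<or> \<Psi> \<inter> Y = {}"
    by (rule irreducible_cases[OF assms(1)]) (use assms(2) XY in auto)
  moreover have "\<Psi> \<inter> Y \<noteq> {}"
    using *[OF XY(2,1)] XY(3,4) by (metis Un_commute inner_commute)
  ultimately show False using *[OF XY] by blast
qed

lemma inner_basis_vec: "x \<bullet> basis_vec i = coord x i"
proof -
  have "x \<bullet> basis_vec i = (\<Sum>j | coord x j \<noteq> 0. if j = i then coord x i else 0)"
    unfolding inner_fsvec_def by (intro sum.cong) (auto simp: basis_vec.rep_eq)
  then show ?thesis using finite_support_coord[of x] by (simp add: sum.delta)
qed

lemma basis_vec_inner: "basis_vec i \<bullet> x = coord x i"
  by (metis inner_basis_vec inner_commute)

lemma norm_add_orthogonal: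
  "e \<bullet> w = 0 \<Longrightarrow> e \<bullet> e = 1 \<Longrightarrow> (a *\<^sub>R e + w) \<bullet> (a *\<^sub>R e + w) = a * a + w \<bullet> w"
  by (simp add: inner_add_left inner_add_right inner_commute)

text \<open>Adjoin \<open>v = h + c e\<close> of norm 2 with \<open>e\<close> a new unit vector. A norm 2 vector of the
  resulting lattice of degree \<open>k\<close> satisfies \<open>k\<^sup>2 c\<^sup>2 \<le> 2\<close>, so \<open>c\<^sup>2 = 2 - h \<bullet> h > 1/2\<close> leaves
  only the degrees \<open>-1, 0, 1\<close>.\<close>

lemma left_extension:
  fixes \<Phi> :: "fsvec set"
  assumes "graded \<Phi> h" "h \<in> span \<Phi>" "h \<bullet> h < 3 / 2"
  obtains \<Phi>' q where "graded \<Phi>' q" "layer \<Phi>' q 0 = \<Phi>"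
proof -
  note sl = graded_slrs[OF assms(1)]
  have "finite (\<Union>\<alpha>\<in>\<Phi>. {i. coord \<alpha> i \<noteq> 0})" using root_finite[OF sl] finite_support_coord by auto
  then obtain N where "N \<notin> (\<Union>\<alpha>\<in>\<Phi>. {i. coord \<alpha> i \<noteq> 0})" using ex_new_if_finite[OF infinite_UNIV_nat] by blast
  then have N: "coord \<alpha> N = 0" if "\<alpha> \<in> \<Phi>" for \<alpha> using that by auto
  define e where "e = basis_vec N"
  have ee: "e \<bullet> e = 1" unfolding e_def by (simp add: inner_basis_vec basis_vec.rep_eq)
  have e0: "e \<bullet> x = 0" if "x \<in> span \<Phi>" for x
    using that by (induction rule: span_induct_alt) (auto simp: inner_add_right e_def basis_vec_inner N)
  define c where "c = sqrt (2 - h \<bullet> h)"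
  have c2: "c * c = 2 - h \<bullet> h" "c > 0" using assms(3) by (auto simp: c_def)
  define v where "v = h + c *\<^sub>R e"
  have v: "v \<bullet> v = 2" "e \<bullet> v = c" "\<And>x. x \<in> span \<Phi> \<Longrightarrow> v \<bullet> x = h \<bullet> x"
    using c2 e0 e0[OF assms(2)] ee
    by (simp_all add: v_def inner_add_left inner_add_right inner_commute)
  \<comment> \<open>The factor \<open>1 / c\<close> makes \<open>q\<close> read off the coefficient
    of \<open>v\<close>, because \<open>e \<bullet> v = c\<close> and \<open>e\<close> is orthogonal
    to \<Phi>.\<close>
  define q where "q = (1 / c) *\<^sub>R e"
  define \<Phi>' where "\<Phi>' = {x \<in> zspan (insert v \<Phi>). x \<bullet> x = 2}"
  have sl': "slrs \<Phi>'"
    unfolding \<Phi>'_def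
  proof (rule slrs_zspan)
    fix s t assume "s \<in> insert v \<Phi>" "t \<in> insert v \<Phi>"
    moreover have "v \<bullet> \<alpha> \<in> \<int>" if "\<alpha> \<in> \<Phi>" for \<alpha>
      using graded_value[OF assms(1) that] v(3) that by (auto simp: span_base)
    ultimately show "s \<bullet> t \<in> \<int>" using v(1) root_inner_Ints[OF sl] by (auto simp: inner_commute)
  qed (use v root_norm[OF sl] root_finite[OF sl] in auto)
  have dec: "\<exists>(k::int) y. x = of_int k *\<^sub>R v + y \<and> y \<in> zspan \<Phi> \<and> q \<bullet> x = of_int k \<and>
      x \<bullet> x = of_int k * of_int k * (c * c) + (of_int k *\<^sub>R h + y) \<bullet> (of_int k *\<^sub>R h + y)" if "x \<in> \<Phi>'" for x
  proof -
    have "x \<in> zspan (insert v \<Phi>)" using that by (simp add: \<Phi>'_def)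
    then obtain k :: int and y where y: "y \<in> zspan \<Phi>" "x = of_int k *\<^sub>R v + y" by (rule zspan_insertE)
    have ys: "y \<in> span \<Phi>" using y zspan_subset_span by auto
    have "q \<bullet> x = of_int k" using y e0[OF ys] v c2(2) by (simp add: q_def inner_add_right)
    have x: "x = (of_int k * c) *\<^sub>R e + (of_int k *\<^sub>R h + y)"
      by (simp add: y v_def algebra_simps)
    have "e \<bullet> (of_int k *\<^sub>R h + y) = 0" by (intro e0 span_add span_scale assms(2) ys)
    then have norm: "(a *\<^sub>R e + (of_int k *\<^sub>R h + y)) \<bullet> (a *\<^sub>R e + (of_int k *\<^sub>R h + y)) =
        a * a + (of_int k *\<^sub>R h + y) \<bullet> (of_int k *\<^sub>R h + y)" for a
      using ee by (intro norm_add_orthogonal)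
    have "x \<bullet> x = of_int k * of_int k * (c * c) + (of_int k *\<^sub>R h + y) \<bullet> (of_int k *\<^sub>R h + y)"
      unfolding x norm by simp
    then show ?thesis using y \<open>q \<bullet> x = of_int k\<close> by blast
  qed
  have q: "q \<bullet> x \<in> {-1, 0, 1}" if x: "x \<in> \<Phi>'" for x
  proof -
    obtain k :: int and y where k: "q \<bullet> x = of_int k"
      "x \<bullet> x = of_int k * of_int k * (c * c) + (of_int k *\<^sub>R h + y) \<bullet> (of_int k *\<^sub>R h + y)"
      using dec[OF x] by blast
    have "of_int (k * k) * (c * c) \<le> 2"
      using k(2) root_norm[OF sl' x] inner_ge_zero[of "of_int k *\<^sub>R h + y"]
      unfolding of_int_mult by linarith
    moreover have "c * c > 1 / 2" using c2 assms(3) by simp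
    ultimately have "\<not> real_of_int (k * k) \<ge> 4"
      using mult_strict_mono'[of "1 / 2" "c * c" 4 "real_of_int (k * k)"]
        mult_right_mono[of 4 "real_of_int (k * k)" "c * c"] by linarith
    then have "k \<in> {-1, 0, 1}" by (intro square_less_4) linarith
    then show ?thesis using k(1) by auto
  qed
  have \<Phi>\<Phi>': "\<Phi> \<subseteq> \<Phi>'" using root_norm[OF sl] by (auto simp: \<Phi>'_def intro: zspan_base)
  have q0: "q \<bullet> \<alpha> = 0" if "\<alpha> \<in> \<Phi>" for \<alpha> using that e0 by (simp add: q_def span_base)
  have layer: "layer \<Phi>' q 0 = \<Phi>"
  proof (intro set_eqI iffI)
    fix x assume x: "x \<in> layer \<Phi>' q 0"
    then have x': "x \<in> \<Phi>'" "q \<bullet> x = 0" by (auto simp: layer_def)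
    then obtain k :: int and y where "x = of_int k *\<^sub>R v + y" "y \<in> zspan \<Phi>" "q \<bullet> x = of_int k"
      using dec[OF x'(1)] by blast
    then have "x \<in> zspan \<Phi>" using x' by simp
    then show "x \<in> \<Phi>" using zspan_norm_2[OF sl] root_norm[OF sl' x'(1)] by blast
  qed (use \<Phi>\<Phi>' q0 in \<open>auto simp: layer_def\<close>)
  have irr: "irreducible_system \<Phi>'"
  proof (rule irreducible_grow[OF graded_irreducible[OF assms(1)] \<Phi>\<Phi>'])
    fix x assume x: "x \<in> \<Phi>'" "x \<notin> \<Phi>"
    show "\<exists>\<alpha>\<in>\<Phi>. \<alpha> \<bullet> x \<noteq> 0"
    proof (rule ccontr)
      assume neg: "\<not> ?thesis"
      obtain k :: int and y where k: "q \<bullet> x = of_int k" "x = of_int k *\<^sub>R v + y" "y \<in> zspan \<Phi>"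
        "x \<bullet> x = of_int k * of_int k * (c * c) + (of_int k *\<^sub>R h + y) \<bullet> (of_int k *\<^sub>R h + y)"
        using dec[OF x(1)] by blast
      \<comment> \<open>A new root orthogonal to \<Phi> would be a multiple of \<open>e\<close>
        alone. Then its norm forces \<open>c * c = 2\<close>, hence \<open>h = 0\<close>, but the
        grading by \<open>h\<close> is nontrivial.\<close>
      have "of_int k *\<^sub>R h + y = 0"
      proof (rule span_orthogonal_0[of _ \<Phi>])
        show "of_int k *\<^sub>R h + y \<in> span \<Phi>"
          using k(3) assms(2) zspan_subset_span by (intro span_add span_scale) auto
        fix s assume s: "s \<in> \<Phi>"
        have "s \<bullet> x = 0" using neg s by blast
        then show "(of_int k *\<^sub>R h + y) \<bullet> s = 0"
          using k(2) v(3)[of s] s by (simp add: inner_add_left inner_add_right span_base inner_commute)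
      qed
      then have "2 = of_int k * of_int k * (c * c)" using k(4) root_norm[OF sl' x(1)] by simp
      moreover have "of_int k \<in> {-1, 0, 1 :: real}" using q[OF x(1)] k(1) by simp
      ultimately have "c * c = 2" by auto
      then have "h = 0" using c2 by simp
      then show False using assms(1) by (auto simp: graded_def)
    qed
  qed
  have "v \<in> \<Phi>'" using v by (auto simp: \<Phi>'_def intro: zspan_base)
  moreover have "q \<bullet> v = 1" using v c2 by (simp add: q_def)
  ultimately have "graded \<Phi>' q" using sl' irr q by (force simp: graded_def)
  then show ?thesis using layer that by blast
qed

section \<open>Embeddable sequences\<close>

lemma nested_sequence_arrow:
  assumes "nested_sequence \<Psi>s Hs" "j < length Hs"
  shows "slrs (\<Psi>s ! j)" "irreducible_system (\<Psi>s ! j)" "three_grading (\<Psi>s ! j) (Hs ! j)"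
    "\<Psi>s ! Suc j = (Hs ! j) 0" "\<Psi>s ! Suc j \<noteq> {}" "slrs (\<Psi>s ! Suc j)"
  using assms nth_mem[of j \<Psi>s] nth_mem[of "Suc j" \<Psi>s] unfolding nested_sequence_def by auto

lemma nested_sequence_length:
  "nested_sequence \<Psi>s Hs \<Longrightarrow> length \<Psi>s = Suc (length Hs)" "nested_sequence \<Psi>s Hs \<Longrightarrow> length Hs \<ge> 1"
  unfolding nested_sequence_def by auto

lemma sequence_isomorphic_refl: "sequence_isomorphic \<Psi>s Hs \<Psi>s Hs"
  unfolding sequence_isomorphic_def
  by (intro exI[of _ "\<lambda>x. x"])
     (auto simp: root_isomorphism_iff isometry_on_id carries_grading_def list_all2_same)

lemma embeddable_left:
  assumes "nested_sequence \<Psi>s Hs" "graded (\<Psi>s ! 0) h" "h \<in> span (\<Psi>s ! 0)" "h \<bullet> h < 3 / 2"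
  shows "embeddable \<Psi>s Hs"
proof -
  obtain \<Phi> q where q: "graded \<Phi> q" "layer \<Phi> q 0 = \<Psi>s ! 0" using left_extension[OF assms(2-4)] .
  let ?G = "\<lambda>i. layer \<Phi> q (of_int i)"
  have "nested_sequence (\<Phi> # \<Psi>s) (?G # Hs)"
    unfolding nested_sequence_def
  proof (intro conjI ballI allI impI)
    show "slrs \<Psi>" "\<Psi> \<noteq> {}" if "\<Psi> \<in> set (\<Phi> # \<Psi>s)" for \<Psi>
      using that graded_slrs[OF q(1)] graded_irreducible[OF q(1)] assms(1)
      by (auto simp: nested_sequence_def irreducible_system_def)
    fix j assume j: "j < length (?G # Hs)"
    show "irreducible_system ((\<Phi> # \<Psi>s) ! j)"
      using j graded_irreducible[OF q(1)] nested_sequence_arrow(2)[OF assms(1)] by (cases j) auto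
    show "three_grading ((\<Phi> # \<Psi>s) ! j) ((?G # Hs) ! j)"
      using j three_grading_layer[OF q(1)] nested_sequence_arrow(3)[OF assms(1)] by (cases j) auto
    show "(\<Phi> # \<Psi>s) ! Suc j = ((?G # Hs) ! j) 0"
      using j q(2) nested_sequence_arrow(4)[OF assms(1)] by (cases j) auto
  qed (use nested_sequence_length[OF assms(1)] in auto)
  then show ?thesis
    unfolding embeddable_def
    by (intro exI[of _ "\<Phi> # \<Psi>s"] exI[of _ "?G # Hs"] exI[of _ 1]) (simp add: sequence_isomorphic_refl)
qed

lemma embeddable_right:
  assumes "nested_sequence \<Psi>s Hs" "\<Psi> = \<Psi>s ! length Hs" "graded \<Psi> h" "layer \<Psi> h 0 \<noteq> {}"
  shows "embeddable \<Psi>s Hs"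
proof -
  let ?G = "\<lambda>i. layer \<Psi> h (of_int i)"
  note len = nested_sequence_length[OF assms(1)]
  have "nested_sequence (\<Psi>s @ [layer \<Psi> h 0]) (Hs @ [?G])"
    unfolding nested_sequence_def
  proof (intro conjI ballI allI impI)
    show "slrs \<Psi>'" "\<Psi>' \<noteq> {}" if "\<Psi>' \<in> set (\<Psi>s @ [layer \<Psi> h 0])" for \<Psi>'
      using that slrs_layer_0[OF graded_slrs[OF assms(3)]] assms(1,4)
      by (auto simp: nested_sequence_def)
    fix j assume j: "j < length (Hs @ [?G])"
    show "irreducible_system ((\<Psi>s @ [layer \<Psi> h 0]) ! j)"
      using j len assms(2) graded_irreducible[OF assms(3)] nested_sequence_arrow(2)[OF assms(1), of j]
      by (cases "j = length Hs") (auto simp: nth_append)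
    show "three_grading ((\<Psi>s @ [layer \<Psi> h 0]) ! j) ((Hs @ [?G]) ! j)"
      using j len assms(2) three_grading_layer[OF assms(3)] nested_sequence_arrow(3)[OF assms(1), of j]
      by (cases "j = length Hs") (auto simp: nth_append)
    show "(\<Psi>s @ [layer \<Psi> h 0]) ! Suc j = ((Hs @ [?G]) ! j) 0"
      using j len nested_sequence_arrow(4)[OF assms(1), of j]
      by (cases "j = length Hs") (auto simp: nth_append)
  qed (use len in auto)
  then show ?thesis
    unfolding embeddable_def
    by (intro exI[of _ "\<Psi>s @ [layer \<Psi> h 0]"] exI[of _ "Hs @ [?G]"] exI[of _ 0])
       (simp add: sequence_isomorphic_refl)
qed

section \<open>Classification of the graded systems\<close>

definition clique :: "'a::real_inner set \<Rightarrow> bool" where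
  "clique S \<longleftrightarrow> (\<forall>a\<in>S. \<forall>b\<in>S. a \<noteq> b \<longrightarrow> a \<bullet> b = 1)"

text \<open>For a root \<open>v\<close> of degree 1 and the part \<open>X\<close> of degree 0, the
  neighbours of \<open>v\<close> are the differences of \<open>v\<close> with these roots. For a
  summand of that part, they are the neighbours reached through the summand.\<close>

definition upper :: "'a::real_inner set \<Rightarrow> 'a \<Rightarrow> 'a set" where
  "upper X v = {\<alpha> \<in> X. v \<bullet> \<alpha> = 1}"

text \<open>The Gram matrix of \<open>S\<close> is the identity plus the all-ones matrix, so the sum
  of \<open>S\<close> has product \<open>card S + 1\<close> with every member. The vector
  \<open>w\<close> is a fundamental weight of type A.\<close>

lemma clique_weight:
  assumes "finite S" "clique S" "\<And>s. s \<in> S \<Longrightarrow> s \<bullet> s = 2"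
  defines "w \<equiv> (1 / (real (card S) + 1)) *\<^sub>R \<Sum>S"
  shows "s \<in> S \<Longrightarrow> w \<bullet> s = 1" "w \<bullet> w = card S / (real (card S) + 1)" "w \<in> span S"
proof -
  have 1: "w \<bullet> s = 1" if "s \<in> S" for s
  proof -
    have "(\<Sum>S) \<bullet> s = (\<Sum>t\<in>S. (if t = s then 1 else 0) + 1)"
      unfolding inner_sum_left
      by (intro sum.cong refl) (use assms that in \<open>auto simp: clique_def\<close>)
    also have "\<dots> = real (card S) + 1"
      using assms(1) that by (simp add: sum.distrib sum.delta)
    finally show ?thesis by (simp add: w_def)
  qed
  then show "s \<in> S \<Longrightarrow> w \<bullet> s = 1" .
  have "w \<bullet> w = w \<bullet> ((1 / (real (card S) + 1)) *\<^sub>R \<Sum>S)" by (simp only: w_def)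
  then have "w \<bullet> w = (1 / (real (card S) + 1)) * (w \<bullet> \<Sum>S)" by simp
  also have "w \<bullet> \<Sum>S = (\<Sum>s\<in>S. 1)" unfolding inner_sum_right using 1 by (intro sum.cong) auto
  finally show "w \<bullet> w = card S / (real (card S) + 1)" by simp
  show "w \<in> span S" unfolding w_def by (intro span_scale span_sum span_base)
qed

text \<open>If \<open>a \<bullet> b = -1\<close>, then \<open>a + b\<close> is a root of degree 0
  with product 2 with \<open>v\<close>, so it would be \<open>v\<close> itself, which has degree
  1.\<close>

lemma local_inner:
  assumes "graded \<Phi> q" "v \<in> layer \<Phi> q 1" "a \<in> layer \<Phi> q 0" "b \<in> layer \<Phi> q 0"
    "v \<bullet> a = 1" "v \<bullet> b = 1"
  shows "a = b \<or> a \<bullet> b = 1 \<or> a \<bullet> b = 0"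
proof -
  note sl = graded_slrs[OF assms(1)]
  have ab: "a \<in> \<Phi>" "b \<in> \<Phi>" "q \<bullet> a = 0" "q \<bullet> b = 0" "v \<in> \<Phi>" "q \<bullet> v = 1"
    using assms by (auto simp: layer_def)
  show ?thesis
  proof (rule root_inner_cases[OF sl ab(1,2)])
    assume "a \<bullet> b = -1"
    then have "a + b \<in> \<Phi>" using root_add sl ab by blast
    moreover have "v \<bullet> (a + b) = 2" using assms by (simp add: inner_add_right)
    ultimately have "v = a + b" using root_eqI sl ab by blast
    then show ?thesis using ab by (simp add: inner_add_right)
  qed (use assms in auto)
qed

text \<open>A component of the part of degree 0 is generated by its roots that are nonorthogonal to a root
  of degree 1, because a component orthogonal to that root would split off the whole system.\<close>

lemma upper_generates:
  assumes "graded \<Phi> q" "v \<in> layer \<Phi> q 1" "layer \<Phi> q 0 = X \<union> Y"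
    "\<forall>x\<in>X. \<forall>y\<in>Y. x \<bullet> y = 0" "\<alpha> \<in> X"
  shows "\<alpha> \<in> upper X v \<or> - \<alpha> \<in> upper X v \<or> (\<exists>x\<in>upper X v. \<exists>x'\<in>upper X v. \<alpha> = x - x')"
proof -
  note sl = graded_slrs[OF assms(1)]
  let ?L = "layer \<Phi> q 0"
  have root: "\<beta> \<in> \<Phi>" "\<beta> \<bullet> \<beta> = 2" "- \<beta> \<in> ?L" "v \<bullet> \<beta> \<in> {-1, 0, 1}" if "\<beta> \<in> ?L" for \<beta>
    using that root_norm[OF sl] root_minus[OF sl] layer_10_inner[OF assms(1,2) that]
    by (auto simp: layer_def)
  have inX: "\<beta> \<in> X" if "\<beta> \<in> ?L" "\<gamma> \<in> X" "\<gamma> \<bullet> \<beta> \<noteq> 0" for \<beta> \<gamma>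
    using that assms(3,4) by blast
  have minus: "- \<beta> \<in> upper X v" if "\<beta> \<in> X" "v \<bullet> \<beta> = -1" for \<beta>
  proof -
    have "\<beta> \<in> ?L" using that assms(3) by auto
    then show ?thesis using inX[of "- \<beta>" \<beta>] that root[of \<beta>] by (auto simp: upper_def)
  qed
  have diff: "\<exists>x\<in>upper X v. \<exists>x'\<in>upper X v. \<beta> = x - x'"
    if b: "\<beta> \<in> X" "v \<bullet> \<beta> = 0" and x: "x \<in> upper X v" "x \<bullet> \<beta> \<noteq> 0" for \<beta> x
  proof -
    have bL: "\<beta> \<in> ?L" and xL: "x \<in> ?L" and vx: "v \<bullet> x = 1" and xX: "x \<in> X"
      using b x assms(3) by (auto simp: upper_def)
    have "x \<noteq> \<beta>" "x \<noteq> - \<beta>" using vx b by auto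
    then have "x \<bullet> \<beta> = 1 \<or> x \<bullet> \<beta> = -1"
      using x(2) root_inner_cases[OF sl root(1)[OF xL] root(1)[OF bL], of "x \<bullet> \<beta> = 1 \<or> x \<bullet> \<beta> = -1"]
      by (metis minus_minus)
    then show ?thesis
    proof
      assume 1: "x \<bullet> \<beta> = 1"
      then have "x - \<beta> \<in> ?L" using root_diff[OF sl] bL xL by (auto simp: layer_def inner_diff_right)
      moreover have "x \<bullet> (x - \<beta>) = 1" using 1 root(2)[OF xL] by (simp add: inner_diff_right)
      ultimately have "x - \<beta> \<in> upper X v"
        using inX[OF _ xX, of "x - \<beta>"] vx b by (simp add: upper_def inner_diff_right)
      moreover have "\<beta> = x - (x - \<beta>)" by simp
      ultimately show ?thesis using x(1) by blast
    next
      assume 1: "x \<bullet> \<beta> = -1"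
      then have "x + \<beta> \<in> ?L" using root_add[OF sl] bL xL by (auto simp: layer_def inner_add_right)
      moreover have "x \<bullet> (x + \<beta>) = 1" using 1 root(2)[OF xL] by (simp add: inner_add_right)
      ultimately have "x + \<beta> \<in> upper X v"
        using inX[OF _ xX, of "x + \<beta>"] vx b by (simp add: upper_def inner_add_right)
      moreover have "\<beta> = x + \<beta> - x" by simp
      ultimately show ?thesis using x(1) by blast
    qed
  qed
  have "\<exists>x\<in>upper X v. x \<bullet> \<alpha> \<noteq> 0" if "v \<bullet> \<alpha> = 0"
  proof (rule ccontr)
    assume neg: "\<not> ?thesis"
    define Z where "Z = {\<beta> \<in> X. v \<bullet> \<beta> = 0 \<and> (\<forall>x\<in>upper X v. x \<bullet> \<beta> = 0)}"
    have "\<exists>\<beta>\<in>Z. v \<bullet> \<beta> = 1"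
    proof (rule layer_0_nonorth[OF assms(1,2), of Z "?L - Z"])
      show "?L = Z \<union> (?L - Z)" using assms(3) by (auto simp: Z_def)
      show "Z \<noteq> {}" using neg that assms(5) by (auto simp: Z_def)
      fix z y assume z: "z \<in> Z" and y: "y \<in> ?L - Z"
      then have zo: "x \<bullet> z = 0" if "x \<in> upper X v" for x using that by (auto simp: Z_def)
      show "z \<bullet> y = 0"
      proof (cases "y \<in> X")
        case False
        then show ?thesis using y z assms(3,4) by (auto simp: Z_def)
      next
        case True
        have "y \<in> upper X v \<or> - y \<in> upper X v \<or> (\<exists>x\<in>upper X v. \<exists>x'\<in>upper X v. y = x - x')"
        proof -
          have "v \<bullet> y \<in> {-1, 0, 1}" using root(4) y by blast
          then consider "v \<bullet> y = 1" | "v \<bullet> y = -1" | "v \<bullet> y = 0" by auto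
          then show ?thesis
          proof cases
            case 3
            then show ?thesis using diff[OF True] y True by (auto simp: Z_def)
          qed (use True minus in \<open>auto simp: upper_def\<close>)
        qed
        then show ?thesis
        proof (elim disjE bexE)
          assume "- y \<in> upper X v"
          from zo[OF this] show ?thesis by (simp add: inner_commute)
        next
          fix x x' assume "x \<in> upper X v" "x' \<in> upper X v" "y = x - x'"
          then show ?thesis using zo by (simp add: inner_diff_left inner_commute[of z])
        qed (use zo in \<open>simp add: inner_commute\<close>)
      qed
    qed
    then show False by (auto simp: Z_def)
  qed
  moreover have "v \<bullet> \<alpha> \<in> {-1, 0, 1}" using root(4) assms(3,5) by blast
  ultimately show ?thesis using minus diff assms(5) by (auto simp: upper_def)
qed

text \<open>Type \<open>A\<^sub>n\<close>: with \<open>v = e\<^sub>0 - f\<^sub>0\<close>, the set \<open>S\<close> consists of the roots \<open>e\<^sub>0 - e\<^sub>i\<close> and \<open>e\<^sub>0 - f\<^sub>j\<close>.\<close>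

lemma type_A_weight:
  assumes "graded \<Phi> q" "v \<in> layer \<Phi> q 1" "layer \<Phi> q 0 = X \<union> Y"
    "\<forall>x\<in>X. \<forall>y\<in>Y. x \<bullet> y = 0"
    "clique (upper X v)" "clique (upper Y v)"
  shows "\<exists>h\<in>span \<Phi>. graded \<Phi> h \<and> h \<bullet> h < 1"
proof -
  note sl = graded_slrs[OF assms(1)]
  have v: "v \<in> \<Phi>" "v \<bullet> v = 2" "q \<bullet> v = 1" using assms(2) root_norm[OF sl] by (auto simp: layer_def)
  have XYL: "X \<subseteq> \<Phi>" "Y \<subseteq> \<Phi>" "\<And>x. x \<in> X \<Longrightarrow> q \<bullet> x = 0" "\<And>x. x \<in> Y \<Longrightarrow> q \<bullet> x = 0"
    using assms(3) by (auto simp: layer_def)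
  have uX: "x \<in> X" "x \<in> \<Phi>" "v \<bullet> x = 1" "x \<bullet> x = 2" if "x \<in> upper X v" for x
    using that XYL root_norm[OF sl] by (auto simp: upper_def)
  have uY: "x \<in> Y" "x \<in> \<Phi>" "v \<bullet> x = 1" "x \<bullet> x = 2" if "x \<in> upper Y v" for x
    using that XYL root_norm[OF sl] by (auto simp: upper_def)
  have XX: "x \<bullet> x' = 1" if "x \<in> upper X v" "x' \<in> upper X v" "x \<noteq> x'" for x x'
    using assms(5) that by (auto simp: clique_def)
  have YY: "x \<bullet> x' = 1" if "x \<in> upper Y v" "x' \<in> upper Y v" "x \<noteq> x'" for x x'
    using assms(6) that by (auto simp: clique_def)
  \<comment> \<open>In coordinates the members of \<open>upper Y v\<close> are the
    \<open>f_j - f_0\<close>, so subtracting them from \<open>v\<close> gives the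
    \<open>e_0 - f_j\<close>. The weight \<open>h\<close> of this clique is 1 on every root that
    starts at \<open>e_0\<close>.\<close>
  define S where "S = insert v (upper X v \<union> (\<lambda>y. v - y) ` upper Y v)"
  have S\<Phi>: "S \<subseteq> \<Phi>" using v uX uY root_diff[OF sl] by (auto simp: S_def)
  have fin: "finite S" using S\<Phi> root_finite[OF sl] by (rule finite_subset)
  have e: "v \<bullet> x = 1 \<and> x \<bullet> v = 1" if "x \<in> upper X v \<union> upper Y v" for x
    using that uX(3) uY(3) by (metis UnE inner_commute)
  have e': "x \<bullet> y = 0 \<and> y \<bullet> x = 0" if "x \<in> upper X v" "y \<in> upper Y v" for x y
    using that uX(1) uY(1) assms(4) by (metis inner_commute)
  have cl: "clique S"
    unfolding clique_def S_def using v e e' uX uY XX YY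
    by (auto simp: inner_diff_left inner_diff_right)
  define h where "h = (1 / (real (card S) + 1)) *\<^sub>R \<Sum>S"
  have h: "s \<in> S \<Longrightarrow> h \<bullet> s = 1" "h \<bullet> h = card S / (real (card S) + 1)" "h \<in> span S" for s
    using clique_weight[OF fin cl] root_norm[OF sl] S\<Phi> unfolding h_def by blast+
  have hX: "h \<bullet> x = 1" if "x \<in> upper X v" for x using that h(1) by (auto simp: S_def)
  have hv: "h \<bullet> v = 1" using h(1) by (auto simp: S_def)
  have hY: "h \<bullet> y = 0" if "y \<in> upper Y v" for y
    using h(1)[of "v - y"] that hv by (auto simp: S_def inner_diff_right)
  note genX = upper_generates[OF assms(1-4)]
  have genY: "\<alpha> \<in> upper Y v \<or> - \<alpha> \<in> upper Y v \<or> (\<exists>x\<in>upper Y v. \<exists>x'\<in>upper Y v. \<alpha> = x - x')"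
    if "\<alpha> \<in> Y" for \<alpha>
    using upper_generates[OF assms(1,2), of Y X \<alpha>] assms(3,4) that by (metis Un_commute inner_commute)
  have hY': "h \<bullet> \<alpha> = 0" if "\<alpha> \<in> Y" for \<alpha>
    using genY[OF that] hY by (auto simp: inner_diff_right) (metis hY inner_minus_right neg_equal_0_iff_equal)
  have hX': "h \<bullet> \<alpha> \<in> {-1, 0, 1}" if "\<alpha> \<in> X" for \<alpha>
    using genX[OF that] hX[of \<alpha>] hX[of "- \<alpha>"] hX by (auto simp: inner_diff_right)
  \<comment> \<open>The two shapes of a root of degree 1: \<open>e_0 - f_j\<close>, which has
    product 1 with every \<open>e_0 - e_i\<close>, and \<open>e_i - f_j\<close>, which has product
    -1 with \<open>x0 = e_0 - e_i\<close> and 0 with the others. Moves within \<open>X\<close> pass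
    between these shapes.\<close>
  define P where "P u \<longleftrightarrow> (h \<bullet> u = 1 \<and> (\<forall>x\<in>upper X v. u \<bullet> x = 1)) \<or>
    (h \<bullet> u = 0 \<and> (\<exists>x0\<in>upper X v. u \<bullet> x0 = -1 \<and> (\<forall>x\<in>upper X v. x \<noteq> x0 \<longrightarrow> u \<bullet> x = 0)))" for u
  have P: "P w" if "w \<in> layer \<Phi> q 1" for w
    using assms(1,2) that
  proof (induction rule: layer_1_induct)
    case base
    then show ?case using hv uX by (simp add: P_def)
  next
    case (step u \<gamma>)
    show ?case
    proof (cases "\<gamma> \<in> X")
      case False
      then have g: "\<gamma> \<in> Y" using step assms(3) by auto
      then have "(u - \<gamma>) \<bullet> x = u \<bullet> x" if "x \<in> upper X v" for x

      proof -
        have "\<gamma> \<bullet> x = 0" using assms(4) uX(1)[OF that] g by (metis inner_commute)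
        then show ?thesis by (simp add: inner_diff_left)
      qed
      moreover have "h \<bullet> (u - \<gamma>) = h \<bullet> u" using hY'[OF g] by (simp add: inner_diff_right)
      ultimately show ?thesis using step(5) by (simp add: P_def)
    next
      case True
      from step(5)[unfolded P_def] show ?thesis
      proof (elim disjE conjE bexE)
        assume hu: "h \<bullet> u = 1" and ux: "\<forall>x\<in>upper X v. u \<bullet> x = 1"
        from genX[OF True] show ?thesis
        proof (elim disjE bexE)
          assume g: "\<gamma> \<in> upper X v"
          then have "h \<bullet> (u - \<gamma>) = 0" using hu hX by (simp add: inner_diff_right)
          moreover have "(u - \<gamma>) \<bullet> \<gamma> = -1" using step(3) uX(4)[OF g] by (simp add: inner_diff_left)
          moreover have "\<forall>x\<in>upper X v. x \<noteq> \<gamma> \<longrightarrow> (u - \<gamma>) \<bullet> x = 0"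
            using ux XX g by (auto simp: inner_diff_left)
          ultimately show ?thesis using g unfolding P_def by blast
        next
          assume "- \<gamma> \<in> upper X v"
          then have "u \<bullet> (- \<gamma>) = 1" using ux by blast
          then show ?thesis using step(3) by simp
        next
          fix x x' assume "x \<in> upper X v" "x' \<in> upper X v" "\<gamma> = x - x'"
          then show ?thesis using step(3) ux by (simp add: inner_diff_right)
        qed
      next
        fix x0 assume hu: "h \<bullet> u = 0" and x0: "x0 \<in> upper X v" "u \<bullet> x0 = -1"
          and ux: "\<forall>x\<in>upper X v. x \<noteq> x0 \<longrightarrow> u \<bullet> x = 0"
        have le: "u \<bullet> x \<le> 0" if "x \<in> upper X v" for x using that ux x0 by (cases "x = x0") auto
        from genX[OF True] show ?thesis
        proof (elim disjE bexE)
          assume "\<gamma> \<in> upper X v"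
          then show ?thesis using le step(3) by fastforce
        next
          assume g: "- \<gamma> \<in> upper X v"
          then have "- \<gamma> = x0" using ux step(3) by force
          then have g0: "\<gamma> = - x0" by auto
          have "h \<bullet> (u - \<gamma>) = 1" using hu hX x0 g0 by (simp add: inner_add_right)
          moreover have "(u - \<gamma>) \<bullet> x = 1" if "x \<in> upper X v" for x
            using ux x0 XX[OF x0(1) that] uX(4)[OF x0(1)] g0 that
            by (cases "x = x0") (auto simp: inner_add_left)
          ultimately show ?thesis unfolding P_def by blast
        next
          fix x x' assume x: "x \<in> upper X v" "x' \<in> upper X v" "\<gamma> = x - x'"
          then have e: "u \<bullet> x - u \<bullet> x' = 1" using step(3) by (simp add: inner_diff_right)
          have x'0: "x' = x0" using ux x le[OF x(1)] e by force
          then have xx0: "x \<noteq> x0" using e by auto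
          have "h \<bullet> (u - \<gamma>) = 0" using hu hX x by (simp add: inner_diff_right)
          moreover have "(u - \<gamma>) \<bullet> x = -1"
            using ux x xx0 x'0 XX[OF x0(1) x(1)] uX(4)[OF x(1)] by (simp add: inner_diff_left)
          moreover have "(u - \<gamma>) \<bullet> z = 0" if z: "z \<in> upper X v" "z \<noteq> x" for z
            using ux x xx0 x'0 x0 z XX[OF x(1) z(1)] XX[OF x0(1) z(1)] XX[OF x(1) x0(1)] uX(4)[OF x0(1)]
            by (cases "z = x0") (auto simp: inner_diff_left)
          ultimately show ?thesis using x(1) unfolding P_def by blast
        qed
      qed
    qed
  qed
  have "h \<bullet> \<alpha> \<in> {-1, 0, 1}" if "\<alpha> \<in> \<Phi>" for \<alpha>
  proof (rule graded_cases[OF assms(1) that])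
    assume "\<alpha> \<in> layer \<Phi> q 1"
    then show ?thesis using P[of \<alpha>] by (auto simp: P_def)
  next
    assume "- \<alpha> \<in> layer \<Phi> q 1"
    then show ?thesis using P[of "- \<alpha>"] by (auto simp: P_def)
  next
    assume "\<alpha> \<in> layer \<Phi> q 0"
    then show ?thesis using hX' hY' assms(3) by blast
  qed
  then have "graded \<Phi> h"
    using assms(1) hv v(1) unfolding graded_def by force
  moreover have "h \<bullet> h < 1" unfolding h(2) by simp
  moreover have "h \<in> span \<Phi>" using h(3) span_mono[OF S\<Phi>] by blast
  ultimately show ?thesis by blast
qed

text \<open>If degree 0 decomposes, both summands contain a root with product 1 with
  \<open>v\<close>. Two orthogonal such roots in one summand, together with one from the other,
  would form a forbidden orthogonal triple; so each summand gives a clique.\<close>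

lemma type_A_or_irreducible:
  assumes "graded \<Phi> q" "v \<in> layer \<Phi> q 1"
  obtains X Y where "layer \<Phi> q 0 = X \<union> Y" "\<forall>x\<in>X. \<forall>y\<in>Y. x \<bullet> y = 0"
      "clique (upper X v)" "clique (upper Y v)"
  | a b where "irreducible_system (layer \<Phi> q 0)" "a \<in> layer \<Phi> q 0" "b \<in> layer \<Phi> q 0"
      "v \<bullet> a = 1" "v \<bullet> b = 1" "a \<bullet> b = 0"
proof (cases "clique (upper (layer \<Phi> q 0) v)")
  case True
  then show ?thesis by (intro that(1)[of "layer \<Phi> q 0" "{}"]) (auto simp: upper_def clique_def)
next
  case False
  then obtain a b where ab: "a \<in> layer \<Phi> q 0" "b \<in> layer \<Phi> q 0" "v \<bullet> a = 1" "v \<bullet> b = 1" "a \<bullet> b = 0"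
    using local_inner[OF assms] unfolding clique_def upper_def by blast
  show ?thesis
  proof (cases "irreducible_system (layer \<Phi> q 0)")
    case True
    then show ?thesis using that(2) ab by blast
  next
    case False
    moreover have "layer \<Phi> q 0 \<noteq> {}" using ab by auto
    ultimately obtain X Y where XY: "X \<noteq> {}" "Y \<noteq> {}" "layer \<Phi> q 0 = X \<union> Y"
        "\<forall>x\<in>X. \<forall>y\<in>Y. x \<bullet> y = 0"
      unfolding irreducible_system_def by metis
    have cl: "clique (upper X v)" if XY: "Y \<noteq> {}" "layer \<Phi> q 0 = X \<union> Y"
        "\<forall>x\<in>X. \<forall>y\<in>Y. x \<bullet> y = 0" for X Y
      unfolding clique_def
    proof (intro ballI impI)
      fix a b assume ab: "a \<in> upper X v" "b \<in> upper X v" "a \<noteq> b"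
      have "\<exists>y\<in>Y. v \<bullet> y = 1"
        by (rule layer_0_nonorth[OF assms, of Y X]) (use XY in blast, use XY in \<open>metis inner_commute\<close>, use XY in blast)
      then obtain y where "y \<in> Y" "v \<bullet> y = 1" by blast
      then show "a \<bullet> b = 1"
        using ab XY local_inner[OF assms, of a b] no_orthogonal_triple[OF assms, of a b y]
        by (auto simp: upper_def)
    qed
    show ?thesis
    proof (rule that(1)[OF XY(3,4)])
      show "clique (upper X v)" by (rule cl[OF XY(2,3,4)])
      have "layer \<Phi> q 0 = Y \<union> X" "\<forall>y\<in>Y. \<forall>x\<in>X. y \<bullet> x = 0" using XY by (blast, metis inner_commute)
      then show "clique (upper Y v)" by (rule cl[OF XY(1)])
    qed
  qed
qed

subsection \<open>Chains of local systems\<close>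

text \<open>\<open>local_chain l t\<close> describes the graded systems from which \<open>t\<close> steps to the local system lead to
  one whose own part of degree 0 is of type \<open>A\<^sub>1 \<times> A\<^sub>l\<close>.\<close>

primrec local_chain :: "nat \<Rightarrow> nat \<Rightarrow> 'a::real_inner set \<Rightarrow> 'a \<Rightarrow> bool" where
  "local_chain l 0 \<Phi> q \<longleftrightarrow> graded \<Phi> q \<and> q \<in> span \<Phi> \<and>
     (\<exists>v\<in>layer \<Phi> q 1. \<exists>d Y. layer \<Phi> q 0 = {d, - d} \<union> Y \<and> (\<forall>y\<in>Y. d \<bullet> y = 0) \<and> v \<bullet> d = 1 \<and>
        clique (upper Y v) \<and> card (upper Y v) = l \<and> l \<ge> 1)"
| "local_chain l (Suc t) \<Phi> q \<longleftrightarrow> graded \<Phi> q \<and> q \<in> span \<Phi> \<and>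
     (\<exists>v\<in>layer \<Phi> q 1. local_chain l t (layer \<Phi> q 0) (local_weight q v))"

declare local_chain.simps [simp del]

lemma local_chain_graded: "local_chain l t \<Phi> q \<Longrightarrow> graded \<Phi> q"
  and local_chain_span: "local_chain l t \<Phi> q \<Longrightarrow> q \<in> span \<Phi>"
  and local_chain_pos: "local_chain l t \<Phi> q \<Longrightarrow> l \<ge> 1"
  by (induction t arbitrary: \<Phi> q) (auto simp: local_chain.simps)

text \<open>On a path from \<open>a\<close> to \<open>b\<close> the product with \<open>a\<close>
  drops from 1 to 0 at some move from \<open>u\<close> to \<open>u - \<gamma>\<close>. There
  \<open>u - a\<close> and \<gamma> are orthogonal, and both have product 1 with
  \<open>u\<close>.\<close>

lemma local_orthogonal_pair:
  assumes "graded \<Phi> q" "a \<in> layer \<Phi> q 1" "b \<in> layer \<Phi> q 1" "a \<bullet> b = 0"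
  shows "\<exists>v\<in>layer \<Phi> q 1. \<exists>x\<in>layer \<Phi> q 0. \<exists>y\<in>layer \<Phi> q 0. v \<bullet> x = 1 \<and> v \<bullet> y = 1 \<and> x \<bullet> y = 0"
    (is ?C)
proof -
  note sl = graded_slrs[OF assms(1)]
  have "a \<bullet> b = 0 \<longrightarrow> ?C"
    using assms(1-3)
  proof (induction rule: layer_1_induct)
    case base
    then show ?case using root_norm[OF sl, of a] assms(2) by (simp add: layer_def)
  next
    case (step u \<gamma>)
    show ?case
    proof
      assume 0: "a \<bullet> (u - \<gamma>) = 0"
      show ?C
      proof (rule layer_1_inner[OF assms(1,2) step(1)])
        assume "a \<bullet> u = 2"
        then show ?C using 0 layer_10_inner[OF assms(1,2) step(2)] by (auto simp: inner_diff_right)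
      next
        assume 1: "a \<bullet> u = 1"
        then have "u - a \<in> layer \<Phi> q 0"
          using root_diff[OF sl, of u a] step(1) assms(2) by (auto simp: layer_def inner_diff_right inner_commute)
        moreover have "u \<bullet> (u - a) = 1" "(u - a) \<bullet> \<gamma> = 0"
          using 0 1 step(3) root_norm[OF sl, of u] step(1)
          by (auto simp: layer_def inner_diff_right inner_diff_left inner_commute)
        ultimately show ?C using step(1-3) by blast
      qed (use step in blast)
    qed
  qed
  then show ?thesis using assms(4) by simp
qed

text \<open>Descent on the number of roots. An irreducible part of degree 0 inherits the absence of
  orthogonal triples. A reducible one consists of two summands with cliques, and one of the cliques
  must be a single root, since otherwise an orthogonal triple appears in degree 1.\<close>

lemma local_chain_exists:
  assumes "graded \<Phi> q" "q \<in> span \<Phi>" "a \<in> layer \<Phi> q 1" "b \<in> layer \<Phi> q 1" "a \<bullet> b = 0"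
    "\<And>a b c. a \<in> layer \<Phi> q 1 \<Longrightarrow> b \<in> layer \<Phi> q 1 \<Longrightarrow> c \<in> layer \<Phi> q 1 \<Longrightarrow>
       a \<bullet> b = 0 \<Longrightarrow> a \<bullet> c = 0 \<Longrightarrow> b \<bullet> c = 0 \<Longrightarrow> False"
  shows "\<exists>l t. local_chain l t \<Phi> q"
  using assms
proof (induction "card \<Phi>" arbitrary: \<Phi> q a b rule: less_induct)
  case less
  note gr = less(2) and sp = less(3) and no_triple = less(7)
  note sl = graded_slrs[OF gr]
  let ?L = "layer \<Phi> q 0"
  obtain v x y where v: "v \<in> layer \<Phi> q 1" and xy: "x \<in> ?L" "y \<in> ?L" "v \<bullet> x = 1" "v \<bullet> y = 1" "x \<bullet> y = 0"
    using local_orthogonal_pair[OF gr less(4-6)] by blast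
  have v\<Phi>: "v \<in> \<Phi>" "v \<bullet> v = 2" "q \<bullet> v = 1" using v root_norm[OF sl] by (auto simp: layer_def)
  show ?case
  proof (rule type_A_or_irreducible[OF gr v])
    fix X Y assume XY: "?L = X \<union> Y" "\<forall>x\<in>X. \<forall>y\<in>Y. x \<bullet> y = 0"
      and cl: "clique (upper X v)" "clique (upper Y v)"
    have YX: "?L = Y \<union> X" "\<forall>x\<in>Y. \<forall>y\<in>X. x \<bullet> y = 0"
      using XY by (blast, metis inner_commute)
    have xy2: "x \<bullet> x = 2" "y \<bullet> y = 2" using xy root_norm[OF sl] by (auto simp: layer_def)
    have "x \<noteq> y" using xy2 xy(5) by auto
    have "\<not> (x \<in> X \<and> y \<in> X)" "\<not> (x \<in> Y \<and> y \<in> Y)"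
    proof -
      have "x \<bullet> y = 1" if "clique (upper Z v)" "x \<in> Z \<and> y \<in> Z" for Z
        using that \<open>x \<noteq> y\<close> xy(3,4) unfolding clique_def upper_def by blast
      then show "\<not> (x \<in> X \<and> y \<in> X)" "\<not> (x \<in> Y \<and> y \<in> Y)" using cl xy(5) by force+
    qed
    then have "(x \<in> X \<and> y \<in> Y) \<or> (x \<in> Y \<and> y \<in> X)" using xy(1,2) XY(1) by blast
    then have ne: "upper X v \<noteq> {}" "upper Y v \<noteq> {}" using xy by (auto simp: upper_def)
    have final: "\<exists>l t. local_chain l t \<Phi> q"
      if XY: "?L = X \<union> Y" "\<forall>x\<in>X. \<forall>y\<in>Y. x \<bullet> y = 0"
        and cl: "clique (upper Y v)" "upper Y v \<noteq> {}" and d: "upper X v = {d}" for X Y d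
    proof -
      have dX: "d \<in> X" "v \<bullet> d = 1" using d by (auto simp: upper_def)
      have dL: "d \<in> \<Phi>" "d \<bullet> d = 2" "- d \<in> ?L"
      proof -
        have "d \<in> ?L" using dX XY(1) by blast
        then show "d \<in> \<Phi>" "d \<bullet> d = 2" "- d \<in> ?L"
          using root_norm[OF sl] root_minus[OF sl] by (auto simp: layer_def)
      qed
      have "- d \<notin> Y" using XY(2) dX(1) dL by fastforce
      then have "- d \<in> X" using dL XY(1) by auto
      \<comment> \<open>The clique of \<open>X\<close> is the single root \<open>d\<close>, and a
        difference of its members is 0, which is not a root; so \<open>X\<close> is of type
        A1.\<close>
      moreover have "\<alpha> = d \<or> \<alpha> = - d" if "\<alpha> \<in> X" for \<alpha>
      proof -
        have "\<alpha> \<bullet> \<alpha> = 2" using that XY(1) root_norm[OF sl] by (auto simp: layer_def)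
        then show ?thesis using upper_generates[OF gr v XY that] unfolding d by force
      qed
      ultimately have X: "X = {d, - d}" using dX by auto
      have "finite (upper Y v)" using finite_layer[OF sl, of q 0] XY(1) by (auto simp: upper_def)
      then have "card (upper Y v) \<ge> 1" using cl(2) by (simp add: Suc_leI card_gt_0_iff)
      then have "local_chain (card (upper Y v)) 0 \<Phi> q"
        using gr sp v XY cl(1) dX X by (auto simp: local_chain.simps intro!: bexI[of _ v] exI[of _ d] exI[of _ Y])
      then show ?thesis by blast
    qed
    show ?thesis
    proof (cases "\<exists>x1\<in>upper X v. \<exists>x2\<in>upper X v. x1 \<noteq> x2")
      case False
      then obtain d where "upper X v = {d}" using ne by blast
      then show ?thesis using final[OF XY cl(2) ne(2)] by blast
    next
      case X2: True
      show ?thesis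
      proof (cases "\<exists>x1\<in>upper Y v. \<exists>x2\<in>upper Y v. x1 \<noteq> x2")
        case False
        then obtain d where "upper Y v = {d}" using ne by blast
        then show ?thesis using final[OF YX cl(1) ne(1)] by blast
      next
        case True
        then obtain y1 y2 where y: "y1 \<in> upper Y v" "y2 \<in> upper Y v" "y1 \<noteq> y2" by blast
        obtain x1 x2 where x: "x1 \<in> upper X v" "x2 \<in> upper X v" "x1 \<noteq> x2" using X2 by blast
        have xx: "x1 \<bullet> x2 = 1" "y1 \<bullet> y2 = 1" using x y cl by (auto simp: clique_def)
        have up: "x1 \<in> X" "x2 \<in> X" "y1 \<in> Y" "y2 \<in> Y" "v \<bullet> x1 = 1" "v \<bullet> x2 = 1" "v \<bullet> y1 = 1" "v \<bullet> y2 = 1"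
          using x y by (auto simp: upper_def)
        then have or: "x1 \<bullet> y1 = 0" "x1 \<bullet> y2 = 0" "x2 \<bullet> y1 = 0" "x2 \<bullet> y2 = 0" using XY(2) by auto
        have L: "x1 \<in> ?L" "x2 \<in> ?L" "y1 \<in> ?L" "y2 \<in> ?L" using up XY(1) by auto
        have w: "v - a - b \<in> layer \<Phi> q 1" if "a \<in> ?L" "b \<in> ?L" "v \<bullet> a = 1" "v \<bullet> b = 1" "a \<bullet> b = 0" for a b
          using layer_1_diff[OF gr layer_1_diff[OF gr v that(1,3)] that(2)] that by (simp add: inner_diff_left)
        \<comment> \<open>The roots \<open>v\<close>, \<open>v - x1 - y1\<close> and
          \<open>v - x2 - y2\<close> are pairwise orthogonal.\<close>
        have False
          by (rule no_triple[OF v w[of x1 y1] w[of x2 y2]])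
             (use L up or xx v\<Phi> in \<open>simp_all add: inner_diff_left inner_diff_right inner_commute\<close>)
        then show ?thesis ..
      qed
    qed
  next
    fix a b assume irr: "irreducible_system ?L"
      and ab: "a \<in> ?L" "b \<in> ?L" "v \<bullet> a = 1" "v \<bullet> b = 1" "a \<bullet> b = 0"
    let ?p = "local_weight q v"
    note p = local_weight[OF gr v sp]
    have gp: "graded ?L ?p" using graded_local[OF gr v irr] graded_cong[of ?L ?p v] p(2) by blast
    have up: "x \<in> layer ?L ?p 1 \<longleftrightarrow> x \<in> ?L \<and> v \<bullet> x = 1" for x
      using p(2)[of x] by (auto simp: layer_def[of ?L])
    have "v \<notin> ?L" using v\<Phi> by (auto simp: layer_def)
    moreover have "?L \<subseteq> \<Phi>" by (auto simp: layer_def)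
    ultimately have "?L \<subset> \<Phi>" using v\<Phi>(1) by blast
    then have "card ?L < card \<Phi>" using root_finite[OF sl] by (rule psubset_card_mono[rotated])
    then have "\<exists>l t. local_chain l t ?L ?p"
    proof (rule less(1)[OF _ gp p(1), of a b])
      show "False" if "a \<in> layer ?L ?p 1" "b \<in> layer ?L ?p 1" "c \<in> layer ?L ?p 1"
          "a \<bullet> b = 0" "a \<bullet> c = 0" "b \<bullet> c = 0" for a b c
        using no_orthogonal_triple[OF gr v] that unfolding up by blast
    qed (use ab up in auto)
    then obtain l t where "local_chain l t ?L ?p" by blast
    then have "local_chain l (Suc t) \<Phi> q" using gr sp v by (auto simp: local_chain.simps)
    then show ?thesis by blast
  qed
qed

text \<open>The induced weight is the sum of \<open>d\<close> halved, of norm \<open>1/2\<close>,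
  and the weight of an A_l clique, of norm \<open>l / (l + 1)\<close>; the two are orthogonal. The
  claim is then the norm formula of \<open>local_weight\<close>.\<close>

lemma local_chain_0_norm:
  assumes "local_chain l 0 \<Phi> q"
  shows "1 / (q \<bullet> q) = 3 / 2 - l / (l + 1)"
proof -
  obtain v d Y where gr: "graded \<Phi> q" "q \<in> span \<Phi>" and v: "v \<in> layer \<Phi> q 1"
    and L: "layer \<Phi> q 0 = {d, - d} \<union> Y" and dY: "\<And>y. y \<in> Y \<Longrightarrow> d \<bullet> y = 0" and d: "v \<bullet> d = 1"
    and cl: "clique (upper Y v)" "card (upper Y v) = l"
    using assms by (auto simp: local_chain.simps)
  note sl = graded_slrs[OF gr(1)]
  have root: "\<alpha> \<bullet> \<alpha> = 2" if "\<alpha> \<in> layer \<Phi> q 0" for \<alpha> using that root_norm[OF sl] by (auto simp: layer_def)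
  have fin: "finite (upper Y v)" using finite_layer[OF sl, of q 0] L by (auto simp: upper_def)
  define w where "w = (1 / (real (card (upper Y v)) + 1)) *\<^sub>R \<Sum>(upper Y v)"
  have "\<And>s. s \<in> upper Y v \<Longrightarrow> s \<bullet> s = 2" using root L by (auto simp: upper_def)
  note w = clique_weight[OF fin cl(1) this, folded w_def]
  have wd: "w \<bullet> d = 0"
    unfolding w_def inner_scaleR_left inner_sum_left
    using dY by (auto simp: upper_def inner_commute[of _ d] intro!: sum.neutral)
  have wY: "w \<bullet> y = v \<bullet> y" if "y \<in> Y" for y
  proof -
    have "y \<in> upper Y v \<or> - y \<in> upper Y v \<or> (\<exists>x\<in>upper Y v. \<exists>x'\<in>upper Y v. y = x - x')"
      by (rule upper_generates[OF gr(1) v, of _ "{d, - d}"]) (use L dY that in \<open>auto simp: inner_commute\<close>)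
    then show ?thesis
      using w(1)[of y] w(1)[of "- y"] w(1) by (auto simp: upper_def inner_diff_right)
  qed
  define p where "p = (1 / 2) *\<^sub>R d + w"
  have d2: "d \<bullet> d = 2" using root L by auto
  have pd: "p \<bullet> d = 1" using wd d2 by (simp add: p_def inner_add_left)
  have pY: "p \<bullet> y = v \<bullet> y" if "y \<in> Y" for y using wY[OF that] dY[OF that] by (simp add: p_def inner_add_left)
  note lw = local_weight[OF gr(1) v gr(2)]
  have "p = local_weight q v"
  proof (rule span_inner_eqI[OF _ lw(1)])
    have "upper Y v \<subseteq> span (layer \<Phi> q 0)" using L by (auto simp: upper_def intro: span_base)
    then have "w \<in> span (layer \<Phi> q 0)" using w(3) span_minimal[OF _ subspace_span] by blast
    then show "p \<in> span (layer \<Phi> q 0)" unfolding p_def using L by (intro span_add span_scale) (auto intro: span_base)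
    show "p \<bullet> s = local_weight q v \<bullet> s" if "s \<in> layer \<Phi> q 0" for s
      using that lw(2)[OF that] pd pY d L by auto
  qed
  moreover have "p \<bullet> p = 1 / 2 + l / (l + 1)"
  proof -
    have "w \<bullet> w = l / (l + 1)" using w(2) cl(2) by simp
    then show ?thesis using wd d2 by (simp add: p_def inner_add_left inner_add_right inner_commute)
  qed
  ultimately show ?thesis using lw(3) by (simp add: add.commute)
qed

lemma local_chain_Suc_norm [consumes 1]:
  assumes "local_chain l (Suc t) \<Phi> q"
  obtains v where "v \<in> layer \<Phi> q 1" "local_chain l t (layer \<Phi> q 0) (local_weight q v)"
    "1 / (q \<bullet> q) = 2 - local_weight q v \<bullet> local_weight q v"
  using assms local_weight(3)[of \<Phi> q] by (fastforce simp: local_chain.simps)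

lemma reciprocal_eqD: "1 / x = c \<Longrightarrow> x = 1 / (c :: real)"
  by auto

text \<open>For \<open>l = 1\<close> the starting norm is 1, a fixed point of the map x -> 1/(2 - x)
  that describes one step upwards.\<close>

lemma local_chain_1_norm: "local_chain 1 t \<Phi> q \<Longrightarrow> q \<bullet> q = 1"
proof (induction t arbitrary: \<Phi> q)
  case 0
  from reciprocal_eqD[OF local_chain_0_norm[OF this]] show ?case by simp
next
  case (Suc t)
  obtain v where v: "local_chain 1 t (layer \<Phi> q 0) (local_weight q v)"
    "1 / (q \<bullet> q) = 2 - local_weight q v \<bullet> local_weight q v"
    using local_chain_Suc_norm[OF Suc(2)] by blast
  then show ?case using Suc(1)[OF v(1)] reciprocal_eqD[OF v(2)] by simp
qed

text \<open>For \<open>l = 2\<close> the start is 6/5, and the map x -> 1/(2 - x) gives 5/4 and then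
  4/3. One further step would reach 3/2, where extension to the left breaks down.\<close>

lemma local_chain_2_norm: "local_chain 2 (Suc (Suc 0)) \<Phi> q \<Longrightarrow> q \<bullet> q = 4 / 3"
proof -
  have 0: "q \<bullet> q = 6 / 5" if "local_chain 2 0 \<Phi> q" for \<Phi> :: "'a set" and q
    using reciprocal_eqD[OF local_chain_0_norm[OF that]] by simp
  have 1: "q \<bullet> q = 5 / 4" if "local_chain 2 (Suc 0) \<Phi> q" for \<Phi> :: "'a set" and q
    using that
  proof (rule local_chain_Suc_norm)
    fix v assume v: "local_chain 2 0 (layer \<Phi> q 0) (local_weight q v)"
      and n: "1 / (q \<bullet> q) = 2 - local_weight q v \<bullet> local_weight q v"
    then show ?thesis using reciprocal_eqD[OF n] unfolding 0[OF v] by simp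
  qed
  assume "local_chain 2 (Suc (Suc 0)) \<Phi> q"
  then show ?thesis
  proof (rule local_chain_Suc_norm)
    fix v assume v: "local_chain 2 (Suc 0) (layer \<Phi> q 0) (local_weight q v)"
      and n: "1 / (q \<bullet> q) = 2 - local_weight q v \<bullet> local_weight q v"
    then show ?thesis using reciprocal_eqD[OF n] unfolding 1[OF v] by simp
  qed
qed

text \<open>Here the system is of type \<open>D\<^sub>n\<close>, with \<open>v = e\<^sub>1 + e\<^sub>2\<close> and \<open>d = e\<^sub>1 - e\<^sub>2\<close>.\<close>

lemma type_D_weight:
  assumes "local_chain l (Suc 0) \<Phi> q"
  shows "\<exists>h\<in>span \<Phi>. graded \<Phi> h \<and> h \<bullet> h = 1"
proof -
  have gr: "graded \<Phi> q" "q \<in> span \<Phi>" using local_chain_graded local_chain_span assms by blast+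
  note sl = graded_slrs[OF gr(1)]
  let ?L = "layer \<Phi> q 0"
  obtain v where v: "v \<in> layer \<Phi> q 1" and ch: "local_chain l 0 ?L (local_weight q v)"
    using assms by (auto simp: local_chain.simps(2))
  define p where "p = local_weight q v"
  have p: "p \<bullet> \<alpha> = v \<bullet> \<alpha>" if "\<alpha> \<in> ?L" for \<alpha> using local_weight(2)[OF gr(1) v gr(2) that] by (simp add: p_def)
  obtain v' d Y where gp: "graded ?L p" and v': "v' \<in> layer ?L p 1"
    and L: "layer ?L p 0 = {d, - d} \<union> Y" and dY: "\<And>y. y \<in> Y \<Longrightarrow> d \<bullet> y = 0" and d: "v' \<bullet> d = 1"
    using ch unfolding p_def[symmetric] local_chain.simps(1) by blast
  have v2: "v \<in> \<Phi>" "v \<bullet> v = 2" "q \<bullet> v = 1" using v root_norm[OF sl] by (auto simp: layer_def)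
  have dL: "d \<in> layer ?L p 0" "- d \<in> layer ?L p 0" using L by auto
  then have d2: "d \<in> \<Phi>" "d \<bullet> d = 2" "v \<bullet> d = 0" "d \<in> ?L" using root_norm[OF sl] p[of d] by (auto simp: layer_def)
  have dY': "y \<bullet> d = 0" if "y \<in> Y" for y using dY[OF that] by (simp add: inner_commute)
  \<comment> \<open>Moves in this layer subtract \<open>d\<close>, \<open>- d\<close> or a root
    orthogonal to \<open>d\<close>. With the condition on the product along the move, none of them
    makes a nonzero product with \<open>d\<close> vanish.\<close>
  have B1: "\<beta> \<bullet> d \<in> {1, -1}" if "\<beta> \<in> layer ?L p 1" for \<beta>
  proof -
    have "\<beta> \<bullet> d \<noteq> 0"
      using gp v' that
    proof (induction rule: layer_1_induct)
      case (step u \<gamma>)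
      then have "\<gamma> \<in> {d, - d} \<union> Y" using L by simp
      then show ?case using step(3,5) d2 dY' by (auto simp: inner_diff_left inner_add_left)
    qed (use d in auto)
    then show ?thesis using layer_10_inner[OF gp that dL(1)] by auto
  qed
  \<comment> \<open>If both products were equal, subtracting the matching \<open>z\<close> from
    \<beta> would give a root of degree 1 with product -1 with \<gamma>.\<close>
  have B2: "\<beta> \<bullet> d = - (\<gamma> \<bullet> d)" if bg: "\<beta> \<in> layer ?L p 1" "\<gamma> \<in> layer ?L p 1" "\<beta> \<bullet> \<gamma> = 0" for \<beta> \<gamma>
  proof (rule ccontr)
    assume "\<beta> \<bullet> d \<noteq> - (\<gamma> \<bullet> d)"
    then obtain z where z: "z \<in> {d, - d}" "\<beta> \<bullet> z = 1" "\<gamma> \<bullet> z = 1"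
      using B1[OF bg(1)] B1[OF bg(2)] by fastforce
    have "\<beta> - z \<in> layer ?L p 1" by (rule layer_1_diff[OF gp bg(1) _ z(2)]) (use z(1) dL in auto)
    moreover have "\<gamma> \<bullet> (\<beta> - z) = -1" using z bg by (simp add: inner_diff_right inner_commute)
    ultimately show False using layer_1_inner[OF gp bg(2), of "\<beta> - z" False] by fastforce
  qed
  have up: "x \<in> layer ?L p c \<longleftrightarrow> x \<in> ?L \<and> v \<bullet> x = c" for x c
    using p[of x] by (auto simp: layer_def[of ?L])
  define h where "h = (1 / 2) *\<^sub>R (v + d)"
  have hh: "h \<bullet> x = (v \<bullet> x + x \<bullet> d) / 2" for x by (simp add: h_def inner_add_left inner_commute[of d])
  \<comment> \<open>The critical move goes from product 1 with \<open>v\<close> to product 0. There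
    \<open>v - u\<close> and \<gamma> are orthogonal, so \<open>B2\<close> makes the contributions
    of \<open>u\<close> and \<gamma> along \<open>d\<close> equal.\<close>
  have A: "v \<bullet> w = 0 \<longrightarrow> w \<bullet> d = 0" if "w \<in> layer \<Phi> q 1" for w
    using gr(1) v that
  proof (induction rule: layer_1_induct)
    case base
    then show ?case using v2 by simp
  next
    case (step u \<gamma>)
    show ?case
    proof
      assume 0: "v \<bullet> (u - \<gamma>) = 0"
      show "(u - \<gamma>) \<bullet> d = 0"
      proof (rule layer_1_inner[OF gr(1) v step(1)])
        assume "v \<bullet> u = 2"
        then show ?thesis using 0 layer_10_inner[OF gr(1) v step(2)] by (auto simp: inner_diff_right)
      next
        assume 1: "v \<bullet> u = 1"
        then have vu: "v - u \<in> ?L" "v \<bullet> (v - u) = 1"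
          using root_diff[OF sl, of v u] step(1) v2 by (auto simp: layer_def inner_diff_right)
        moreover have g: "v \<bullet> \<gamma> = 1" using 0 1 by (simp add: inner_diff_right)
        moreover have "(v - u) \<bullet> \<gamma> = 0" using g step(3) by (simp add: inner_diff_left)
        ultimately have "(v - u) \<bullet> d = - (\<gamma> \<bullet> d)" using B2 step(2) up by blast
        then show ?thesis using d2(3) by (simp add: inner_diff_left)
      next
        assume 1: "v \<bullet> u = 0"
        then have "\<gamma> \<in> {d, - d} \<union> Y" using L up[of \<gamma> 0] step(2) 0 by (simp add: inner_diff_right)
        moreover have "u \<bullet> d = 0" using step(5) 1 by simp
        ultimately show ?thesis using step(3) dY' by (auto simp: inner_diff_left)
      qed
    qed
  qed
  have h1: "h \<bullet> w \<in> {0, 1}" if w: "w \<in> layer \<Phi> q 1" for w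
  proof (rule layer_1_inner[OF gr(1) v w])
    assume "w = v" then show ?thesis using v2 d2 by (simp add: hh)
  next
    assume 1: "v \<bullet> w = 1"
    then have "v - w \<in> ?L" "v \<bullet> (v - w) = 1"
      using root_diff[OF sl, of v w] w v2 by (auto simp: layer_def inner_diff_right)
    then have "(v - w) \<bullet> d \<in> {1, -1}" using B1 up by blast
    then show ?thesis using 1 d2 by (auto simp: hh inner_diff_left)
  next
    assume "v \<bullet> w = 0"
    then show ?thesis using A[OF w] by (simp add: hh)
  qed
  have h0: "h \<bullet> \<beta> \<in> {-1, 0, 1}" if b: "\<beta> \<in> ?L" for \<beta>
  proof -
    have "v \<bullet> \<beta> \<in> {-1, 0, 1}" using layer_10_inner[OF gr(1) v b] .
    moreover have "- \<beta> \<in> ?L" using b root_minus[OF sl] by (auto simp: layer_def)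
    ultimately consider "\<beta> \<in> layer ?L p 1" "v \<bullet> \<beta> = 1" | "- \<beta> \<in> layer ?L p 1" "v \<bullet> \<beta> = -1" | "\<beta> \<in> layer ?L p 0" "v \<bullet> \<beta> = 0"
      using b up by auto
    then show ?thesis
    proof cases
      case 1
      then show ?thesis using B1[of \<beta>] by (auto simp: hh)
    next
      case 2
      then show ?thesis using B1[of "- \<beta>"] by (auto simp: hh)
    next
      case 3
      then show ?thesis using L dY' d2 by (auto simp: hh)
    qed
  qed
  have "h \<bullet> \<alpha> \<in> {-1, 0, 1}" if "\<alpha> \<in> \<Phi>" for \<alpha>
    using h0 h1[of \<alpha>] h1[of "- \<alpha>"] by (rule_tac graded_cases[OF gr(1) that]) auto
  moreover have "h \<bullet> v = 1" using v2 d2 by (simp add: hh)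
  ultimately have "graded \<Phi> h" using gr(1) v2(1) unfolding graded_def by force
  moreover have "h \<bullet> h = 1" using v2 d2 by (simp add: h_def inner_add_left inner_add_right inner_commute)
  moreover have "h \<in> span \<Phi>" unfolding h_def by (intro span_scale span_add span_base v2 d2)
  ultimately show ?thesis by blast
qed

text \<open>For \<open>l\<close> at least 3 the intermediate system behaves like D6 or larger with a
  half-spin grading, whose roots of degree 1 include the pairwise orthogonal
  \<open>e_1 + e_2\<close>, \<open>e_3 + e_4\<close>, \<open>e_5 + e_6\<close>. One level higher,
  such a triple is forbidden.\<close>

lemma local_chain_2_bound: "local_chain l (Suc (Suc 0)) \<Phi> q \<Longrightarrow> l \<le> 2"
proof (rule ccontr)
  assume ch: "local_chain l (Suc (Suc 0)) \<Phi> q" and l: "\<not> l \<le> 2"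
  have gr: "graded \<Phi> q" "q \<in> span \<Phi>" using local_chain_graded local_chain_span ch by blast+
  obtain v where v: "v \<in> layer \<Phi> q 1" and ch1: "local_chain l (Suc 0) (layer \<Phi> q 0) (local_weight q v)"
    using ch unfolding local_chain.simps(2)[of l "Suc 0"] by blast
  define \<Phi>1 where "\<Phi>1 = layer \<Phi> q 0"
  define q1 where "q1 = local_weight q v"
  have q1: "q1 \<bullet> \<alpha> = v \<bullet> \<alpha>" if "\<alpha> \<in> \<Phi>1" for \<alpha>
    using local_weight(2)[OF gr(1) v gr(2)] that by (simp add: q1_def \<Phi>1_def)
  have gr1: "graded \<Phi>1 q1" "q1 \<in> span \<Phi>1"
    using local_chain_graded local_chain_span ch1 unfolding \<Phi>1_def q1_def by blast+
  obtain v0 where v0: "v0 \<in> layer \<Phi>1 q1 1" and ch2: "local_chain l 0 (layer \<Phi>1 q1 0) (local_weight q1 v0)"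
    using ch1 unfolding \<Phi>1_def[symmetric] q1_def[symmetric] local_chain.simps(2)[of l 0] by blast
  define \<Phi>2 where "\<Phi>2 = layer \<Phi>1 q1 0"
  define q2 where "q2 = local_weight q1 v0"
  have q2: "q2 \<bullet> \<alpha> = v0 \<bullet> \<alpha>" if "\<alpha> \<in> \<Phi>2" for \<alpha>
    using local_weight(2)[OF gr1(1) v0 gr1(2)] that by (simp add: q2_def \<Phi>2_def)
  obtain v' d Y where gr2: "graded \<Phi>2 q2" and v': "v' \<in> layer \<Phi>2 q2 1"
    and L: "layer \<Phi>2 q2 0 = {d, - d} \<union> Y" and dY: "\<And>y. y \<in> Y \<Longrightarrow> d \<bullet> y = 0" and d: "v' \<bullet> d = 1"
    and cl: "clique (upper Y v')" "card (upper Y v') = l"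
    using ch2 unfolding \<Phi>2_def[symmetric] q2_def[symmetric] local_chain.simps(1) by blast
  have "3 \<le> card (upper Y v')" using cl l by simp
  then obtain T where T: "T \<subseteq> upper Y v'" "card T = 3" "finite T"
    by (rule obtain_subset_with_card_n)
  then obtain y1 y2 y3 where "T = {y1, y2, y3}" and ne: "y1 \<noteq> y2" "y1 \<noteq> y3" "y2 \<noteq> y3"
    by (auto simp: card_3_iff)
  then have yu: "y1 \<in> upper Y v'" "y2 \<in> upper Y v'" "y3 \<in> upper Y v'" using T by auto
  then have yY: "y1 \<in> Y" "y2 \<in> Y" "y3 \<in> Y" and vy: "v' \<bullet> y1 = 1" "v' \<bullet> y2 = 1" "v' \<bullet> y3 = 1"
    by (auto simp: upper_def)
  have yy: "y1 \<bullet> y2 = 1" "y1 \<bullet> y3 = 1" "y2 \<bullet> y3 = 1" using yu ne cl(1) by (auto simp: clique_def)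
  have L0: "d \<in> layer \<Phi>2 q2 0" "y1 \<in> layer \<Phi>2 q2 0" "y2 \<in> layer \<Phi>2 q2 0" "y3 \<in> layer \<Phi>2 q2 0"
    using L yY by auto
  have norm2: "x \<bullet> x = 2" if "x \<in> \<Phi>2" for x using root_norm[OF graded_slrs[OF gr2] that] .
  have n: "d \<bullet> d = 2" "y1 \<bullet> y1 = 2" "y2 \<bullet> y2 = 2" "y3 \<bullet> y3 = 2" "v' \<bullet> v' = 2"
    using L0 v' norm2 by (auto simp: layer_def)
  have n0: "v0 \<bullet> v0 = 2" using v0 root_norm[OF graded_slrs[OF gr1(1)]] by (auto simp: layer_def)
  have up2: "x \<in> \<Phi>2 \<and> v0 \<bullet> x = c" if "x \<in> layer \<Phi>2 q2 c" for x c
    using that q2[of x] by (auto simp: layer_def)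
  note z = up2[OF L0(1)] up2[OF L0(2)] up2[OF L0(3)] up2[OF L0(4)] up2[OF v']
  note ips = inner_diff_left inner_diff_right inner_commute
  have b: "v' - d \<in> layer \<Phi>2 q2 1" "v' - y2 \<in> layer \<Phi>2 q2 1"
    using layer_1_diff[OF gr2 v'] L0 d vy by auto
  have b': "v' - d - y1 \<in> layer \<Phi>2 q2 1" "v' - d - y3 \<in> layer \<Phi>2 q2 1"
    using layer_1_diff[OF gr2 b(1) L0(2)] layer_1_diff[OF gr2 b(1) L0(4)] vy dY[OF yY(1)] dY[OF yY(3)]
    by (auto simp: inner_diff_left)
  have w: "v0 - a - b \<in> layer \<Phi>1 q1 1"
    if "a \<in> layer \<Phi>2 q2 1" "b \<in> layer \<Phi>2 q2 1" "a \<bullet> b = 0" for a b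
  proof -
    have ab: "a \<in> layer \<Phi>1 q1 0" "v0 \<bullet> a = 1" "b \<in> layer \<Phi>1 q1 0" "v0 \<bullet> b = 1"
      using up2[OF that(1)] up2[OF that(2)] by (auto simp: \<Phi>2_def)
    show ?thesis
      using layer_1_diff[OF gr1(1) layer_1_diff[OF gr1(1) v0 ab(1,2)] ab(3)] ab that by (simp add: inner_diff_left)
  qed
  \<comment> \<open>With \<open>v0 = e_1 + e_2\<close>, \<open>v' = e_1 - e_3\<close>,
    \<open>d = e_1 - e_2\<close> and \<open>y1, y2, y3\<close> equal to \<open>e_4 - e_3\<close>,
    \<open>e_5 - e_3\<close>, \<open>e_6 - e_3\<close>, these two roots are \<open>e_3 + e_4\<close>
    and \<open>e_5 + e_6\<close>.\<close>
  have u: "v0 - v' - (v' - d - y1) \<in> layer \<Phi>1 q1 1" "v0 - (v' - y2) - (v' - d - y3) \<in> layer \<Phi>1 q1 1"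
    by (rule w[OF v' b'(1)], use d dY[OF yY(1)] dY[OF yY(2)] dY[OF yY(3)] vy yy n in \<open>simp add: ips\<close>)
       (rule w[OF b(2) b'(2)], use d dY[OF yY(1)] dY[OF yY(2)] dY[OF yY(3)] vy yy n in \<open>simp add: ips\<close>)
  have up1: "x \<in> layer \<Phi> q 0" "v \<bullet> x = 1" if "x \<in> layer \<Phi>1 q1 1" for x
  proof -
    have "x \<in> \<Phi>1" "q1 \<bullet> x = 1" using that by (simp_all add: layer_def[of \<Phi>1])
    then show "x \<in> layer \<Phi> q 0" "v \<bullet> x = 1" using q1[of x] by (simp_all add: \<Phi>1_def)
  qed
  show False
    by (rule no_orthogonal_triple[OF gr(1) v up1(1)[OF v0] up1(1)[OF u(1)] up1(1)[OF u(2)]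
          up1(2)[OF v0] up1(2)[OF u(1)] up1(2)[OF u(2)]])
       (use d dY[OF yY(1)] dY[OF yY(2)] dY[OF yY(3)] vy yy n n0 z in \<open>simp_all add: ips\<close>)
qed

lemma local_chain_bound: "local_chain l (Suc (Suc t)) \<Phi> q \<Longrightarrow> l \<le> 2"
proof (induction t arbitrary: \<Phi> q)
  case 0
  then show ?case using local_chain_2_bound by blast
next
  case (Suc t)
  obtain v where "local_chain l (Suc (Suc t)) (layer \<Phi> q 0) (local_weight q v)"
    using local_chain_Suc_norm[OF Suc(2)] by blast
  then show ?case by (rule Suc(1))
qed

text \<open>Each case but one supplies a short weight: norm below 1 in type A, norm 1 one step above
  an A1 x A_l system or whenever \<open>l = 1\<close>, and 4/3 for \<open>l = 2\<close> after two
  steps. What remains is \<open>l = 2\<close> with at least three steps.\<close>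

lemma graded_classification:
  assumes "graded \<Phi> q" "q \<in> span \<Phi>"
  shows "(\<exists>h\<in>span \<Phi>. graded \<Phi> h \<and> h \<bullet> h < 3 / 2) \<or> (\<exists>t. local_chain 2 (Suc (Suc (Suc t))) \<Phi> q)"
proof -
  obtain v where v: "v \<in> layer \<Phi> q 1" using layer_1_nonempty[OF assms(1)] .
  show ?thesis
  proof (rule type_A_or_irreducible[OF assms(1) v])
    fix X Y assume "layer \<Phi> q 0 = X \<union> Y" "\<forall>x\<in>X. \<forall>y\<in>Y. x \<bullet> y = 0"
      "clique (upper X v)" "clique (upper Y v)"
    then have "\<exists>h\<in>span \<Phi>. graded \<Phi> h \<and> h \<bullet> h < 1" by (rule type_A_weight[OF assms(1) v])
    then show ?thesis by force
  next
    let ?L = "layer \<Phi> q 0" and ?p = "local_weight q v"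
    fix a b assume irr: "irreducible_system ?L"
      and ab: "a \<in> ?L" "b \<in> ?L" "v \<bullet> a = 1" "v \<bullet> b = 1" "a \<bullet> b = 0"
    note p = local_weight[OF assms(1) v assms(2)]
    have gp: "graded ?L ?p" using graded_local[OF assms(1) v irr] graded_cong[of ?L ?p v] p(2) by blast
    have up: "x \<in> layer ?L ?p 1 \<longleftrightarrow> x \<in> ?L \<and> v \<bullet> x = 1" for x
      using p(2)[of x] by (auto simp: layer_def[of ?L])
    have "\<exists>l t. local_chain l t ?L ?p"
    proof (rule local_chain_exists[OF gp p(1), of a b])
      show "False" if "a \<in> layer ?L ?p 1" "b \<in> layer ?L ?p 1" "c \<in> layer ?L ?p 1"
          "a \<bullet> b = 0" "a \<bullet> c = 0" "b \<bullet> c = 0" for a b c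
        using no_orthogonal_triple[OF assms(1) v] that unfolding up by blast
    qed (use ab up in auto)
    then obtain l t where "local_chain l t ?L ?p" by blast
    then have ch: "local_chain l (Suc t) \<Phi> q" using assms v by (auto simp: local_chain.simps(2))
    have small: ?thesis if "h \<in> span \<Phi>" "graded \<Phi> h" "h \<bullet> h < 3 / 2" for h using that by blast
    show ?thesis
    proof (cases t)
      case 0
      then obtain h where "h \<in> span \<Phi>" "graded \<Phi> h" "h \<bullet> h = 1" using type_D_weight ch by blast
      then show ?thesis using small[of h] by simp
    next
      case (Suc s)
      then have "l \<le> 2" "l \<ge> 1" using local_chain_bound local_chain_pos ch by blast+
      then consider "l = 1" | "l = 2" by linarith
      then show ?thesis
      proof cases
        case 1
        then show ?thesis using local_chain_1_norm[of "Suc t" \<Phi> q] ch small[OF assms(2,1)] by simp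
      next
        case 2
        then show ?thesis
          using local_chain_2_norm[of \<Phi> q] ch Suc small[OF assms(2,1)] by (cases s) (simp, blast)
      qed
    qed
  qed
qed

section \<open>Frames of type \<open>E\<^sub>7\<close>\<close>

text \<open>The vectors \<open>b 0, b 1, b 2, b 3\<close> have degree 1 in the successive gradings of the sequence, and
  \<open>b 4\<close> and \<open>b 5, b 6\<close> span the two factors of its last term. Up to signs, this is a change of basis away
  from a system of simple roots.\<close>

definition gram :: "(nat \<Rightarrow> 'a::real_inner) \<Rightarrow> bool" where
  "gram b \<longleftrightarrow> (\<forall>i<7. \<forall>j<7. b i \<bullet> b j =
     (if i = j then 2
      else if (i, j) \<in> {(0, 1), (1, 2), (2, 3), (3, 4), (3, 5), (3, 6), (5, 6)} \<or>
        (j, i) \<in> {(0, 1), (1, 2), (2, 3), (3, 4), (3, 5), (3, 6), (5, 6)} then 1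
      else 0))"

lemma gram_simps:
  assumes "gram b"
  shows
    "b 0 \<bullet> b 0 = 2" "b 0 \<bullet> b (Suc 0) = 1" "b 0 \<bullet> b 2 = 0"
    "b 0 \<bullet> b 3 = 0" "b 0 \<bullet> b 4 = 0" "b 0 \<bullet> b 5 = 0"
    "b 0 \<bullet> b 6 = 0" "b (Suc 0) \<bullet> b 0 = 1" "b (Suc 0) \<bullet> b (Suc 0) = 2"
    "b (Suc 0) \<bullet> b 2 = 1" "b (Suc 0) \<bullet> b 3 = 0" "b (Suc 0) \<bullet> b 4 = 0"
    "b (Suc 0) \<bullet> b 5 = 0" "b (Suc 0) \<bullet> b 6 = 0" "b 2 \<bullet> b 0 = 0"
    "b 2 \<bullet> b (Suc 0) = 1" "b 2 \<bullet> b 2 = 2" "b 2 \<bullet> b 3 = 1"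
    "b 2 \<bullet> b 4 = 0" "b 2 \<bullet> b 5 = 0" "b 2 \<bullet> b 6 = 0"
    "b 3 \<bullet> b 0 = 0" "b 3 \<bullet> b (Suc 0) = 0" "b 3 \<bullet> b 2 = 1"
    "b 3 \<bullet> b 3 = 2" "b 3 \<bullet> b 4 = 1" "b 3 \<bullet> b 5 = 1"
    "b 3 \<bullet> b 6 = 1" "b 4 \<bullet> b 0 = 0" "b 4 \<bullet> b (Suc 0) = 0"
    "b 4 \<bullet> b 2 = 0" "b 4 \<bullet> b 3 = 1" "b 4 \<bullet> b 4 = 2"
    "b 4 \<bullet> b 5 = 0" "b 4 \<bullet> b 6 = 0" "b 5 \<bullet> b 0 = 0"
    "b 5 \<bullet> b (Suc 0) = 0" "b 5 \<bullet> b 2 = 0" "b 5 \<bullet> b 3 = 1"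
    "b 5 \<bullet> b 4 = 0" "b 5 \<bullet> b 5 = 2" "b 5 \<bullet> b 6 = 1"
    "b 6 \<bullet> b 0 = 0" "b 6 \<bullet> b (Suc 0) = 0" "b 6 \<bullet> b 2 = 0"
    "b 6 \<bullet> b 3 = 1" "b 6 \<bullet> b 4 = 0" "b 6 \<bullet> b 5 = 1"
    "b 6 \<bullet> b 6 = 2"
  using assms by (simp_all add: gram_def)

text \<open>The vector of the span of \<open>b j, ..., b 6\<close> that is 1 on \<open>b j\<close>
  and 0 on the later ones, obtained by inverting the Gram matrix. Its leading coefficient is
  therefore also its norm: 3/2, 4/3, 5/4, 6/5.\<close>

definition weight :: "(nat \<Rightarrow> 'a::real_inner) \<Rightarrow> nat \<Rightarrow> 'a" where
  "weight b j =
    (if j = 0 then (3/2) *\<^sub>R b 0 - 2 *\<^sub>R b 1 + (5/2) *\<^sub>R b 2 - 3 *\<^sub>R b 3 + (3/2) *\<^sub>R b 4 + b 5 + b 6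
     else if j = 1 then (4/3) *\<^sub>R b 1 - (5/3) *\<^sub>R b 2 + 2 *\<^sub>R b 3 - b 4 - (2/3) *\<^sub>R b 5 - (2/3) *\<^sub>R b 6
     else if j = 2 then (5/4) *\<^sub>R b 2 - (3/2) *\<^sub>R b 3 + (3/4) *\<^sub>R b 4 + (1/2) *\<^sub>R b 5 + (1/2) *\<^sub>R b 6
     else (6/5) *\<^sub>R b 3 - (3/5) *\<^sub>R b 4 - (2/5) *\<^sub>R b 5 - (2/5) *\<^sub>R b 6)"

definition part :: "'a::real_inner set \<Rightarrow> (nat \<Rightarrow> 'a) \<Rightarrow> nat \<Rightarrow> 'a set" where
  "part \<Phi> b j = \<Phi> \<inter> zspan (b ` {j..<7})"

text \<open>Containment in the integral span of \<open>b\<close> makes \<Phi> the set of norm 2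
  vectors of a lattice with prescribed Gram matrix. Including all four gradings records
  irreducibility and minuscule values, which are awkward to derive from the Gram matrix
  alone.\<close>

definition frame :: "'a::real_inner set \<Rightarrow> (nat \<Rightarrow> 'a) \<Rightarrow> bool" where
  "frame \<Phi> b \<longleftrightarrow> gram b \<and> b ` {0..<7} \<subseteq> \<Phi> \<and> \<Phi> \<subseteq> zspan (b ` {0..<7}) \<and>
     (\<forall>j<4. graded (part \<Phi> b j) (weight b j))"

lemma nat_less_7: "i < 7 \<longleftrightarrow> i \<in> {0, 1, 2, 3, 4, 5, 6 :: nat}"
  by auto

lemma nat_less_4: "i < 4 \<longleftrightarrow> i \<in> {0, 1, 2, 3 :: nat}"
  by auto

lemma base_eqs:
  "b ` {0..<7} = {b 0, b (Suc 0), b 2, b 3, b 4, b 5, b 6}"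
  "b ` {Suc 0..<7} = {b (Suc 0), b 2, b 3, b 4, b 5, b 6}"
  "b ` {2..<7} = {b 2, b 3, b 4, b 5, b 6}"
  "b ` {3..<7} = {b 3, b 4, b 5, b 6}"
  "b ` {4..<7} = {b 4, b 5, b 6}"
  for b :: "nat \<Rightarrow> 'a"
proof -
  have "{0..<7} = {0, Suc 0, 2, 3, 4, 5, 6}" "{Suc 0..<7} = {Suc 0, 2, 3, 4, 5, 6}"
    "{2..<7} = {2, 3, 4, 5, 6 :: nat}" "{3..<7} = {3, 4, 5, 6 :: nat}" "{4..<7} = {4, 5, 6 :: nat}"
    by auto
  then show "b ` {0..<7} = {b 0, b (Suc 0), b 2, b 3, b 4, b 5, b 6}"
    "b ` {Suc 0..<7} = {b (Suc 0), b 2, b 3, b 4, b 5, b 6}"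
    "b ` {2..<7} = {b 2, b 3, b 4, b 5, b 6}"
    "b ` {3..<7} = {b 3, b 4, b 5, b 6}"
    "b ` {4..<7} = {b 4, b 5, b 6}"
    by simp_all
qed

lemma base_insert: "j < 7 \<Longrightarrow> b ` {j..<7} = insert (b j) (b ` {Suc j..<7})" for j :: nat
proof -
  assume "j < 7"
  then have "{j..<7} = insert j {Suc j..<7}" by auto
  then show ?thesis by simp
qed

lemma weight_inner:
  assumes "gram b" "j < 4" "j \<le> i" "i < 7"
  shows "weight b j \<bullet> b i = (if i = j then 1 else 0)"
  using assms(2-4) unfolding nat_less_4 nat_less_7
  by (auto simp: weight_def inner_add_left inner_diff_left gram_simps[OF assms(1)])

lemma weight_span:
  assumes "j < 4"
  shows "weight b j \<in> span (b ` {j..<7})"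
  using assms unfolding nat_less_4
  by (auto simp: weight_def base_eqs intro!: span_add span_diff span_scale intro: span_base)

lemma weight_norm:
  assumes "gram b"
  shows "weight b 0 \<bullet> weight b 0 = 3/2" "weight b (Suc 0) \<bullet> weight b (Suc 0) = 4/3"
    "weight b 2 \<bullet> weight b 2 = 5/4" "weight b 3 \<bullet> weight b 3 = 6/5"
  by (simp_all add: weight_def inner_add_left inner_diff_left inner_add_right inner_diff_right
      gram_simps[OF assms])

lemma frame_gram: "frame \<Phi> b \<Longrightarrow> gram b"
  and frame_base: "frame \<Phi> b \<Longrightarrow> i < 7 \<Longrightarrow> b i \<in> \<Phi>"
  and frame_zspan: "frame \<Phi> b \<Longrightarrow> \<Phi> \<subseteq> zspan (b ` {0..<7})"
  and frame_graded: "frame \<Phi> b \<Longrightarrow> j < 4 \<Longrightarrow> graded (part \<Phi> b j) (weight b j)"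
  by (auto simp: frame_def)

lemma part_0: "frame \<Phi> b \<Longrightarrow> part \<Phi> b 0 = \<Phi>"
  using frame_zspan by (auto simp: part_def)

lemma frame_slrs: "frame \<Phi> b \<Longrightarrow> slrs \<Phi>"
  using frame_graded[of \<Phi> b 0] graded_slrs part_0 by fastforce

lemma part_base: "frame \<Phi> b \<Longrightarrow> j \<le> i \<Longrightarrow> i < 7 \<Longrightarrow> b i \<in> part \<Phi> b j"
  using frame_base by (auto simp: part_def intro: zspan_base)

lemma part_zspan: "part \<Phi> b j \<subseteq> zspan (b ` {j..<7})"
  by (auto simp: part_def)

lemma zspan_part:
  assumes "frame \<Phi> b" shows "zspan (part \<Phi> b j) = zspan (b ` {j..<7})"
proof
  show "zspan (part \<Phi> b j) \<subseteq> zspan (b ` {j..<7})" using zspan_le part_zspan by blast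
  have "b ` {j..<7} \<subseteq> part \<Phi> b j" using part_base[OF assms] by auto
  then show "zspan (b ` {j..<7}) \<subseteq> zspan (part \<Phi> b j)" by (rule zspan_mono)
qed

lemma span_part:
  assumes "frame \<Phi> b" shows "span (part \<Phi> b j) = span (b ` {j..<7})"
proof
  have "part \<Phi> b j \<subseteq> span (b ` {j..<7})" using part_zspan zspan_subset_span by blast
  then show "span (part \<Phi> b j) \<subseteq> span (b ` {j..<7})" by (simp add: span_minimal)
  have "b ` {j..<7} \<subseteq> part \<Phi> b j" using part_base[OF assms] by auto
  then show "span (b ` {j..<7}) \<subseteq> span (part \<Phi> b j)" by (rule span_mono)
qed

lemma part_eq_norm_2:
  assumes "frame \<Phi> b" shows "part \<Phi> b j = {x \<in> zspan (b ` {j..<7}). x \<bullet> x = 2}"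
proof -
  have "x \<in> \<Phi>" if "x \<in> zspan (b ` {j..<7})" "x \<bullet> x = 2" for x
  proof (rule zspan_norm_2[OF frame_slrs[OF assms] _ that(2)])
    have "b ` {j..<7} \<subseteq> \<Phi>" using frame_base[OF assms] by auto
    then show "x \<in> zspan \<Phi>" using zspan_mono that(1) by blast
  qed
  then show ?thesis using root_norm[OF frame_slrs[OF assms]] by (auto simp: part_def)
qed

text \<open>The weight reads off the coefficient of \<open>b j\<close>, so degree 0 means that this
  coefficient is absent.\<close>

lemma layer_part:
  assumes "gram b" "j < 4"
  shows "layer (part \<Phi> b j) (weight b j) 0 = part \<Phi> b (Suc j)"
proof -
  have ins: "b ` {j..<7} = insert (b j) (b ` {Suc j..<7})"
    using assms(2) by (simp add: base_insert)
  have 0: "weight b j \<bullet> y = 0" if "y \<in> zspan (b ` {Suc j..<7})" for y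
    by (rule zspan_inner_0[OF that]) (use weight_inner[OF assms] in auto)
  have 1: "weight b j \<bullet> b j = 1" using weight_inner[OF assms, of j] assms(2) by simp
  show ?thesis
  proof (intro set_eqI iffI)
    fix x assume "x \<in> layer (part \<Phi> b j) (weight b j) 0"
    then have x: "x \<in> \<Phi>" "x \<in> zspan (insert (b j) (b ` {Suc j..<7}))" "weight b j \<bullet> x = 0"
      by (auto simp: layer_def part_def ins)
    from x(2) obtain k :: int and y where y: "y \<in> zspan (b ` {Suc j..<7})" "x = of_int k *\<^sub>R b j + y"
      by (rule zspan_insertE)
    then have "k = 0" using x(3) 0 1 by (simp add: inner_add_right)
    then show "x \<in> part \<Phi> b (Suc j)" using x y by (simp add: part_def)
  next
    fix x assume x: "x \<in> part \<Phi> b (Suc j)"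
    then have "x \<in> zspan (b ` {j..<7})" unfolding ins using zspan_mono[OF subset_insertI] by (auto simp: part_def)
    then show "x \<in> layer (part \<Phi> b j) (weight b j) 0" using x 0 by (auto simp: layer_def part_def)
  qed
qed

lemma part_layer_1: "frame \<Phi> b \<Longrightarrow> j < 4 \<Longrightarrow> b j \<in> layer (part \<Phi> b j) (weight b j) 1"
  using part_base[of \<Phi> b j j] weight_inner[OF frame_gram, of \<Phi> b j j] by (simp add: layer_def)

lemma part_weight_eqI:
  assumes "\<And>i. j \<le> i \<Longrightarrow> i < 7 \<Longrightarrow> g \<bullet> b i = g' \<bullet> b i" "\<alpha> \<in> zspan (b ` {j..<7})"
  shows "g \<bullet> \<alpha> = g' \<bullet> \<alpha>"
  by (rule zspan_inner_eq[OF assms(2)]) (use assms(1) in auto)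

text \<open>Climbing from the last system, each \<open>\<Psi> j\<close> is integrally generated by
  \<open>b j\<close> and its part of degree 0. Hence \<open>b\<close> generates everything, and
  \<open>g j\<close> may be any vector with the right values on \<open>b\<close>; it then agrees
  with \<open>weight b j\<close> on \<open>\<Psi> j\<close>.\<close>

lemma frameI:
  assumes "gram b"
    and gr: "\<And>j. j < 4 \<Longrightarrow> graded (\<Psi> j) (g j)"
    and layer: "\<And>j. j < 4 \<Longrightarrow> layer (\<Psi> j) (g j) 0 = \<Psi> (Suc j)"
    and g: "\<And>i j. j < 4 \<Longrightarrow> j \<le> i \<Longrightarrow> i < 7 \<Longrightarrow> g j \<bullet> b i = (if i = j then 1 else 0)"
    and base: "\<And>i. i < 4 \<Longrightarrow> b i \<in> \<Psi> i" "{b 4, b 5, b 6} \<subseteq> \<Psi> 4" "\<Psi> 4 \<subseteq> zspan {b 4, b 5, b 6}"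
  shows "frame (\<Psi> 0) b" "\<And>j. j \<le> 4 \<Longrightarrow> part (\<Psi> 0) b j = \<Psi> j"
    "\<And>j \<alpha>. j < 4 \<Longrightarrow> \<alpha> \<in> \<Psi> j \<Longrightarrow> g j \<bullet> \<alpha> = weight b j \<bullet> \<alpha>"
proof -
  have sub: "\<Psi> (Suc j) \<subseteq> \<Psi> j" if "j < 4" for j using layer[OF that] by (auto simp: layer_def)
  have sub0: "\<Psi> j \<subseteq> \<Psi> 0" if "j \<le> 4" for j
    using that
  proof (induction j)
    case (Suc j)
    then show ?case using sub[of j] by auto
  qed simp
  have z: "\<Psi> j \<subseteq> zspan (b ` {j..<7})" if "j \<le> 4" for j
    using that
  proof (induction j rule: inc_induct)
    case base
    then show ?case using assms(7) by (simp add: base_eqs)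
  next
    case (step j)
    have ins: "b ` {j..<7} = insert (b j) (b ` {Suc j..<7})"
      using step(2) by (simp add: base_insert)
    have "b j \<in> layer (\<Psi> j) (g j) 1" using g[of j j] base(1) step(2) by (simp add: layer_def)
    then have "\<Psi> j \<subseteq> zspan (insert (b j) (\<Psi> (Suc j)))"
      using graded_subset_zspan[OF gr[OF step(2)]] layer[OF step(2)] by metis
    moreover have "insert (b j) (\<Psi> (Suc j)) \<subseteq> zspan (b ` {j..<7})"
      using step(3) zspan_mono[OF subset_insertI] unfolding ins by (blast intro: zspan_base)
    ultimately show ?case using zspan_le by blast
  qed
  have agree: "g j \<bullet> \<alpha> = weight b j \<bullet> \<alpha>" if "j < 4" "\<alpha> \<in> \<Psi> j" for j \<alpha>
    by (rule part_weight_eqI[of j _ b]) (use that g weight_inner[OF assms(1)] z[of j] in auto)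
  then show "\<And>j \<alpha>. j < 4 \<Longrightarrow> \<alpha> \<in> \<Psi> j \<Longrightarrow> g j \<bullet> \<alpha> = weight b j \<bullet> \<alpha>" .
  have part: "part (\<Psi> 0) b j = \<Psi> j" if "j \<le> 4" for j
    using that
  proof (induction j)
    case 0
    show ?case using z[of 0] by (auto simp: part_def)
  next
    case (Suc j)
    then have j: "j < 4" and e: "part (\<Psi> 0) b j = \<Psi> j" by auto
    show ?case
      using layer_part[OF assms(1) j, of "\<Psi> 0"] layer[OF j] layer_cong[of "\<Psi> j" "g j" "weight b j"] agree[OF j]
      unfolding e by metis
  qed
  then show "\<And>j. j \<le> 4 \<Longrightarrow> part (\<Psi> 0) b j = \<Psi> j" .
  have "b i \<in> \<Psi> 0" if "i < 7" for i
  proof (cases "i < 4")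
    case True
    then show ?thesis using base(1) sub0[of i] by auto
  next
    case False
    then have "i \<in> {4, 5, 6}" using that by auto
    then show ?thesis using base(2) sub0[of 4] by auto
  qed
  moreover have "graded (part (\<Psi> 0) b j) (weight b j)" if "j < 4" for j
    using gr[OF that] graded_cong[of "\<Psi> j" "g j" "weight b j"] agree[OF that] part that by simp
  ultimately show "frame (\<Psi> 0) b" using assms(1) z[of 0] by (auto simp: frame_def)
qed

text \<open>The frame consists of the successively chosen roots of degree 1, the root
  \<open>d\<close> of the A1 factor and the two roots of the clique of the A2 factor.\<close>

lemma local_chain_frame:
  assumes "local_chain 2 (Suc (Suc (Suc 0))) \<Phi> q"
  obtains b where "frame \<Phi> b" "\<And>\<alpha>. \<alpha> \<in> \<Phi> \<Longrightarrow> q \<bullet> \<alpha> = weight b 0 \<bullet> \<alpha>"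
proof -
  have step: "\<exists>v \<Phi>' q'. v \<in> layer \<Phi> q 1 \<and> \<Phi>' = layer \<Phi> q 0 \<and> local_chain l t \<Phi>' q' \<and>
      (\<forall>\<alpha>\<in>\<Phi>'. v \<bullet> \<alpha> = q' \<bullet> \<alpha>) \<and> v \<bullet> v = 2"
    if ch: "local_chain l (Suc t) \<Phi> q" for l t and \<Phi> :: "'a set" and q
  proof -
    obtain v where v: "v \<in> layer \<Phi> q 1" "local_chain l t (layer \<Phi> q 0) (local_weight q v)"
      using local_chain_Suc_norm[OF ch] by blast
    moreover have "v \<bullet> v = 2"
      using v(1) root_norm[OF graded_slrs[OF local_chain_graded[OF ch]]] by (simp add: layer_def)
    ultimately show ?thesis
      using local_weight(2)[OF local_chain_graded[OF ch] v(1) local_chain_span[OF ch]]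
      by (intro exI[of _ v] exI[of _ "layer \<Phi> q 0"] exI[of _ "local_weight q v"]) simp
  qed
  obtain v1 \<Phi>1 q1 where 1: "v1 \<in> layer \<Phi> q 1" "\<Phi>1 = layer \<Phi> q 0" "local_chain 2 (Suc (Suc 0)) \<Phi>1 q1"
      "\<And>\<alpha>. \<alpha> \<in> \<Phi>1 \<Longrightarrow> v1 \<bullet> \<alpha> = q1 \<bullet> \<alpha>" "v1 \<bullet> v1 = 2"
    using step[OF assms] by blast
  obtain v2 \<Phi>2 q2 where 2: "v2 \<in> layer \<Phi>1 q1 1" "\<Phi>2 = layer \<Phi>1 q1 0" "local_chain 2 (Suc 0) \<Phi>2 q2"
      "\<And>\<alpha>. \<alpha> \<in> \<Phi>2 \<Longrightarrow> v2 \<bullet> \<alpha> = q2 \<bullet> \<alpha>" "v2 \<bullet> v2 = 2"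
    using step[OF 1(3)] by blast
  obtain v3 \<Phi>3 q3 where 3: "v3 \<in> layer \<Phi>2 q2 1" "\<Phi>3 = layer \<Phi>2 q2 0" "local_chain 2 0 \<Phi>3 q3"
      "\<And>\<alpha>. \<alpha> \<in> \<Phi>3 \<Longrightarrow> v3 \<bullet> \<alpha> = q3 \<bullet> \<alpha>" "v3 \<bullet> v3 = 2"
    using step[OF 2(3)] by blast
  obtain v4 d Y where gr3: "graded \<Phi>3 q3" and 4: "v4 \<in> layer \<Phi>3 q3 1"
    and L: "layer \<Phi>3 q3 0 = {d, - d} \<union> Y" and dY: "\<forall>y\<in>Y. d \<bullet> y = 0" and d: "v4 \<bullet> d = 1"
    and cl: "clique (upper Y v4)" "card (upper Y v4) = 2"
    using 3(3) unfolding local_chain.simps(1) by blast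
  obtain y1 y2 where y: "upper Y v4 = {y1, y2}" "y1 \<noteq> y2" using cl(2) by (auto simp: card_2_iff)
  have yy: "y1 \<bullet> y2 = 1" using cl(1) y by (auto simp: clique_def)
  have yY: "y1 \<in> Y" "y2 \<in> Y" "v4 \<bullet> y1 = 1" "v4 \<bullet> y2 = 1" using y by (auto simp: upper_def)
  define \<Phi>4 where "\<Phi>4 = layer \<Phi>3 q3 0"
  have in4: "d \<in> \<Phi>4" "y1 \<in> \<Phi>4" "y2 \<in> \<Phi>4" using L yY by (auto simp: \<Phi>4_def)
  have n4: "x \<bullet> x = 2" if "x \<in> \<Phi>3" for x using root_norm[OF graded_slrs[OF gr3] that] .
  have 43: "x \<in> \<Phi>3" "q3 \<bullet> x = 0" if "x \<in> \<Phi>4" for x using that by (auto simp: \<Phi>4_def layer_def)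
  have 32: "x \<in> \<Phi>2" "q2 \<bullet> x = 0" if "x \<in> \<Phi>3" for x using that by (auto simp: 3(2) layer_def)
  have 21: "x \<in> \<Phi>1" "q1 \<bullet> x = 0" if "x \<in> \<Phi>2" for x using that by (auto simp: 2(2) layer_def)
  have 10: "x \<in> \<Phi>" "q \<bullet> x = 0" if "x \<in> \<Phi>1" for x using that by (auto simp: 1(2) layer_def)
  have v1: "v1 \<in> \<Phi>" "q \<bullet> v1 = 1" using 1(1) by (auto simp: layer_def)
  have v2: "v2 \<in> \<Phi>1" "q1 \<bullet> v2 = 1" using 2(1) by (auto simp: layer_def)
  have v3: "v3 \<in> \<Phi>2" "q2 \<bullet> v3 = 1" using 3(1) by (auto simp: layer_def)
  have v4: "v4 \<in> \<Phi>3" "q3 \<bullet> v4 = 1" using 4 by (auto simp: layer_def)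
  define b where "b i = [v1, v2, v3, v4, d, y1, y2] ! i" for i
  have b: "b 0 = v1" "b (Suc 0) = v2" "b 2 = v3" "b 3 = v4" "b 4 = d" "b 5 = y1" "b 6 = y2"
    by (simp_all add: b_def)
  \<comment> \<open>Each \<open>v\<close> induces the next grading vector on the following system.
    Its product with the next root is thus 1, and with all later ones 0, because those lie in degree
    0.\<close>
  have ip: "v1 \<bullet> v2 = 1" "v1 \<bullet> v3 = 0" "v1 \<bullet> v4 = 0" "v1 \<bullet> d = 0" "v1 \<bullet> y1 = 0" "v1 \<bullet> y2 = 0"
    "v2 \<bullet> v3 = 1" "v2 \<bullet> v4 = 0" "v2 \<bullet> d = 0" "v2 \<bullet> y1 = 0" "v2 \<bullet> y2 = 0"
    "v3 \<bullet> v4 = 1" "v3 \<bullet> d = 0" "v3 \<bullet> y1 = 0" "v3 \<bullet> y2 = 0" "d \<bullet> y1 = 0" "d \<bullet> y2 = 0"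
    using 1(4) 2(4) 3(4) v2 v3 v4 in4 43 32 21 dY yY by auto
  have n: "v4 \<bullet> v4 = 2" "d \<bullet> d = 2" "y1 \<bullet> y1 = 2" "y2 \<bullet> y2 = 2" using n4 v4 in4 43 by auto
  have gram: "gram b"
    unfolding gram_def nat_less_7
    using ip ip[THEN inner_commute[THEN trans]] n 1(5) 2(5) 3(5) d yY(3,4) yy
      d[THEN inner_commute[THEN trans]] yY(3,4)[THEN inner_commute[THEN trans]] yy[THEN inner_commute[THEN trans]]
    by (auto simp: b)
  define \<Psi> where "\<Psi> j = [\<Phi>, \<Phi>1, \<Phi>2, \<Phi>3, \<Phi>4] ! j" for j
  have \<Psi>: "\<Psi> 0 = \<Phi>" "\<Psi> (Suc 0) = \<Phi>1" "\<Psi> 2 = \<Phi>2" "\<Psi> 3 = \<Phi>3" "\<Psi> 4 = \<Phi>4" by (simp_all add: \<Psi>_def)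
  define g where "g j = [q, q1, q2, q3] ! j" for j
  have g: "g 0 = q" "g (Suc 0) = q1" "g 2 = q2" "g 3 = q3" by (simp_all add: g_def)
  have S: "Suc 1 = 2" "Suc 2 = 3" "Suc 3 = 4" "Suc (Suc 0) = 2" by simp_all
  note fr = frameI[OF gram, of \<Psi> g]
  have "frame (\<Psi> 0) b \<and> (\<forall>\<alpha>\<in>\<Psi> 0. g 0 \<bullet> \<alpha> = weight b 0 \<bullet> \<alpha>)"
  proof (intro conjI ballI fr(1) fr(3))
    show gr': "graded (\<Psi> j) (g j)" if "j < 4" for j
      using that local_chain_graded[OF assms] local_chain_graded[OF 1(3)] local_chain_graded[OF 2(3)] gr3
      unfolding nat_less_4 by (auto simp: g \<Psi>)
    then show "\<And>j. j < 4 \<Longrightarrow> graded (\<Psi> j) (g j)" .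
    show l: "layer (\<Psi> j) (g j) 0 = \<Psi> (Suc j)" if "j < 4" for j
      using that 1(2) 2(2) 3(2) \<Phi>4_def unfolding nat_less_4 by (elim insertE) (simp_all add: g \<Psi> S)
    then show "\<And>j. j < 4 \<Longrightarrow> layer (\<Psi> j) (g j) 0 = \<Psi> (Suc j)" .
    show gg: "g j \<bullet> b i = (if i = j then 1 else 0)" if "j < 4" "j \<le> i" "i < 7" for i j
      using that v1 v2 v3 v4 in4 43 32 21 10 unfolding nat_less_4 nat_less_7
      by (elim insertE) (simp_all add: g b)
    then show "\<And>i j. j < 4 \<Longrightarrow> j \<le> i \<Longrightarrow> i < 7 \<Longrightarrow> g j \<bullet> b i = (if i = j then 1 else 0)" .
    show bb: "b i \<in> \<Psi> i" if "i < 4" for i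
      using that v1 v2 v3 v4 unfolding nat_less_4 by (elim insertE) (simp_all add: \<Psi> b)
    then show "\<And>i. i < 4 \<Longrightarrow> b i \<in> \<Psi> i" .
    show "{b 4, b 5, b 6} \<subseteq> \<Psi> 4" using in4 by (simp add: b \<Psi>)
    then show "{b 4, b 5, b 6} \<subseteq> \<Psi> 4" .
    have "Y \<subseteq> zspan {d, y1, y2}"
    proof
      fix \<alpha> assume "\<alpha> \<in> Y"
      then have "\<alpha> \<in> upper Y v4 \<or> - \<alpha> \<in> upper Y v4 \<or> (\<exists>x\<in>upper Y v4. \<exists>x'\<in>upper Y v4. \<alpha> = x - x')"
        by (intro upper_generates[OF gr3 4, of _ "{d, - d}"]) (use L dY in \<open>auto simp: inner_commute\<close>)
      moreover have "upper Y v4 \<subseteq> zspan {d, y1, y2}" using y by (auto intro: zspan_base)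
      ultimately show "\<alpha> \<in> zspan {d, y1, y2}" using zspan_minus[of "- \<alpha>"] zspan_diff by fastforce
    qed
    moreover have "d \<in> zspan {d, y1, y2}" "- d \<in> zspan {d, y1, y2}"
      by (auto intro: zspan_base zspan_minus)
    ultimately show z: "\<Psi> 4 \<subseteq> zspan {b 4, b 5, b 6}" using L by (simp add: b \<Psi> \<Phi>4_def)
    then show "\<Psi> 4 \<subseteq> zspan {b 4, b 5, b 6}" .
  qed auto
  then show ?thesis using that[of b] by (simp add: \<Psi> g)
qed

subsection \<open>Weights modulo the root lattice\<close>

text \<open>A lattice vector can be found with any prescribed integral products with the
  \<open>b i\<close> for \<open>i > j\<close>. Subtracting it from \<open>h\<close> leaves a vector
  whose only nonzero product is with \<open>b j\<close>, that is, a multiple of the weight.\<close>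

lemma weight_coset:
  fixes b :: "nat \<Rightarrow> 'a::real_inner"
  assumes "gram b" "j < 4" "h \<in> span (b ` {j..<7})" "\<forall>i. j \<le> i \<and> i < 7 \<longrightarrow> h \<bullet> b i \<in> \<int>"
  obtains k :: int and l where "l \<in> zspan (b ` {j..<7})" "h = of_int k *\<^sub>R weight b j + l"
proof -
  note g = gram_simps[OF assms(1)]
  have "\<exists>l\<in>zspan (b ` {j..<7}). \<forall>i. j < i \<and> i < 7 \<longrightarrow> (h - l) \<bullet> b i = 0"
  proof -
    define H where "H i = \<lfloor>h \<bullet> b i\<rfloor>" for i
    have H: "h \<bullet> b i = of_int (H i)" if "j \<le> i" "i < 7" for i
    proof -
      have "h \<bullet> b i \<in> \<int>" using assms(4) that by blast
      then show ?thesis by (auto simp: H_def elim: Ints_cases)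
    qed
    \<comment> \<open>The equations for \<open>b 5\<close> and \<open>b 6\<close> express
      \<open>n3\<close> and \<open>m1\<close> through the coefficient \<open>t\<close> of
      \<open>b 6\<close>. The equation \<open>n3 + 2 * nd = H 4\<close> for \<open>b 4\<close> is
      then solvable in integers precisely for \<open>t\<close> of this parity.\<close>
    define t where "t = (H 4 + H 5) mod 2"
    define n3 where "n3 = - 3 * t - H 5 + 2 * H 6"
    define m1 where "m1 = t + H 5 - H 6"
    define nd where "nd = (H 4 - n3) div 2"
    have "even (H 4 - n3)" unfolding n3_def t_def by presburger
    then have nd: "2 * nd = H 4 - n3" by (simp add: nd_def)
    \<comment> \<open>The equations for \<open>b 3\<close>, \<open>b 2\<close>, \<open>b 1\<close>
      are triangular and determine \<open>n2\<close>, \<open>n1\<close>, \<open>n0\<close> in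
      turn.\<close>
    define n2 where "n2 = H 3 - 2 * n3 - nd - m1 - t"
    define n1 where "n1 = H 2 - 2 * n2 - n3"
    define n0 where "n0 = H 1 - 2 * n1 - n2"
    have nd': "2 * real_of_int nd = of_int (H 4) - of_int n3"
      using arg_cong[OF nd, of real_of_int] by simp
    note defs = n3_def m1_def n2_def n1_def n0_def
    define l3 where "l3 = of_int n3 *\<^sub>R b 3 + of_int nd *\<^sub>R b 4 + of_int m1 *\<^sub>R b 5 + of_int t *\<^sub>R b 6"
    define l2 where "l2 = of_int n2 *\<^sub>R b 2 + l3"
    define l1 where "l1 = of_int n1 *\<^sub>R b 1 + l2"
    define l0 where "l0 = of_int n0 *\<^sub>R b 0 + l1"
    have l3: "l3 \<bullet> b 4 = H 4" "l3 \<bullet> b 5 = H 5" "l3 \<bullet> b 6 = H 6" "l3 \<bullet> b 3 = H 3 - n2"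
      "l3 \<bullet> b 2 = n3" "l3 \<bullet> b (Suc 0) = 0" "l3 \<bullet> b 0 = 0"
      using nd' by (simp_all add: l3_def inner_add_left g, simp_all add: defs)
    have l2: "l2 \<bullet> b 4 = H 4" "l2 \<bullet> b 5 = H 5" "l2 \<bullet> b 6 = H 6" "l2 \<bullet> b 3 = H 3"
      "l2 \<bullet> b 2 = H 2 - n1" "l2 \<bullet> b (Suc 0) = n2" "l2 \<bullet> b 0 = 0"
      by (simp_all add: l2_def inner_add_left g l3, simp add: n1_def)
    have l1: "l1 \<bullet> b 4 = H 4" "l1 \<bullet> b 5 = H 5" "l1 \<bullet> b 6 = H 6" "l1 \<bullet> b 3 = H 3"
      "l1 \<bullet> b 2 = H 2" "l1 \<bullet> b (Suc 0) = H 1 - n0"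
      by (simp_all add: l1_def inner_add_left g l2, simp add: n0_def)
    have l0: "l0 \<bullet> b 4 = H 4" "l0 \<bullet> b 5 = H 5" "l0 \<bullet> b 6 = H 6" "l0 \<bullet> b 3 = H 3"
      "l0 \<bullet> b 2 = H 2" "l0 \<bullet> b (Suc 0) = H 1"
      by (simp_all add: l0_def inner_add_left g l1)
    have z: "of_int k *\<^sub>R x \<in> zspan S" if "x \<in> S" for k :: int and x :: 'a and S
      using that by (intro zspan_of_int zspan_base)
    have z3: "l3 \<in> zspan (b ` {3..<7})" unfolding l3_def base_eqs by (intro zspan_add z) auto
    have z2: "l2 \<in> zspan (b ` {2..<7})" unfolding l2_def l3_def base_eqs by (intro zspan_add z) auto
    have z1: "l1 \<in> zspan (b ` {Suc 0..<7})" unfolding l1_def l2_def l3_def base_eqs by (intro zspan_add z) auto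
    have z0: "l0 \<in> zspan (b ` {0..<7})" unfolding l0_def l1_def l2_def l3_def base_eqs by (intro zspan_add z) auto
    have *: "\<exists>l\<in>zspan (b ` {j..<7}). \<forall>i. j < i \<and> i < 7 \<longrightarrow> (h - l) \<bullet> b i = 0"
      if "l \<in> zspan (b ` {j..<7})" "\<And>i. j < i \<Longrightarrow> i < 7 \<Longrightarrow> l \<bullet> b i = of_int (H i)" for l
      using that H by (intro bexI[of _ l]) (auto simp: inner_diff_left)
    from assms(2) consider "j = 0" | "j = Suc 0" | "j = 2" | "j = 3" unfolding nat_less_4 by auto
    then show ?thesis
    proof cases
      case 1
      show ?thesis by (rule *[of l0]) (use 1 z0 l0 in \<open>auto simp: nat_less_7\<close>)
    next
      case 2
      show ?thesis by (rule *[of l1]) (use 2 z1 l1 in \<open>auto simp: nat_less_7\<close>)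
    next
      case 3
      show ?thesis by (rule *[of l2]) (use 3 z2 l2 in \<open>auto simp: nat_less_7\<close>)
    next
      case 4
      show ?thesis by (rule *[of l3]) (use 4 z3 l3 in \<open>auto simp: nat_less_7\<close>)
    qed
  qed
  then obtain l where l: "l \<in> zspan (b ` {j..<7})" and 0: "\<And>i. j < i \<Longrightarrow> i < 7 \<Longrightarrow> (h - l) \<bullet> b i = 0" by blast
  have gZ: "x \<bullet> y \<in> \<int>" if "x \<in> b ` {j..<7}" "y \<in> b ` {j..<7}" for x y
    using that assms(1) by (auto simp: gram_def)
  have "l \<bullet> b j \<in> \<int>"
    by (rule zspan_inner_Ints2[OF l _ gZ]) (use assms(2) in \<open>auto intro: zspan_base\<close>)
  then have "(h - l) \<bullet> b j \<in> \<int>" using assms(2,4) by (simp add: inner_diff_left)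
  then obtain k :: int where k: "(h - l) \<bullet> b j = of_int k" by (auto elim: Ints_cases)
  have "h - l - of_int k *\<^sub>R weight b j = 0"
  proof (rule span_orthogonal_0[of _ "b ` {j..<7}"])
    show "h - l - of_int k *\<^sub>R weight b j \<in> span (b ` {j..<7})"
      using l zspan_subset_span assms(3) weight_span[OF assms(2)] by (intro span_diff span_scale) auto
    fix s assume "s \<in> b ` {j..<7}"
    then obtain i where "s = b i" "j \<le> i" "i < 7" by auto
    then show "(h - l - of_int k *\<^sub>R weight b j) \<bullet> s = 0"
      using 0[of i] k weight_inner[OF assms(1,2), of i]
      by (cases "i = j") (auto simp: inner_diff_left[of "h - l"])
  qed
  then have "h = of_int k *\<^sub>R weight b j + l" by (simp add: algebra_simps)
  then show ?thesis using that l by blast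
qed

text \<open>The factor 2, 3, 4 or 5 clears the denominators of the weight.\<close>

lemma weight_order:
  fixes b :: "nat \<Rightarrow> 'a::real_inner"
  assumes "j < 4"
  shows "(2 + real j) *\<^sub>R weight b j \<in> zspan (b ` {j..<7})"
proof -
  have z: "c *\<^sub>R x \<in> zspan S" if "x \<in> S" "c \<in> \<int>" for c and x :: 'a and S
    using that by (intro zspan_Ints zspan_base)
  from assms consider "j = 0" | "j = Suc 0" | "j = 2" | "j = 3" unfolding nat_less_4 by auto
  then show ?thesis
  proof cases
    case 1
    have "2 *\<^sub>R weight b 0 = 3 *\<^sub>R b 0 - 4 *\<^sub>R b 1 + 5 *\<^sub>R b 2 - 6 *\<^sub>R b 3 + 3 *\<^sub>R b 4 + 2 *\<^sub>R b 5 + 2 *\<^sub>R b 6"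
      by (simp add: weight_def algebra_simps)
    also have "\<dots> \<in> zspan (b ` {0..<7})" unfolding base_eqs by (intro zspan_add zspan_diff z) auto
    finally show ?thesis using 1 by simp
  next
    case 2
    have "3 *\<^sub>R weight b (Suc 0) = 4 *\<^sub>R b 1 - 5 *\<^sub>R b 2 + 6 *\<^sub>R b 3 - 3 *\<^sub>R b 4 - 2 *\<^sub>R b 5 - 2 *\<^sub>R b 6"
      by (simp add: weight_def algebra_simps)
    also have "\<dots> \<in> zspan (b ` {Suc 0..<7})" unfolding base_eqs by (intro zspan_add zspan_diff z) auto
    finally show ?thesis using 2 by simp
  next
    case 3
    have "4 *\<^sub>R weight b 2 = 5 *\<^sub>R b 2 - 6 *\<^sub>R b 3 + 3 *\<^sub>R b 4 + 2 *\<^sub>R b 5 + 2 *\<^sub>R b 6"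
      by (simp add: weight_def algebra_simps)
    also have "\<dots> \<in> zspan (b ` {2..<7})" unfolding base_eqs by (intro zspan_add zspan_diff z) auto
    finally show ?thesis using 3 by simp
  next
    case 4
    have "5 *\<^sub>R weight b 3 = 6 *\<^sub>R b 3 - 3 *\<^sub>R b 4 - 2 *\<^sub>R b 5 - 2 *\<^sub>R b 6"
      by (simp add: weight_def algebra_simps)
    also have "\<dots> \<in> zspan (b ` {3..<7})" unfolding base_eqs by (intro zspan_add zspan_diff z) auto
    finally show ?thesis using 4 by simp
  qed
qed

text \<open>The weight lattice modulo the root lattice is cyclic of order \<open>2 + j\<close>, generated by the given
  weight. The remaining cosets contain shorter vectors.\<close>

lemma weight_cases:
  fixes b :: "nat \<Rightarrow> 'a::real_inner"
  assumes "gram b" "j < 4" "h \<in> span (b ` {j..<7})" "\<forall>i. j \<le> i \<and> i < 7 \<longrightarrow> h \<bullet> b i \<in> \<int>"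
    and min: "\<And>l. l \<in> zspan (b ` {j..<7}) \<Longrightarrow> h \<bullet> h \<le> (h + l) \<bullet> (h + l)"
  shows "h \<bullet> h < weight b j \<bullet> weight b j \<or>
    (\<exists>s\<in>{1, -1}. \<exists>l\<in>zspan (b ` {j..<7}). s *\<^sub>R h = weight b j + l)"
proof -
  let ?Z = "zspan (b ` {j..<7})" and ?w = "weight b j"
  note g = gram_simps[OF assms(1)]
  obtain k :: int and l where l: "l \<in> ?Z" "h = of_int k *\<^sub>R ?w + l"
    using weight_coset[OF assms(1-4)] by blast
  define N where "N = 2 + int j"
  define r where "r = k mod N"
  have kN: "of_int (k div N) *\<^sub>R ((2 + real j) *\<^sub>R ?w) \<in> ?Z" by (intro zspan_of_int weight_order assms)
  have "real_of_int k = of_int (k div N) * (2 + real j) + of_int r"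
  proof -
    have "k = (k div N) * N + r" by (simp add: r_def)
    then have "real_of_int k = of_int ((k div N) * N + r)" by metis
    then show ?thesis by (simp add: N_def)
  qed
  then have "h = of_int r *\<^sub>R ?w + (of_int (k div N) *\<^sub>R ((2 + real j) *\<^sub>R ?w) + l)"
    using l(2) by (simp add: algebra_simps)
  then obtain m where m: "m \<in> ?Z" "h = of_int r *\<^sub>R ?w + m"
    using zspan_add[OF kN l(1)] by blast
  have close: ?thesis if "u \<bullet> u < ?w \<bullet> ?w" "u - h \<in> ?Z" for u
    using min[OF that(2)] that(1) by simp
  have pos: "?w \<bullet> ?w > 0"
    using assms(2) weight_norm[OF assms(1)] unfolding nat_less_4 by auto
  have r: "0 \<le> r" "r < N" by (auto simp: r_def N_def)
  have "r = 0 \<or> r = 1 \<or> r = N - 1 \<or> (j = 2 \<and> r = 2) \<or> (j = 3 \<and> r = 2) \<or> (j = 3 \<and> r = 3)"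
    using r assms(2) unfolding N_def by presburger
  then consider "r = 0" | "r = 1" | "r = N - 1" | "j = 2" "r = 2" | "j = 3" "r = 2" | "j = 3" "r = 3"
    by blast
  then show ?thesis
  proof cases
    case 1
    then have "0 - h \<in> ?Z" using zspan_minus[OF m(1)] m(2) by simp
    then show ?thesis using close[of 0] pos by simp
  next
    case 2
    then have "1 *\<^sub>R h = ?w + m" using m by simp
    then show ?thesis using m by blast
  next
    case 3
    have "(-1) *\<^sub>R h = ?w + (- ((2 + real j) *\<^sub>R ?w) - m)"
      using m 3 by (simp add: N_def algebra_simps scaleR_2)
    moreover have "- ((2 + real j) *\<^sub>R ?w) - m \<in> ?Z"
      by (intro zspan_diff zspan_minus weight_order assms m)
    ultimately show ?thesis by blast
  next
    case 4
    \<comment> \<open>Subtracting \<open>w\<close> moves twice the weight to a shorter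
      representative: the norm is 4 * (5/4) - 4 * 2 + 4 = 1, as for the vector weight of D5.\<close>
    define w where "w = 2 *\<^sub>R b 2 - 3 *\<^sub>R b 3 + b 4 + b 5 + b 6"
    define u where "u = 2 *\<^sub>R weight b 2 - w"
    have "weight b 2 \<bullet> w = 2" "w \<bullet> w = 4"
      by (simp_all add: w_def inner_add_left inner_add_right inner_diff_left inner_diff_right g
          weight_inner[OF assms(1)])
    then have "u \<bullet> u = 1"
      using weight_norm[OF assms(1)]
      by (simp add: u_def inner_diff_left inner_diff_right inner_commute[of w "weight b 2"])
    moreover have "w \<in> ?Z"
      unfolding w_def 4 base_eqs by (intro zspan_add zspan_diff zspan_Ints) (auto intro: zspan_base)
    then have "- w - m \<in> ?Z" by (intro zspan_diff zspan_minus m)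
    then have "u - h \<in> ?Z" using m 4 by (simp add: u_def)
    ultimately show ?thesis using 4 weight_norm[OF assms(1)] by (intro close[of u]) simp_all
  next
    case 5
    \<comment> \<open>In A4, twice and three times the given weight fall into the cosets of the two
      shortest fundamental weights, of norm 4/5 < 6/5; here and in the next case \<open>w\<close>
      leads to such a representative.\<close>
    define w where "w = 2 *\<^sub>R b 3 - b 4 - b 5 - b 6"
    define u where "u = 2 *\<^sub>R weight b 3 - w"
    have "weight b 3 \<bullet> w = 2" "w \<bullet> w = 4"
      by (simp_all add: w_def inner_add_left inner_add_right inner_diff_left inner_diff_right g
          weight_inner[OF assms(1)])
    then have "u \<bullet> u = 4/5"
      using weight_norm[OF assms(1)]
      by (simp add: u_def inner_diff_left inner_diff_right inner_commute[of w "weight b 3"])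
    moreover have "w \<in> ?Z"
      unfolding w_def 5 base_eqs by (intro zspan_add zspan_diff zspan_Ints) (auto intro: zspan_base)
    then have "- w - m \<in> ?Z" by (intro zspan_diff zspan_minus m)
    then have "u - h \<in> ?Z" using m 5 by (simp add: u_def)
    ultimately show ?thesis using 5 weight_norm[OF assms(1)] by (intro close[of u]) simp_all
  next
    case 6
    define w where "w = 4 *\<^sub>R b 3 - 2 *\<^sub>R b 4 - b 5 - b 6"
    define u where "u = 3 *\<^sub>R weight b 3 - w"
    have "weight b 3 \<bullet> w = 4" "w \<bullet> w = 14"
      by (simp_all add: w_def inner_add_left inner_add_right inner_diff_left inner_diff_right g
          weight_inner[OF assms(1)])
    then have "u \<bullet> u = 4/5"
      using weight_norm[OF assms(1)]
      by (simp add: u_def inner_diff_left inner_diff_right inner_commute[of w "weight b 3"])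
    moreover have "w \<in> ?Z"
      unfolding w_def 6 base_eqs by (intro zspan_add zspan_diff zspan_Ints) (auto intro: zspan_base)
    then have "- w - m \<in> ?Z" by (intro zspan_diff zspan_minus m)
    then have "u - h \<in> ?Z" using m 6 by (simp add: u_def)
    ultimately show ?thesis using 6 weight_norm[OF assms(1)] by (intro close[of u]) simp_all
  qed
qed

lemma frame_weight_cases:
  assumes "frame \<Phi> b" "j < 4" "h \<in> span (part \<Phi> b j)" "\<forall>\<alpha>\<in>part \<Phi> b j. h \<bullet> \<alpha> \<in> {-1, 0, 1}"
  shows "h \<bullet> h < weight b j \<bullet> weight b j \<or>
    (\<exists>s\<in>{1, -1}. \<exists>l\<in>zspan (part \<Phi> b j). s *\<^sub>R h = weight b j + l)"
  unfolding zspan_part[OF assms(1)]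
proof (rule weight_cases[OF frame_gram[OF assms(1)] assms(2)])
  show "h \<in> span (b ` {j..<7})" using assms(3) span_part[OF assms(1)] by simp
  show "\<forall>i. j \<le> i \<and> i < 7 \<longrightarrow> h \<bullet> b i \<in> \<int>"
  proof (intro allI impI)
    fix i assume "j \<le> i \<and> i < 7"
    then have "b i \<in> part \<Phi> b j" using part_base[OF assms(1)] by blast
    then show "h \<bullet> b i \<in> \<int>" using assms(4) by force
  qed
  show "h \<bullet> h \<le> (h + l) \<bullet> (h + l)" if "l \<in> zspan (b ` {j..<7})" for l
    using minuscule_minimal_norm[OF graded_slrs[OF frame_graded[OF assms(1,2)]] _ assms(4)] that
      zspan_part[OF assms(1)] by blast
qed

section \<open>A system with a frame is not the degree 0 part of a larger graded system\<close>

lemma zspan_even: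
  assumes "slrs \<Phi>" "x \<in> zspan \<Phi>"
  shows "\<exists>k::int. x \<bullet> x = 2 * of_int k"
  using assms(2)
proof induction
  case zero
  show ?case by (intro exI[of _ 0]) simp
next
  case (add x s)
  then obtain k where "x \<bullet> x = 2 * of_int k" by blast
  moreover obtain i where "x \<bullet> s = of_int i"
    using zspan_inner_Ints2[OF add(1) zspan_base[OF add(2)] root_inner_Ints[OF assms(1)]] by (auto elim: Ints_cases)
  ultimately show ?case using root_norm[OF assms(1) add(2)]
    by (intro exI[of _ "k + i + 1"]) (simp add: inner_add_left inner_add_right inner_commute[of s x])
next
  case (diff x s)
  then obtain k where "x \<bullet> x = 2 * of_int k" by blast
  moreover obtain i where "x \<bullet> s = of_int i"
    using zspan_inner_Ints2[OF diff(1) zspan_base[OF diff(2)] root_inner_Ints[OF assms(1)]] by (auto elim: Ints_cases)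
  ultimately show ?case using root_norm[OF assms(1) diff(2)]
    by (intro exI[of _ "k - i + 1"]) (simp add: inner_diff_left inner_diff_right inner_commute[of s x])
qed

text \<open>A root \<open>v\<close> of degree 1 would have the component \<open>h\<close> with \<open>h \<bullet> h = 3/2\<close> in the span of the
  part of degree 0, and \<open>2 (v - h)\<close> would be a root of degree 2 (the highest root of \<open>E\<^sub>8\<close>).\<close>

lemma frame_not_layer_0:
  assumes "graded \<Phi> q" "q \<in> span \<Phi>" "frame (layer \<Phi> q 0) b"
  shows False
proof -
  let ?L = "layer \<Phi> q 0"
  note sl = graded_slrs[OF assms(1)]
  note slL = frame_slrs[OF assms(3)] and gram = frame_gram[OF assms(3)]
  obtain v where v: "v \<in> layer \<Phi> q 1" using layer_1_nonempty[OF assms(1)] .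
  have v': "v \<in> \<Phi>" "v \<bullet> v = 2" "q \<bullet> v = 1" using v root_norm[OF sl] by (auto simp: layer_def)
  define h where "h = local_weight q v"
  note lw = local_weight[OF assms(1) v assms(2), folded h_def]
  have hv: "h \<bullet> \<alpha> \<in> {-1, 0, 1}" if "\<alpha> \<in> ?L" for \<alpha>
    using lw(2)[OF that] layer_10_inner[OF assms(1) v that] by simp
  note p0 = part_0[OF assms(3)] and zp = zspan_part[OF assms(3), of 0] and sp = span_part[OF assms(3), of 0]
  have hs: "h \<in> span (b ` {0..<7})" using lw(1) sp p0 by simp
  have hi: "\<forall>i. 0 \<le> i \<and> i < 7 \<longrightarrow> h \<bullet> b i \<in> \<int>"
    using hv frame_base[OF assms(3)] by fastforce
  have "(0::nat) < 4" by simp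
  then obtain k :: int and l where l: "l \<in> zspan (b ` {0..<7})" "h = of_int k *\<^sub>R weight b 0 + l"
    using weight_coset[OF gram _ hs hi] by blast
  have two: "2 *\<^sub>R weight b 0 \<in> zspan (b ` {0..<7})" using weight_order[of 0 b] by simp
  have h0: "h \<bullet> h > 0"
  proof -
    have "\<exists>\<alpha>\<in>?L. v \<bullet> \<alpha> = 1"
      by (rule layer_0_nonorth[OF assms(1) v, of _ "{}"]) (use frame_base[OF assms(3), of 0] in auto)
    then show ?thesis using lw(2) by auto
  qed
  \<comment> \<open>For even \<open>k\<close> the vector \<open>h\<close> lies in the root lattice,
    and being minimal in that coset it would be 0.\<close>
  have odd: "odd k"
  proof
    assume "even k"
    then obtain m where "k = 2 * m" by blast
    then have "h = of_int m *\<^sub>R (2 *\<^sub>R weight b 0) + l" using l(2) by (simp add: algebra_simps)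
    then have "h \<in> zspan (b ` {0..<7})" using zspan_add[OF zspan_of_int[OF two] l(1)] by metis
    then have "- h \<in> zspan ?L" using zspan_minus[of h] unfolding zp[symmetric] p0 by blast
    then have "h \<bullet> h \<le> (h + - h) \<bullet> (h + - h)"
      using minuscule_minimal_norm[OF slL] hv by blast
    then show False using h0 by simp
  qed
  then obtain m where "k = 2 * m + 1" by (blast elim: oddE)
  then have "h = weight b 0 + (of_int m *\<^sub>R (2 *\<^sub>R weight b 0) + l)" using l(2) by (simp add: algebra_simps)
  moreover have "of_int m *\<^sub>R (2 *\<^sub>R weight b 0) + l \<in> zspan (b ` {0..<7})"
    by (rule zspan_add[OF zspan_of_int[OF two] l(1)])
  ultimately obtain n where n: "n \<in> zspan (b ` {0..<7})" "h = weight b 0 + n" by blast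
  have nL: "n \<in> zspan ?L" using n zp p0 by simp
  obtain i :: int where i: "n \<bullet> n = 2 * of_int i" using zspan_even[OF slL nL] by blast
  have "weight b 0 \<bullet> n \<in> \<int>"
    by (rule zspan_inner_Ints[OF n(1)]) (use weight_inner[OF gram, of 0] in auto)
  then obtain i' where i': "weight b 0 \<bullet> n = of_int i'" by (auto elim: Ints_cases)
  \<comment> \<open>Evenness of the root lattice puts the norm of \<open>h\<close> into 3/2 + 2Z;
    since it lies strictly between 0 and 2, it is 3/2.\<close>
  have "h \<bullet> h = 3/2 + 2 * of_int (i + i')"
    using i i' weight_norm(1)[OF gram] n(2) by (simp add: inner_add_left inner_add_right inner_commute[of n "weight b 0"])
  moreover have "h \<bullet> h < 2" using lw(3,4) by simp
  ultimately have "real_of_int (i + i') < 1" "- 1 < real_of_int (i + i')" using h0 by simp_all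
  then have "i + i' = 0" by linarith
  then have hh: "h \<bullet> h = 3/2" using \<open>h \<bullet> h = 3/2 + 2 * of_int (i + i')\<close> by simp
  have vh: "v \<bullet> h = h \<bullet> h"
  proof -
    have "q \<bullet> h = 0" using lw(1) by (rule inner_span_layer_0)
    moreover have "h \<bullet> h = (v - (1 / (q \<bullet> q)) *\<^sub>R q) \<bullet> h" by (simp add: h_def local_weight_def)
    ultimately show ?thesis by (simp add: inner_diff_left)
  qed
  define w where "w = 2 *\<^sub>R v - 2 *\<^sub>R h"
  have "w \<bullet> w = 2"
    using vh hh v' by (simp add: w_def inner_diff_left inner_diff_right inner_commute[of h v])
  moreover have "w \<in> zspan \<Phi>"
  proof -
    have "2 *\<^sub>R h = 2 *\<^sub>R weight b 0 + 2 *\<^sub>R n" using n by (simp add: algebra_simps)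
    moreover have "2 *\<^sub>R n \<in> zspan (b ` {0..<7})" using n(1) by (intro zspan_Ints) auto
    ultimately have "2 *\<^sub>R h \<in> zspan ?L" using zspan_add[OF two] zp p0 by simp
    then have "2 *\<^sub>R h \<in> zspan \<Phi>" using zspan_mono[of ?L \<Phi>] by (auto simp: layer_def)
    moreover have "2 *\<^sub>R v \<in> zspan \<Phi>" using v' by (intro zspan_Ints zspan_base) auto
    ultimately show ?thesis unfolding w_def by (intro zspan_diff)
  qed
  ultimately have "w \<in> \<Phi>" using zspan_norm_2[OF sl] by blast
  moreover have "q \<bullet> w = 2"
    using inner_span_layer_0[OF lw(1)] v' by (simp add: w_def inner_diff_right)
  ultimately show False using graded_value[OF assms(1)] by force
qed

text \<open>Chains of exactly three steps give frames. A longer chain has, at some level, a system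
  with a frame as its part of degree 0, which is impossible.\<close>

lemma graded_frame:
  assumes "graded \<Phi> q" "q \<in> span \<Phi>"
  shows "(\<exists>h\<in>span \<Phi>. graded \<Phi> h \<and> h \<bullet> h < 3 / 2) \<or>
    (\<exists>b. frame \<Phi> b \<and> (\<forall>\<alpha>\<in>\<Phi>. q \<bullet> \<alpha> = weight b 0 \<bullet> \<alpha>))"
proof -
  have no: False if "local_chain 2 (Suc (Suc (Suc (Suc t)))) \<Phi> q" for t and \<Phi> :: "'a set" and q
    using that
  proof (induction t arbitrary: \<Phi> q)
    case 0
    obtain v where v: "local_chain 2 (Suc (Suc (Suc 0))) (layer \<Phi> q 0) (local_weight q v)"
      using local_chain_Suc_norm[OF 0] by blast
    obtain b where "frame (layer \<Phi> q 0) b" using local_chain_frame[OF v] by blast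
    then show ?case using frame_not_layer_0 local_chain_graded[OF 0] local_chain_span[OF 0] by blast
  next
    case (Suc t)
    obtain v where v: "local_chain 2 (Suc (Suc (Suc (Suc t)))) (layer \<Phi> q 0) (local_weight q v)"
      using local_chain_Suc_norm[OF Suc(2)] by blast
    then show ?case by (rule Suc(1))
  qed
  show ?thesis
  proof (cases "\<exists>h\<in>span \<Phi>. graded \<Phi> h \<and> h \<bullet> h < 3 / 2")
    case False
    then obtain t where t: "local_chain 2 (Suc (Suc (Suc t))) \<Phi> q"
      using graded_classification[OF assms] by blast
    then have "t = 0" using no by (cases t) auto
    then obtain b where "frame \<Phi> b" "\<And>\<alpha>. \<alpha> \<in> \<Phi> \<Longrightarrow> q \<bullet> \<alpha> = weight b 0 \<bullet> \<alpha>"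
      using local_chain_frame t by blast
    then show ?thesis by blast
  qed blast
qed

section \<open>Moving frames\<close>

lemma weight_image:
  assumes "linear f"
  shows "weight (f \<circ> b) j = f (weight b j)"
  by (simp add: weight_def linear_add[OF assms] linear_diff[OF assms] linear_scale[OF assms])

lemma weight_cong: "(\<And>i. i < 7 \<Longrightarrow> b i = b' i) \<Longrightarrow> weight b j = weight b' j"
  by (simp add: weight_def)

lemma part_cong: "(\<And>i. i < 7 \<Longrightarrow> b i = b' i) \<Longrightarrow> part \<Phi> b j = part \<Phi> b' j"
proof -
  assume "\<And>i. i < 7 \<Longrightarrow> b i = b' i"
  then have "b ` {j..<7} = b' ` {j..<7}" by (intro image_cong) auto
  then show ?thesis by (simp add: part_def)
qed

lemma frame_subset_span: "frame \<Phi> b \<Longrightarrow> zspan (b ` {j..<7}) \<subseteq> span \<Phi>"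
proof -
  assume fr: "frame \<Phi> b"
  have "part \<Phi> b j \<subseteq> \<Phi>" by (auto simp: part_def)
  then have "span (part \<Phi> b j) \<subseteq> span \<Phi>" by (rule span_mono)
  then show ?thesis using zspan_subset_span span_part[OF fr] by blast
qed

lemma weight_in_span: "frame \<Phi> b \<Longrightarrow> j < 4 \<Longrightarrow> weight b j \<in> span (part \<Phi> b j)"
  using weight_span span_part by blast

lemma part_image:
  assumes "isometry_on f \<Phi>" "frame \<Phi> b"
  shows "part (f ` \<Phi>) (f \<circ> b) j = f ` part \<Phi> b j"
proof -
  have "zspan ((f \<circ> b) ` {j..<7}) = f ` zspan (b ` {j..<7})"
    using zspan_image[OF isometry_on_linear[OF assms(1)], of "b ` {j..<7}"] by (simp add: image_comp)
  then show ?thesis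
    unfolding part_def
    by (simp add: inj_on_image_Int[OF isometry_on_inj[OF assms(1)] span_superset frame_subset_span[OF assms(2)]])
qed

lemma isometry_on_part: "isometry_on f \<Phi> \<Longrightarrow> isometry_on f (part \<Phi> b j)"
  by (rule isometry_on_subset) (auto simp: part_def intro: span_base)

lemma frame_image:
  assumes "isometry_on f \<Phi>" "frame \<Phi> b"
  shows "frame (f ` \<Phi>) (f \<circ> b)"
  unfolding frame_def
proof (intro conjI allI impI)
  note lin = isometry_on_linear[OF assms(1)]
  have "f (b i) \<bullet> f (b j) = b i \<bullet> b j" if "i < 7" "j < 7" for i j
    using isometry_on_inner[OF assms(1)] frame_base[OF assms(2)] that by (simp add: span_base)
  then show "gram (f \<circ> b)" using frame_gram[OF assms(2)] by (simp add: gram_def)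
  show "(f \<circ> b) ` {0..<7} \<subseteq> f ` \<Phi>" using frame_base[OF assms(2)] by auto
  have "zspan ((f \<circ> b) ` {0..<7}) = f ` zspan (b ` {0..<7})"
    using zspan_image[OF lin, of "b ` {0..<7}"] by (simp add: image_comp)
  then show "f ` \<Phi> \<subseteq> zspan ((f \<circ> b) ` {0..<7})" using frame_zspan[OF assms(2)] by auto
  fix j :: nat assume "j < 4"
  then show "graded (part (f ` \<Phi>) (f \<circ> b) j) (weight (f \<circ> b) j)"
    unfolding part_image[OF assms] weight_image[OF lin]
    by (intro graded_image isometry_on_part assms weight_in_span frame_graded)
qed

text \<open>Pairing a linear relation with each \<open>b i\<close> gives a linear system whose
  matrix is the Gram matrix; it has only the zero solution.\<close>

lemma gram_independent:
  assumes "gram b"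
  shows "independent (b ` {0..<7})" "inj_on b {0..<7}"
proof -
  show inj: "inj_on b {0..<7}"
  proof (rule inj_onI)
    fix i j :: nat assume "i \<in> {0..<7}" "j \<in> {0..<7}" "b i = b j"
    then show "i = j" using assms unfolding gram_def
      by (metis (no_types, lifting) atLeastLessThan_iff one_neq_zero rel_simps(76) numeral_eq_one_iff zero_neq_numeral semiring_norm(85))
  qed
  have fin: "finite (b ` {0..<7})" by simp
  show "independent (b ` {0..<7})"
    unfolding independent_explicit_finite_subsets
  proof (intro allI impI ballI)
    fix S u x assume S: "S \<subseteq> b ` {0..<7}" "finite S" and 0: "(\<Sum>v\<in>S. u v *\<^sub>R v) = 0" and x: "x \<in> S"
    define c where "c i = (if b i \<in> S then u (b i) else 0)" for i
    have "(\<Sum>v\<in>S. u v *\<^sub>R v) = (\<Sum>v\<in>b ` {0..<7}. (if v \<in> S then u v else 0) *\<^sub>R v)"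
      by (rule sum.mono_neutral_cong_left) (use S in auto)
    also have "\<dots> = (\<Sum>i\<in>{0..<7}. c i *\<^sub>R b i)" by (simp add: sum.reindex[OF inj] c_def)
    also have "{0..<7} = {0, 1, 2, 3, 4, 5, 6 :: nat}" by auto
    finally have z: "c 0 *\<^sub>R b 0 + c (Suc 0) *\<^sub>R b (Suc 0) + c 2 *\<^sub>R b 2 + c 3 *\<^sub>R b 3 + c 4 *\<^sub>R b 4 + c 5 *\<^sub>R b 5 + c 6 *\<^sub>R b 6 = 0"
      using 0 by (simp add: add.assoc)
    have "(c 0 *\<^sub>R b 0 + c (Suc 0) *\<^sub>R b (Suc 0) + c 2 *\<^sub>R b 2 + c 3 *\<^sub>R b 3 + c 4 *\<^sub>R b 4 + c 5 *\<^sub>R b 5 + c 6 *\<^sub>R b 6) \<bullet> b i = 0" for i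
      unfolding z by simp
    from this[of 0] this[of "Suc 0"] this[of 2] this[of 3] this[of 4] this[of 5] this[of 6]
    have e: "2 * c 0 + c (Suc 0) = 0" "c 0 + 2 * c (Suc 0) + c 2 = 0" "c (Suc 0) + 2 * c 2 + c 3 = 0"
      "c 2 + 2 * c 3 + c 4 + c 5 + c 6 = 0" "c 3 + 2 * c 4 = 0" "c 3 + 2 * c 5 + c 6 = 0" "c 3 + c 5 + 2 * c 6 = 0"
      by (simp_all add: inner_add_left gram_simps[OF assms])
    have c: "c 0 = 0" "c (Suc 0) = 0" "c 2 = 0" "c 3 = 0" "c 4 = 0" "c 5 = 0" "c 6 = 0"
      using e by linarith+
    obtain i where "i < 7" "x = b i" using S x by auto
    then show "u x = 0" using c x unfolding nat_less_7 by (auto simp: c_def)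
  qed
qed

text \<open>The linear map sending \<open>b\<close> to \<open>b'\<close> preserves the common Gram
  matrix, and each root system consists of all norm 2 vectors of its lattice. So matching bases
  already matches the systems, their parts and their weights.\<close>

lemma frame_isometry:
  assumes "frame \<Phi> b" "frame \<Phi>' b'"
  obtains f where "isometry_on f \<Phi>" "f ` \<Phi> = \<Phi>'" "\<And>j. f ` part \<Phi> b j = part \<Phi>' b' j"
    "\<And>j. f (weight b j) = weight b' j"
proof -
  note gram = frame_gram[OF assms(1)] frame_gram[OF assms(2)]
  have "\<exists>f. linear f \<and> (\<forall>x\<in>b ` {0..<7}. f x = (b' \<circ> inv_into {0..<7} b) x)"
    by (rule linear_independent_extend[OF gram_independent(1)[OF gram(1)]])
  then obtain f where lin: "linear f" and "\<forall>x\<in>b ` {0..<7}. f x = (b' \<circ> inv_into {0..<7} b) x" by blast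
  then have fb: "f (b i) = b' i" if "i < 7" for i
    using that inv_into_f_f[OF gram_independent(2)[OF gram(1)], of i] by simp
  have "isometry_on f (b ` {0..<7})"
    by (rule isometry_onI[OF lin]) (use fb gram in \<open>auto simp: gram_def\<close>)
  moreover have "\<Phi> \<subseteq> span (b ` {0..<7})" using frame_zspan[OF assms(1)] zspan_subset_span by blast
  ultimately have f: "isometry_on f \<Phi>" by (rule isometry_on_subset)
  have fb': "(f \<circ> b) i = b' i" if "i < 7" for i using fb that by simp
  have fz: "f ` zspan (b ` {0..<7}) = zspan (b' ` {0..<7})"
  proof -
    have "f ` b ` {0..<7} = b' ` {0..<7}" using fb by force
    then show ?thesis using zspan_image[OF lin] by metis
  qed
  have norm: "f x \<bullet> f x = x \<bullet> x" if "x \<in> zspan (b ` {0..<7})" for x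
    using that frame_subset_span[OF assms(1)] isometry_on_inner[OF f] by blast
  have "f ` {x \<in> Z. x \<bullet> x = 2} = {y \<in> f ` Z. y \<bullet> y = 2}" if "\<And>x. x \<in> Z \<Longrightarrow> f x \<bullet> f x = x \<bullet> x" for Z
    using that by force
  from this[of "zspan (b ` {0..<7})", OF norm]
  have "f ` {x \<in> zspan (b ` {0..<7}). x \<bullet> x = 2} = {y \<in> zspan (b' ` {0..<7}). y \<bullet> y = 2}"
    unfolding fz by blast
  then have im: "f ` \<Phi> = \<Phi>'"
    unfolding part_eq_norm_2[OF assms(1), symmetric] part_eq_norm_2[OF assms(2), symmetric]
      part_0[OF assms(1)] part_0[OF assms(2)] .
  show ?thesis
  proof (rule that[OF f im])
    show "f ` part \<Phi> b j = part \<Phi>' b' j" for j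
      using part_image[OF f assms(1), of j] part_cong[of "f \<circ> b" b' \<Phi>' j, OF fb'] im by simp
    show "f (weight b j) = weight b' j" for j
      using weight_image[OF lin, of b j] weight_cong[of "f \<circ> b" b' j, OF fb'] by simp
  qed
qed

lemma part_slrs:
  assumes "frame \<Phi> b" "j \<le> 4" shows "slrs (part \<Phi> b j)"
proof (cases "j = 4")
  case True
  have "part \<Phi> b 4 = layer (part \<Phi> b 3) (weight b 3) 0"
    using layer_part[OF frame_gram[OF assms(1)], of 3 \<Phi>] by simp
  then show ?thesis using True slrs_layer_0[OF graded_slrs[OF frame_graded[OF assms(1), of 3]]] by simp
qed (use assms graded_slrs[OF frame_graded[OF assms(1), of j]] in simp)

text \<open>A root \<open>k b_4 + y\<close> with \<open>y\<close> orthogonal to \<open>b 4\<close>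
  satisfies \<open>2 * k * k + y \<bullet> y = 2\<close>, so either \<open>k = 0\<close> or
  \<open>y = 0\<close>. This ends every sequence with a frame after its fifth term, since a term at
  the tail of an arrow must be irreducible.\<close>

lemma part_4_reducible:
  assumes "frame \<Phi> b"
  shows "\<not> irreducible_system (part \<Phi> b 4)"
proof
  assume irr: "irreducible_system (part \<Phi> b 4)"
  note g = gram_simps[OF frame_gram[OF assms]]
  let ?Y = "part \<Phi> b 4 \<inter> zspan {b 5, b 6}"
  have ort: "b 4 \<bullet> y = 0" if "y \<in> zspan {b 5, b 6}" for y
    by (rule zspan_inner_0[OF that]) (auto simp: g)
  have mem: "x \<in> {b 4, - b 4} \<or> x \<in> zspan {b 5, b 6}" if x: "x \<in> part \<Phi> b 4" for x
  proof -
    have "x \<in> zspan (insert (b 4) {b 5, b 6})" "x \<bullet> x = 2"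
      using x part_eq_norm_2[OF assms, of 4] by (auto simp: base_eqs)
    then obtain k :: int and y where y: "y \<in> zspan {b 5, b 6}" "x = of_int k *\<^sub>R b 4 + y"
      using zspan_insertE[of x "b 4" "{b 5, b 6}"] by blast
    have "b 4 \<bullet> y = 0" using ort y by simp
    then have "x \<bullet> x = of_int (2 * k * k) + y \<bullet> y"
      using y(2) by (simp add: inner_add_left inner_add_right g inner_commute[of y "b 4"])
    then have e: "of_int (2 * k * k) + y \<bullet> y = 2" using \<open>x \<bullet> x = 2\<close> by simp
    then have "real_of_int (2 * k * k) \<le> 2" using inner_ge_zero[of y] by linarith
    then have "k \<in> {-1, 0, 1}" by (intro square_less_4) linarith
    then consider "k = 0" | "k = 1" | "k = -1" by blast
    then show ?thesis
    proof cases
      case 1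
      then show ?thesis using y by simp
    qed (use e y in auto)
  qed
  have b: "b 4 \<in> part \<Phi> b 4" "b 5 \<in> part \<Phi> b 4" using part_base[OF assms] by auto
  have slp: "slrs (part \<Phi> b 4)" by (rule part_slrs[OF assms]) simp
  have "{b 4, - b 4} = {} \<or> ?Y = {}"
  proof (rule irreducible_cases[OF irr])
    show "part \<Phi> b 4 = {b 4, - b 4} \<union> ?Y" using mem b(1) root_minus[OF slp b(1)] by auto
    show "x \<bullet> y = 0" if "x \<in> {b 4, - b 4}" "y \<in> ?Y" for x y using that ort by auto
  qed
  moreover have "b 5 \<in> ?Y" using b by (auto intro: zspan_base)
  ultimately show False by blast
qed

lemma orthogonal_transformation_image_eq:
  assumes "orthogonal_transformation \<sigma>" "finite S" "\<sigma> ` S \<subseteq> S"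
  shows "\<sigma> ` S = S"
  using assms by (metis card_image card_subset_eq finite_imageI inj_on_subset orthogonal_transformation_inj subset_UNIV)

text \<open>Congruent weights of gradings have equal norms, both being minimal in their coset. So if \<open>h\<close> is
  congruent to the weight induced by \<open>b i\<close> on the next part, then adding the difference to \<open>b i\<close>
  gives another root \<open>v\<close> of degree 1, which induces \<open>h\<close>; a product of reflections maps \<open>b i\<close> to \<open>v\<close>.\<close>

lemma frame_adapt:
  assumes fr: "frame \<Phi> b" and i: "i < 3"
    and h: "h \<in> span (part \<Phi> b (Suc i))" "\<forall>\<alpha>\<in>part \<Phi> b (Suc i). h \<bullet> \<alpha> \<in> {-1, 0, 1}"
    and ge: "weight b (Suc i) \<bullet> weight b (Suc i) \<le> h \<bullet> h"
  obtains b' s where "s \<in> {1, -1}" "frame \<Phi> b'" "\<And>m. m \<le> Suc i \<Longrightarrow> part \<Phi> b' m = part \<Phi> b m"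
    "\<And>m. m \<le> i \<Longrightarrow> weight b' m = weight b m"
    "\<And>\<alpha>. \<alpha> \<in> part \<Phi> b (Suc i) \<Longrightarrow> h \<bullet> \<alpha> = s * (weight b' (Suc i) \<bullet> \<alpha>)"
proof -
  let ?P = "part \<Phi> b i" and ?Q = "part \<Phi> b (Suc i)" and ?w = "weight b (Suc i)"
  have i4: "i < 4" "Suc i < 4" using i by auto
  note gram = frame_gram[OF fr]
  have grP: "graded ?P (weight b i)" and grQ: "graded ?Q ?w" using frame_graded[OF fr] i4 by auto
  have layerQ: "layer ?P (weight b i) 0 = ?Q" using layer_part[OF gram i4(1)] .
  obtain s l where s: "s \<in> {1, -1}" and l: "l \<in> zspan ?Q" "s *\<^sub>R h = ?w + l"
    using frame_weight_cases[OF fr i4(2) h] ge by force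
  define h' where "h' = s *\<^sub>R h"
  have h': "\<forall>\<alpha>\<in>?Q. h' \<bullet> \<alpha> \<in> {-1, 0, 1}" "h' = ?w + l"
  proof -
    show "\<forall>\<alpha>\<in>?Q. h' \<bullet> \<alpha> \<in> {-1, 0, 1}" using s h(2) unfolding h'_def by force
    show "h' = ?w + l" using l(2) by (simp add: h'_def)
  qed
  have "?w \<bullet> ?w \<le> h' \<bullet> h'" 
    using minuscule_minimal_norm[OF graded_slrs[OF grQ] l(1), of ?w] graded_value[OF grQ] h'(2) by simp
  moreover have "h' \<bullet> h' \<le> ?w \<bullet> ?w"
    using minuscule_minimal_norm[OF graded_slrs[OF grQ] zspan_minus[OF l(1)] h'(1)] h'(2) by simp
  ultimately have nl: "2 * (?w \<bullet> l) + l \<bullet> l = 0"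
    unfolding h'(2) by (simp add: inner_add_left inner_add_right inner_commute[of l ?w])
  have lz: "l \<in> zspan (b ` {Suc i..<7})" using l(1) zspan_part[OF fr] by simp
  have bi: "b i \<bullet> b k = ?w \<bullet> b k" if "k \<in> {Suc i..<7}" for k
    using that i gram weight_inner[OF gram i4(2), of k] by (auto simp: gram_def)
  have bz: "b i \<bullet> x = ?w \<bullet> x" if "x \<in> zspan (b ` {Suc i..<7})" for x
    by (rule zspan_inner_eq[OF that]) (use bi in auto)
  have w0: "weight b m \<bullet> x = 0" if "x \<in> zspan (b ` {Suc i..<7})" "m \<le> i" for x m
    by (rule zspan_inner_0[OF that(1)]) (use weight_inner[OF gram, of m] that(2) i in auto)
  have Qz: "?Q \<subseteq> zspan (b ` {Suc i..<7})" by (rule part_zspan)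
  define v where "v = b i + l"
  have bP: "b i \<in> layer ?P (weight b i) 1" using part_layer_1[OF fr i4(1)] .
  have "v \<in> layer ?P (weight b i) 1"
  proof -
    have "b i \<bullet> b i = 2" using gram i by (simp add: gram_def)
    then have "v \<bullet> v = 2"
      using nl bz[OF lz] by (simp add: v_def inner_add_left inner_add_right inner_commute[of l "b i"])
    have "b ` {Suc i..<7} \<subseteq> b ` {i..<7}" by auto
    then have "l \<in> zspan (b ` {i..<7})" using lz zspan_mono by blast
    moreover have "b i \<in> zspan (b ` {i..<7})" using i by (intro zspan_base) auto
    ultimately have "v \<in> zspan (b ` {i..<7})" unfolding v_def by (intro zspan_add)
    with \<open>v \<bullet> v = 2\<close> have "v \<in> ?P" using part_eq_norm_2[OF fr] by simp
    then show ?thesis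
      using bP w0[OF lz, of i] by (simp add: layer_def v_def inner_add_right)
  qed
  then obtain \<sigma> where \<sigma>: "orthogonal_transformation \<sigma>" "\<sigma> (b i) = v" "\<sigma> ` ?P = ?P"
    and fixed: "\<And>x. (\<forall>\<alpha>\<in>?Q. x \<bullet> \<alpha> = 0) \<Longrightarrow> \<sigma> x = x"
    using layer_1_transitive[OF grP bP] unfolding layerQ by metis
  have iso: "isometry_on \<sigma> S" for S by (rule orthogonal_transformation_isometry_on[OF \<sigma>(1)])
  note lin = isometry_on_linear[OF iso]
  \<comment> \<open>In the Gram matrix \<open>b k\<close> is orthogonal to everything beyond
    \<open>b (Suc k)\<close>, hence to the whole part in whose roots the reflections are
    taken.\<close>
  have fixb: "\<sigma> (b k) = b k" if "k < i" for k
  proof (rule fixed, rule ballI)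
    fix \<alpha> assume "\<alpha> \<in> ?Q"
    then have "\<alpha> \<in> zspan (b ` {Suc i..<7})" using Qz by blast
    then show "b k \<bullet> \<alpha> = 0"
      by (rule zspan_inner_0) (use gram that i in \<open>auto simp: gram_def\<close>)
  qed
  have fixw: "\<sigma> (weight b m) = weight b m" if "m \<le> i" for m
    using fixed w0 that Qz by blast
  \<comment> \<open>The vectors before \<open>b i\<close> are fixed, and the remaining ones stay in
    part \<open>i\<close>. So \<open>\<sigma>\<close> maps the lattice of each earlier part into
    itself, and with it the norm 2 vectors.\<close>
  have im: "\<sigma> ` part \<Phi> b m = part \<Phi> b m" if "m \<le> i" for m
  proof (rule orthogonal_transformation_image_eq[OF \<sigma>(1)])
    have "part \<Phi> b m \<subseteq> \<Phi>" by (auto simp: part_def)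
    then show "finite (part \<Phi> b m)" using root_finite[OF frame_slrs[OF fr]] finite_subset by blast
    have "\<sigma> (b k) \<in> zspan (b ` {m..<7})" if "k \<in> {m..<7}" for k
    proof (cases "k < i")
      case True
      then show ?thesis using fixb that by (auto intro: zspan_base)
    next
      case False
      then have "b k \<in> ?P" using part_base[OF fr] that by auto
      then have "\<sigma> (b k) \<in> ?P" using \<sigma>(3) by blast
      then have "\<sigma> (b k) \<in> zspan (b ` {i..<7})" using part_zspan by blast
      moreover have "b ` {i..<7} \<subseteq> b ` {m..<7}" using \<open>m \<le> i\<close> by auto
      ultimately show ?thesis using zspan_mono by blast
    qed
    then have "\<sigma> ` b ` {m..<7} \<subseteq> zspan (b ` {m..<7})" by auto
    then have "\<sigma> ` zspan (b ` {m..<7}) \<subseteq> zspan (b ` {m..<7})"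
      unfolding zspan_image[OF lin] using zspan_le by blast
    then show "\<sigma> ` part \<Phi> b m \<subseteq> part \<Phi> b m"
      using isometry_on_inner[OF iso[of UNIV]] unfolding part_eq_norm_2[OF fr] by auto
  qed
  have im\<Phi>: "\<sigma> ` \<Phi> = \<Phi>" using im[of 0] part_0[OF fr] by simp
  have imQ: "\<sigma> ` ?Q = ?Q"
    using layer_image[OF iso weight_in_span[OF fr i4(1)], of 0] fixw[of i] im[of i] layerQ by simp
  show ?thesis
  proof (rule that[of s "\<sigma> \<circ> b"])
    show "s \<in> {1, -1}" by (rule s)
    show fr': "frame \<Phi> (\<sigma> \<circ> b)" using frame_image[OF iso fr] im\<Phi> by simp
    have "part \<Phi> (\<sigma> \<circ> b) m = \<sigma> ` part \<Phi> b m" for m using part_image[OF iso fr, of m] im\<Phi> by simp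
    then show parts: "part \<Phi> (\<sigma> \<circ> b) m = part \<Phi> b m" if "m \<le> Suc i" for m
      using that im imQ by (cases "m = Suc i") auto
    show "weight (\<sigma> \<circ> b) m = weight b m" if "m \<le> i" for m
      using weight_image[OF lin] fixw[OF that] by simp
    fix \<alpha> assume "\<alpha> \<in> ?Q"
    then have a: "\<alpha> \<in> zspan (b ` {Suc i..<7})" "\<alpha> \<in> zspan ((\<sigma> \<circ> b) ` {Suc i..<7})"
      using part_zspan parts[of "Suc i"] by blast+
    have "h' \<bullet> \<alpha> = v \<bullet> \<alpha>" using bz[OF a(1)] unfolding h'(2) v_def by (simp add: inner_add_left)
    moreover have "v \<bullet> \<alpha> = weight (\<sigma> \<circ> b) (Suc i) \<bullet> \<alpha>"
    proof (rule zspan_inner_eq[OF a(2)])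
      fix x assume "x \<in> (\<sigma> \<circ> b) ` {Suc i..<7}"
      then obtain k where k: "k \<in> {Suc i..<7}" "x = \<sigma> (b k)" by auto
      have "v \<bullet> x = b i \<bullet> b k" using isometry_on_inner[OF iso[of UNIV]] k(2) unfolding \<sigma>(2)[symmetric] by simp
      also have "\<dots> = weight (\<sigma> \<circ> b) (Suc i) \<bullet> x"
        using bi[OF k(1)] k isometry_on_inner[OF iso[of UNIV]] weight_image[OF lin, of b "Suc i"] by simp
      finally show "v \<bullet> x = weight (\<sigma> \<circ> b) (Suc i) \<bullet> x" .
    qed
    ultimately show "h \<bullet> \<alpha> = s * (weight (\<sigma> \<circ> b) (Suc i) \<bullet> \<alpha>)"
      using s by (auto simp: h'_def)
  qed
qed

section \<open>The sequence of a frame\<close>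

definition frame_parts :: "'a::real_inner set \<Rightarrow> (nat \<Rightarrow> 'a) \<Rightarrow> 'a set list" where
  "frame_parts \<Phi> b = map (part \<Phi> b) [0, 1, 2, 3, 4]"

definition frame_gradings :: "'a::real_inner set \<Rightarrow> (nat \<Rightarrow> 'a) \<Rightarrow> (int \<Rightarrow> 'a set) list" where
  "frame_gradings \<Phi> b = map (\<lambda>j k. layer (part \<Phi> b j) (weight b j) (of_int k)) [0, 1, 2, 3]"

lemma frame_parts_nth: "j \<le> 4 \<Longrightarrow> frame_parts \<Phi> b ! j = part \<Phi> b j"
proof -
  assume "j \<le> 4"
  then consider "j = 0" | "j = 1" | "j = 2" | "j = 3" | "j = 4" by linarith
  then show ?thesis by cases (simp_all add: frame_parts_def)
qed

lemma frame_gradings_nth: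
  "j < 4 \<Longrightarrow> frame_gradings \<Phi> b ! j = (\<lambda>k. layer (part \<Phi> b j) (weight b j) (of_int k))"
proof -
  assume "j < 4"
  then consider "j = 0" | "j = 1" | "j = 2" | "j = 3" by linarith
  then show ?thesis by cases (simp_all add: frame_gradings_def)
qed

lemma frame_lengths: "length (frame_parts \<Phi> b) = 5" "length (frame_gradings \<Phi> b) = 4"
  by (simp_all add: frame_parts_def frame_gradings_def)

lemma frame_nested:
  assumes "frame \<Phi> b" shows "nested_sequence (frame_parts \<Phi> b) (frame_gradings \<Phi> b)"
  unfolding nested_sequence_def frame_lengths
proof (intro conjI ballI allI impI)
  fix \<Psi> assume "\<Psi> \<in> set (frame_parts \<Phi> b)"
  then obtain j where "j \<in> set [0, 1, 2, 3, 4]" "\<Psi> = part \<Phi> b j"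
    unfolding frame_parts_def set_map by blast
  then have j: "j \<le> 4" "\<Psi> = part \<Phi> b j" by auto
  then show "slrs \<Psi>" using part_slrs[OF assms] by simp
  show "\<Psi> \<noteq> {}" using part_base[OF assms, of j 6] j by auto
next
  fix j :: nat assume j: "j < 4"
  show "irreducible_system (frame_parts \<Phi> b ! j)"
    using j graded_irreducible[OF frame_graded[OF assms j]] by (simp add: frame_parts_nth)
  show "three_grading (frame_parts \<Phi> b ! j) (frame_gradings \<Phi> b ! j)"
    using j three_grading_layer[OF frame_graded[OF assms j]] by (simp add: frame_parts_nth frame_gradings_nth)
  show "frame_parts \<Phi> b ! Suc j = (frame_gradings \<Phi> b ! j) 0"
    using j layer_part[OF frame_gram[OF assms] j, of \<Phi>] by (simp add: frame_parts_nth frame_gradings_nth)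
qed simp_all

text \<open>Cardinalities are proportional to norms, so it suffices to bound
  \<open>h \<bullet> h\<close>. Either \<open>h\<close> is shorter than the frame weight, or up to
  sign it is congruent to it, and then minimality in the coset gives the bound.\<close>

lemma frame_maximal:
  assumes "frame \<Phi> b" shows "maximal_sequence (frame_parts \<Phi> b) (frame_gradings \<Phi> b)"
  unfolding maximal_sequence_def frame_lengths
proof (intro allI impI)
  fix j :: nat and H assume j: "j < 4" and "three_grading (frame_parts \<Phi> b ! j) H"
  then have H: "three_grading (part \<Phi> b j) H" by (simp add: frame_parts_nth)
  note gr = frame_graded[OF assms j]
  obtain h where h: "graded (part \<Phi> b j) h" "h \<in> span (part \<Phi> b j)" "\<And>i. H i = layer (part \<Phi> b j) h (of_int i)"
    using three_grading_vector[OF graded_slrs[OF gr] graded_irreducible[OF gr] H] by blast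
  obtain K where K: "K > 0" "\<And>h. h \<in> span (part \<Phi> b j) \<Longrightarrow> (\<forall>\<alpha>\<in>part \<Phi> b j. h \<bullet> \<alpha> \<in> {-1, 0, 1}) \<Longrightarrow>
      real (card (layer (part \<Phi> b j) h 1)) = K * (h \<bullet> h)"
    using card_layer_norm[OF graded_slrs[OF gr] graded_irreducible[OF gr]] by blast
  have hv: "\<forall>\<alpha>\<in>part \<Phi> b j. h \<bullet> \<alpha> \<in> {-1, 0, 1}" using graded_value[OF h(1)] by blast
  have "h \<bullet> h \<le> weight b j \<bullet> weight b j"
    using frame_weight_cases[OF assms j h(2) hv]
  proof
    assume "\<exists>s\<in>{1, - 1}. \<exists>l\<in>zspan (part \<Phi> b j). s *\<^sub>R h = weight b j + l"
    then obtain s l where sl: "s \<in> {1, -1 :: real}" "l \<in> zspan (part \<Phi> b j)" "s *\<^sub>R h = weight b j + l" by blast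
    have "\<forall>\<alpha>\<in>part \<Phi> b j. (s *\<^sub>R h) \<bullet> \<alpha> \<in> {-1, 0, 1}" using hv sl(1) by auto
    from minuscule_minimal_norm[OF graded_slrs[OF gr] zspan_minus[OF sl(2)] this]
    have "(s *\<^sub>R h) \<bullet> (s *\<^sub>R h) \<le> weight b j \<bullet> weight b j" using sl(3) by simp
    then show ?thesis using sl(1) by auto
  qed simp
  then have "K * (h \<bullet> h) \<le> K * (weight b j \<bullet> weight b j)" using K(1) by simp
  moreover have "weight b j \<in> span (part \<Phi> b j)" using weight_in_span[OF assms j] .
  ultimately have "card (layer (part \<Phi> b j) h 1) \<le> card (layer (part \<Phi> b j) (weight b j) 1)"
    using K(2)[OF h(2) hv] K(2)[of "weight b j"] graded_value[OF gr] by simp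
  then show "card (H 1) \<le> card ((frame_gradings \<Phi> b ! j) 1)"
    using j h(3) by (simp add: frame_gradings_nth)
qed

text \<open>The neighbours of \<open>b j\<close> are the vectors \<open>b j - \<alpha>\<close>, where \<open>\<alpha>\<close> has degree 1 for the weight induced
  by \<open>b j\<close>. The other vertices are treated by transitivity.\<close>

lemma frame_local:
  assumes "frame \<Phi> b" shows "local_sequence (frame_gradings \<Phi> b)"
  unfolding local_sequence_def frame_lengths
proof (intro allI impI ballI)
  fix j :: nat and v assume "Suc j < 4" and "v \<in> (frame_gradings \<Phi> b ! j) 1"
  then have j: "j < 3" "j < 4" "Suc j < 4" and v: "v \<in> layer (part \<Phi> b j) (weight b j) 1"
    by (auto simp: frame_gradings_nth)
  let ?P = "part \<Phi> b j" and ?Q = "part \<Phi> b (Suc j)"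
  let ?V = "layer ?Q (weight b (Suc j)) 1" and ?W = "layer ?P (weight b j) 1"
  note gram = frame_gram[OF assms] and gr = frame_graded[OF assms j(2)]
  note sl = graded_slrs[OF gr]
  have layerQ: "layer ?P (weight b j) 0 = ?Q" using layer_part[OF gram j(2)] .
  have bW: "b j \<in> ?W" using part_layer_1[OF assms j(2)] .
  have bb: "b j \<bullet> b j = 2" using gram j by (simp add: gram_def)
  have agree: "b j \<bullet> x = weight b (Suc j) \<bullet> x" if "x \<in> ?Q" for x
  proof (rule zspan_inner_eq)
    show "x \<in> zspan (b ` {Suc j..<7})" using that part_zspan by blast
    show "b j \<bullet> s = weight b (Suc j) \<bullet> s" if "s \<in> b ` {Suc j..<7}" for s
      using that j gram weight_inner[OF gram j(3)] by (auto simp: gram_def)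
  qed
  have V: "x \<in> ?V \<longleftrightarrow> x \<in> ?Q \<and> b j \<bullet> x = 1" for x using agree by (auto simp: layer_def)
  obtain \<sigma> where \<sigma>: "orthogonal_transformation \<sigma>" "\<sigma> (b j) = v" "\<sigma> ` ?P = ?P"
    and fixed: "\<And>x. (\<forall>\<alpha>\<in>?Q. x \<bullet> \<alpha> = 0) \<Longrightarrow> \<sigma> x = x"
    using layer_1_transitive[OF gr bW v] unfolding layerQ by metis
  have iso: "isometry_on \<sigma> S" for S by (rule orthogonal_transformation_isometry_on[OF \<sigma>(1)])
  have ip: "\<sigma> x \<bullet> \<sigma> y = x \<bullet> y" for x y using isometry_on_inner[OF iso[of UNIV]] by simp
  have inj: "\<sigma> x = \<sigma> y \<longleftrightarrow> x = y" for x y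
    using orthogonal_transformation_inj[OF \<sigma>(1)] by (meson injD)
  have "\<sigma> (weight b j) = weight b j"
    by (rule fixed) (use layerQ in \<open>auto simp: layer_def\<close>)
  then have \<sigma>W: "\<sigma> ` ?W = ?W"
    using layer_image[OF iso weight_in_span[OF assms j(2)], of 1] \<sigma>(3) by simp
  define \<phi> where "\<phi> x = \<sigma> (b j - x)" for x
  have ipd: "(b j - x) \<bullet> (b j - y) = x \<bullet> y" if "x \<in> ?V" "y \<in> ?V" for x y
    using that bb by (simp add: V inner_diff_left inner_diff_right inner_commute[of x "b j"])
  have "graph_isomorphic ?V (neighbours ?W v)"
    unfolding graph_isomorphic_def
  proof (intro exI[of _ \<phi>] conjI ballI)
    show "bij_betw \<phi> ?V (neighbours ?W v)"
      unfolding bij_betw_def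
    proof
      show "inj_on \<phi> ?V" by (rule inj_onI) (simp add: \<phi>_def inj)
      show "\<phi> ` ?V = neighbours ?W v"
      proof (intro set_eqI iffI)
        fix w assume "w \<in> \<phi> ` ?V"
        then obtain x where x: "x \<in> ?Q" "b j \<bullet> x = 1" "w = \<sigma> (b j - x)" by (auto simp: V \<phi>_def)
        have "b j - x \<in> ?W" using layer_1_diff[OF gr bW _ x(2)] x(1) layerQ by simp
        then have "w \<in> ?W" using \<sigma>W x(3) by blast
        moreover have "v \<bullet> w = 1" using x bb by (simp add: \<sigma>(2)[symmetric] ip inner_diff_right)
        moreover have "v \<bullet> v = 2" using bb by (simp add: \<sigma>(2)[symmetric] ip)
        ultimately show "w \<in> neighbours ?W v" by (auto simp: neighbours_def nonorthogonal_def)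
      next
        fix w assume "w \<in> neighbours ?W v"
        then have w: "w \<in> ?W" "w \<noteq> v" "v \<bullet> w \<noteq> 0" by (auto simp: neighbours_def nonorthogonal_def)
        then obtain u where u: "u \<in> ?W" "w = \<sigma> u" using \<sigma>W by blast
        have "u \<noteq> b j" "b j \<bullet> u \<noteq> 0" using w u \<sigma>(2) ip by auto
        then have 1: "b j \<bullet> u = 1" using layer_1_inner[OF gr bW u(1), of "b j \<bullet> u = 1"] by blast
        have "b j - u \<in> ?P"
          using root_diff[OF sl _ _ 1] bW u(1) by (simp add: layer_def)
        then have "b j - u \<in> layer ?P (weight b j) 0"
          using bW u(1) by (simp add: layer_def inner_diff_right)
        then have "b j - u \<in> ?V" using 1 bb by (simp add: V layerQ inner_diff_right)
        then show "w \<in> \<phi> ` ?V" using u(2) by (intro image_eqI[of _ _ "b j - u"]) (simp_all add: \<phi>_def)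
      qed
    qed
    fix x y assume "x \<in> ?V" "y \<in> ?V"
    then show "nonorthogonal x y \<longleftrightarrow> nonorthogonal (\<phi> x) (\<phi> y)"
      using ipd by (simp add: nonorthogonal_def \<phi>_def ip inj)
  qed
  then show "graph_isomorphic ((frame_gradings \<Phi> b ! Suc j) 1) (neighbours ((frame_gradings \<Phi> b ! j) 1) v)"
    using j by (simp add: frame_gradings_nth)
qed

text \<open>If the block starts the longer sequence, its fifth term is at the tail of an arrow
  although it is reducible. Otherwise the block is preceded by a term whose part of degree 0 carries
  a frame.\<close>

lemma frame_not_embeddable:
  assumes "frame \<Phi> b" shows "\<not> embeddable (frame_parts \<Phi> b) (frame_gradings \<Phi> b)"
proof
  assume "embeddable (frame_parts \<Phi> b) (frame_gradings \<Phi> b)"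
  then obtain \<Psi>s :: "fsvec set list" and Hs k where ns: "nested_sequence \<Psi>s Hs" and len: "length \<Psi>s > 5" "k + 5 \<le> length \<Psi>s"
    and "sequence_isomorphic (frame_parts \<Phi> b) (frame_gradings \<Phi> b) (take 5 (drop k \<Psi>s)) (take 4 (drop k Hs))"
    unfolding embeddable_def frame_lengths by blast
  then obtain f where f: "root_isomorphism f (hd (frame_parts \<Phi> b)) (hd (take 5 (drop k \<Psi>s)))"
    and all: "list_all2 (\<lambda>\<Phi> \<Psi>. f ` \<Phi> = \<Psi>) (frame_parts \<Phi> b) (take 5 (drop k \<Psi>s))"
    unfolding sequence_isomorphic_def by blast
  have hd: "hd (frame_parts \<Phi> b) = \<Phi>" using part_0[OF assms] by (simp add: frame_parts_def)
  have iso: "isometry_on f \<Phi>" using f unfolding root_isomorphism_iff hd by blast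
  have im: "\<Psi>s ! (k + j) = f ` part \<Phi> b j" if "j \<le> 4" for j
    using list_all2_nthD[OF all, of j] that len by (simp add: frame_lengths frame_parts_nth)
  note fr = frame_image[OF iso assms]
  have im0: "\<Psi>s ! k = f ` \<Phi>" using im[of 0] part_0[OF assms] by simp
  have lenH: "length \<Psi>s = Suc (length Hs)" using nested_sequence_length[OF ns] by simp
  show False
  proof (cases k)
    case 0
    then have "irreducible_system (\<Psi>s ! 4)" using nested_sequence_arrow(2)[OF ns, of 4] len lenH by simp
    moreover have "\<Psi>s ! 4 = part (f ` \<Phi>) (f \<circ> b) 4" using im[of 4] 0 part_image[OF iso assms] by simp
    ultimately show False using part_4_reducible[OF fr] by simp
  next
    case (Suc j)
    then have "j < length Hs" using len lenH by simp
    note arrow = nested_sequence_arrow[OF ns this]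
    obtain h where h: "graded (\<Psi>s ! j) h" "h \<in> span (\<Psi>s ! j)" "\<And>i. (Hs ! j) i = layer (\<Psi>s ! j) h (of_int i)"
      using three_grading_vector[OF arrow(1-3)] by blast
    have "layer (\<Psi>s ! j) h 0 = f ` \<Phi>" using arrow(4) h(3)[of 0] im0 Suc by simp
    then show False using frame_not_layer_0[OF h(1,2)] fr by metis
  qed
qed

text \<open>Induction over the arrows. Failure of extension to the left excludes short weights on
  the first term and so provides a frame there. At each later arrow the frame is moved so as to
  match one more grading, up to sign, without disturbing the earlier parts and weights.\<close>

lemma adapted_frame:
  assumes "nested_sequence \<Psi>s Hs" "maximal_sequence \<Psi>s Hs" "\<not> embeddable \<Psi>s Hs"
    and "1 \<le> n" "n \<le> 4" "n \<le> length Hs"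
  shows "\<exists>b. frame (\<Psi>s ! 0) b \<and> (\<forall>i\<le>n. \<Psi>s ! i = part (\<Psi>s ! 0) b i) \<and>
    (\<forall>i<n. \<exists>s\<in>{1, -1}. \<forall>k. (Hs ! i) k = layer (\<Psi>s ! i) (s *\<^sub>R weight b i) (of_int k))"
  using assms(4-6)
proof (induction n rule: nat_induct_at_least)
  case base
  then have "0 < length Hs" by linarith
  note arrow = nested_sequence_arrow[OF assms(1) this]
  obtain h where h: "graded (\<Psi>s ! 0) h" "h \<in> span (\<Psi>s ! 0)" "\<And>i. (Hs ! 0) i = layer (\<Psi>s ! 0) h (of_int i)"
    using three_grading_vector[OF arrow(1-3)] by blast
  have "\<not> (\<exists>h\<in>span (\<Psi>s ! 0). graded (\<Psi>s ! 0) h \<and> h \<bullet> h < 3 / 2)"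
    using embeddable_left[OF assms(1)] assms(3) by blast
  then obtain b where b: "frame (\<Psi>s ! 0) b" "\<And>\<alpha>. \<alpha> \<in> \<Psi>s ! 0 \<Longrightarrow> h \<bullet> \<alpha> = weight b 0 \<bullet> \<alpha>"
    using graded_frame[OF h(1,2)] by blast
  have l: "layer (\<Psi>s ! 0) h c = layer (\<Psi>s ! 0) (weight b 0) c" for c
    using layer_cong[of "\<Psi>s ! 0" h "weight b 0"] b(2) by blast
  have p0: "part (\<Psi>s ! 0) b 0 = \<Psi>s ! 0" by (rule part_0[OF b(1)])
  have "\<Psi>s ! 1 = part (\<Psi>s ! 0) b 1"
    using arrow(4) h(3)[of 0] l layer_part[OF frame_gram[OF b(1)], of 0 "\<Psi>s ! 0"] p0 by simp
  then have "\<forall>i\<le>1. \<Psi>s ! i = part (\<Psi>s ! 0) b i" using p0 by (auto simp: le_Suc_eq)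
  moreover have "\<forall>i<1. \<exists>s\<in>{1, -1}. \<forall>k. (Hs ! i) k = layer (\<Psi>s ! i) (s *\<^sub>R weight b i) (of_int k)"
    using h(3) l by simp
  ultimately show ?case using b(1) by blast
next
  case (Suc n)
  have "n \<le> 4" "n \<le> length Hs" using Suc.prems by auto
  from Suc.IH[OF this] obtain b where fr: "frame (\<Psi>s ! 0) b" and parts: "\<And>i. i \<le> n \<Longrightarrow> \<Psi>s ! i = part (\<Psi>s ! 0) b i"
    and grad: "\<And>i. i < n \<Longrightarrow> \<exists>s\<in>{1, -1}. \<forall>k. (Hs ! i) k = layer (\<Psi>s ! i) (s *\<^sub>R weight b i) (of_int k)"
    by blast
  obtain i where i: "n = Suc i" "i < 3" using Suc.hyps Suc.prems(1) by (cases n) auto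
  let ?P = "part (\<Psi>s ! 0) b n"
  have n: "n < length Hs" "n < 4" using Suc.prems by auto
  have P: "\<Psi>s ! n = ?P" using parts by blast
  note arrow = nested_sequence_arrow[OF assms(1) n(1)]
  obtain h where h: "graded ?P h" "h \<in> span ?P" "\<And>i. (Hs ! n) i = layer ?P h (of_int i)"
    using three_grading_vector[OF arrow(1-3)] P by metis
  note gr = frame_graded[OF fr n(2)]
  obtain K where K: "K > 0" "\<And>h. h \<in> span ?P \<Longrightarrow> (\<forall>\<alpha>\<in>?P. h \<bullet> \<alpha> \<in> {-1, 0, 1}) \<Longrightarrow>
      real (card (layer ?P h 1)) = K * (h \<bullet> h)"
    using card_layer_norm[OF graded_slrs[OF gr] graded_irreducible[OF gr]] by blast
  \<comment> \<open>Maximality is tested against the grading by the frame weight. This bounds the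
    norm of \<open>h\<close> from below and rules out the shorter cosets.\<close>
  have "card (layer ?P (weight b n) 1) \<le> card ((Hs ! n) 1)"
    using assms(2) n(1) three_grading_layer[OF gr] P unfolding maximal_sequence_def by force
  then have "K * (weight b n \<bullet> weight b n) \<le> K * (h \<bullet> h)"
    using K(2)[OF h(2)] K(2)[OF weight_in_span[OF fr n(2)]] graded_value[OF h(1)] graded_value[OF gr] h(3)[of 1]
    by simp
  then have ge: "weight b n \<bullet> weight b n \<le> h \<bullet> h" using K(1) by simp
  obtain b' s where s: "s \<in> {1, -1}" and fr': "frame (\<Psi>s ! 0) b'"
    and parts': "\<And>m. m \<le> n \<Longrightarrow> part (\<Psi>s ! 0) b' m = part (\<Psi>s ! 0) b m"
    and weights': "\<And>m. m < n \<Longrightarrow> weight b' m = weight b m"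
    and hs: "\<And>\<alpha>. \<alpha> \<in> ?P \<Longrightarrow> h \<bullet> \<alpha> = s * (weight b' n \<bullet> \<alpha>)"
    using frame_adapt[OF fr i(2), of h] h(2) graded_value[OF h(1)] ge unfolding i(1) less_Suc_eq_le by metis
  have H: "(Hs ! n) k = layer (\<Psi>s ! n) (s *\<^sub>R weight b' n) (of_int k)" for k
    using h(3) layer_cong[of ?P h "s *\<^sub>R weight b' n"] hs P by simp
  have "\<Psi>s ! Suc n = layer ?P h 0" using arrow(4) h(3)[of 0] by simp
  also have "\<dots> = layer ?P (weight b' n) 0" using hs s by (auto simp: layer_def)
  also have "\<dots> = part (\<Psi>s ! 0) b' (Suc n)"
    using layer_part[OF frame_gram[OF fr'] n(2), of "\<Psi>s ! 0"] parts'[of n] by simp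
  finally have "\<Psi>s ! Suc n = part (\<Psi>s ! 0) b' (Suc n)" .
  moreover have "\<Psi>s ! i = part (\<Psi>s ! 0) b' i" if "i \<le> n" for i
    using parts[OF that] parts'[OF that] by metis
  ultimately have 1: "\<forall>i\<le>Suc n. \<Psi>s ! i = part (\<Psi>s ! 0) b' i" unfolding le_Suc_eq by blast
  have "\<exists>s\<in>{1, -1}. \<forall>k. (Hs ! i) k = layer (\<Psi>s ! i) (s *\<^sub>R weight b' i) (of_int k)" if "i < Suc n" for i
  proof (cases "i = n")
    case True
    then show ?thesis using H s by blast
  next
    case False
    then show ?thesis using that grad[of i] weights'[of i] by simp
  qed
  then show ?case using fr' 1 by blast
qed

text \<open>A sequence with fewer than four arrows could be continued by the grading that the frame
  puts on its last term, and one with more would need the reducible fifth term to be irreducible.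
  With exactly four arrows, the isometry between the two frames carries one sequence to the
  other.\<close>

lemma frame_unique:
  assumes "frame \<Phi> b" "nested_sequence \<Psi>s Hs" "maximal_sequence \<Psi>s Hs" "\<not> embeddable \<Psi>s Hs"
  shows "sequence_isomorphic (frame_parts \<Phi> b) (frame_gradings \<Phi> b) \<Psi>s Hs"
proof -
  note len = nested_sequence_length[OF assms(2)]
  define n where "n = min 4 (length Hs)"
  have n: "1 \<le> n" "n \<le> 4" "n \<le> length Hs" using len by (auto simp: n_def)
  obtain c where fr: "frame (\<Psi>s ! 0) c" and parts: "\<And>i. i \<le> n \<Longrightarrow> \<Psi>s ! i = part (\<Psi>s ! 0) c i"
    and grad: "\<And>i. i < n \<Longrightarrow> \<exists>s\<in>{1, -1}. \<forall>k. (Hs ! i) k = layer (\<Psi>s ! i) (s *\<^sub>R weight c i) (of_int k)"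
    using adapted_frame[OF assms(2-4) n] by blast
  have "\<not> length Hs < 4"
  proof
    assume l: "length Hs < 4"
    then have "length Hs \<le> n" by (simp add: n_def)
    then have P: "\<Psi>s ! length Hs = part (\<Psi>s ! 0) c (length Hs)" by (rule parts)
    have "part (\<Psi>s ! 0) c (Suc (length Hs)) \<noteq> {}"
      using part_base[OF fr, of "Suc (length Hs)" 6] l by auto
    then have "layer (part (\<Psi>s ! 0) c (length Hs)) (weight c (length Hs)) 0 \<noteq> {}"
      using layer_part[OF frame_gram[OF fr] l] by simp
    then show False
      using embeddable_right[OF assms(2) P[symmetric] frame_graded[OF fr l]] assms(4) by blast
  qed
  moreover have "\<not> length Hs > 4"
  proof
    assume "length Hs > 4"
    then show False
      using nested_sequence_arrow(2)[OF assms(2), of 4] parts[of 4] part_4_reducible[OF fr] by (simp add: n_def)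
  qed
  ultimately have lH: "length Hs = 4" "length \<Psi>s = 5" "n = 4" using len by (auto simp: n_def)
  obtain f where f: "isometry_on f \<Phi>" "f ` \<Phi> = \<Psi>s ! 0" "\<And>j. f ` part \<Phi> b j = part (\<Psi>s ! 0) c j"
    "\<And>j. f (weight b j) = weight c j"
    using frame_isometry[OF assms(1) fr] by blast
  show ?thesis
    unfolding sequence_isomorphic_def
  proof (intro exI[of _ f] conjI)
    have "hd (frame_parts \<Phi> b) = \<Phi>" using part_0[OF assms(1)] by (simp add: frame_parts_def)
    moreover have "hd \<Psi>s = \<Psi>s ! 0" using lH by (intro hd_conv_nth) auto
    ultimately show "root_isomorphism f (hd (frame_parts \<Phi> b)) (hd \<Psi>s)"
      using f(1,2) by (simp add: root_isomorphism_iff)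
    show "list_all2 (\<lambda>\<Phi> \<Psi>. f ` \<Phi> = \<Psi>) (frame_parts \<Phi> b) \<Psi>s"
      unfolding list_all2_conv_all_nth frame_lengths
    proof (intro conjI allI impI)
      fix j :: nat assume "j < 5"
      then show "f ` (frame_parts \<Phi> b ! j) = \<Psi>s ! j"
        using f(3)[of j] parts[of j] lH by (simp add: frame_parts_nth)
    qed (use lH in simp)
    show "list_all2 (carries_grading f) (frame_gradings \<Phi> b) Hs"
      unfolding list_all2_conv_all_nth frame_lengths
    proof (intro conjI allI impI)
      fix j :: nat assume j: "j < 4"
      obtain s where s: "s \<in> {1, -1 :: real}" "\<And>k. (Hs ! j) k = layer (\<Psi>s ! j) (s *\<^sub>R weight c j) (of_int k)"
        using grad[of j] j lH by blast
      have "f ` (frame_gradings \<Phi> b ! j) k = layer (\<Psi>s ! j) (weight c j) (of_int k)" for k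
        using layer_image[OF isometry_on_part[OF f(1)] weight_in_span[OF assms(1) j]] j f(3,4) parts[of j] lH
        by (simp add: frame_gradings_nth)
      \<comment> \<open>The sign \<open>s = -1\<close> corresponds to the alternative that exchanges
        the degrees 1 and -1.\<close>
      then show "carries_grading f (frame_gradings \<Phi> b ! j) (Hs ! j)"
        using s unfolding carries_grading_def by (auto simp: layer_minus)
    qed (use lH in simp)
  qed
qed

section \<open>The coordinate models\<close>

lemma coord_simps [simp]:
  "coord (x + y) i = coord x i + coord y i" "coord (x - y) i = coord x i - coord y i"
  "coord (- x) i = - coord x i" "coord (c *\<^sub>R x) i = c * coord x i" "coord 0 i = 0"
  "coord (basis_vec k) i = (if i = k then 1 else 0)"
  by (simp_all add: plus_fsvec.rep_eq minus_fsvec.rep_eq uminus_fsvec.rep_eq scaleR_fsvec.rep_eq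
      zero_fsvec.rep_eq basis_vec.rep_eq)

lemma inner_basis_basis: "basis_vec i \<bullet> basis_vec j = (if i = j then 1 else 0)"
  by (simp add: basis_vec_inner)

section \<open>The E8 lattice and its roots\<close>

lemma inner_lessThan_8:
  assumes "\<forall>i\<ge>8. coord x i = 0"
  shows "x \<bullet> y = (\<Sum>i<8. coord x i * coord y i)"
proof -
  have "{i. coord x i \<noteq> 0} \<subseteq> {..<8}" using assms by (auto simp: not_less[symmetric])
  then show ?thesis unfolding inner_fsvec_def by (intro sum.mono_neutral_left) auto
qed

text \<open>The coordinates are all integral or all half-integral. Integrality of half the
  coordinate sum expresses that the sum is even.\<close>

definition lattice_E8 :: "fsvec set" where
  "lattice_E8 = {x. (\<forall>i\<ge>8. coord x i = 0) \<and>
     ((\<forall>i<8. coord x i \<in> \<int>) \<or> (\<forall>i<8. coord x i - 1/2 \<in> \<int>)) \<and> (\<Sum>i<8. coord x i) / 2 \<in> \<int>}"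

lemma lattice_E8_diff:
  assumes "x \<in> lattice_E8" "y \<in> lattice_E8" shows "x - y \<in> lattice_E8"
proof -
  have "(\<Sum>i<8. coord (x - y) i) / 2 = (\<Sum>i<8. coord x i) / 2 - (\<Sum>i<8. coord y i) / 2"
    by (simp add: sum_subtractf diff_divide_distrib)
  then have "(\<Sum>i<8. coord (x - y) i) / 2 \<in> \<int>"
    using assms unfolding lattice_E8_def by (metis (no_types, lifting) Ints_diff mem_Collect_eq)
  moreover have "(\<forall>i<8. coord (x - y) i \<in> \<int>) \<or> (\<forall>i<8. coord (x - y) i - 1/2 \<in> \<int>)"
  proof -
    have half: "a - b \<in> \<int>" if "a - 1/2 \<in> \<int>" "b - 1/2 \<in> \<int>" for a b :: real
      using Ints_diff[OF that] by simp
    have half': "a - b - 1/2 \<in> \<int>" if "a \<in> \<int>" "b - 1/2 \<in> \<int>" for a b :: real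
      using Ints_diff[OF Ints_diff[OF that] Ints_1] by (simp add: algebra_simps)
    have half'': "a - b - 1/2 \<in> \<int>" if "a - 1/2 \<in> \<int>" "b \<in> \<int>" for a b :: real
      using Ints_diff[OF that] by (simp add: algebra_simps)
    consider "\<forall>i<8. coord x i \<in> \<int>" "\<forall>i<8. coord y i \<in> \<int>"
      | "\<forall>i<8. coord x i \<in> \<int>" "\<forall>i<8. coord y i - 1/2 \<in> \<int>"
      | "\<forall>i<8. coord x i - 1/2 \<in> \<int>" "\<forall>i<8. coord y i \<in> \<int>"
      | "\<forall>i<8. coord x i - 1/2 \<in> \<int>" "\<forall>i<8. coord y i - 1/2 \<in> \<int>"
      using assms unfolding lattice_E8_def by blast
    then show ?thesis
    proof cases
      case 1
      then have "\<forall>i<8. coord (x - y) i \<in> \<int>" by simp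
      then show ?thesis ..
    next
      case 2
      then have "\<forall>i<8. coord (x - y) i - 1/2 \<in> \<int>" unfolding coord_simps using half' by blast
      then show ?thesis ..
    next
      case 3
      then have "\<forall>i<8. coord (x - y) i - 1/2 \<in> \<int>" unfolding coord_simps using half'' by blast
      then show ?thesis ..
    next
      case 4
      then have "\<forall>i<8. coord (x - y) i \<in> \<int>" unfolding coord_simps using half by blast
      then show ?thesis ..
    qed
  qed
  ultimately show ?thesis using assms by (simp add: lattice_E8_def)
qed

lemma lattice_E8_inner:
  assumes "x \<in> lattice_E8" "y \<in> lattice_E8" shows "x \<bullet> y \<in> \<int>"
proof -
  let ?s = "\<lambda>x. (\<Sum>i<8. coord x i) / 2"
  have s: "?s x \<in> \<int>" "?s y \<in> \<int>" using assms by (auto simp: lattice_E8_def)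
  have mixed: "(\<Sum>i<8. coord x i * coord y i) \<in> \<int>"
    if "\<forall>i<8. coord x i \<in> \<int>" "\<forall>i<8. coord y i - 1/2 \<in> \<int>" "?s x \<in> \<int>" for x y
  proof -
    have "(\<Sum>i<8. coord x i * coord y i) = (\<Sum>i<8. coord x i * (coord y i - 1/2)) + ?s x"
      by (simp add: sum_divide_distrib sum.distrib[symmetric] algebra_simps)
    moreover have "(\<Sum>i<8. coord x i * (coord y i - 1/2)) \<in> \<int>" using that by (intro Ints_sum Ints_mult) auto
    ultimately show ?thesis using that(3) by simp
  qed
  have halves: "(\<Sum>i<8. coord x i * coord y i) \<in> \<int>"
    if "\<forall>i<8. coord x i - 1/2 \<in> \<int>" "\<forall>i<8. coord y i - 1/2 \<in> \<int>"
  proof -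
    have "(\<Sum>i<8. coord x i * coord y i) =
        (\<Sum>i<8. (coord x i - 1/2) * (coord y i - 1/2) + coord x i / 2 + coord y i / 2 - 1/4)"
      by (intro sum.cong) (auto simp: field_simps)
    also have "\<dots> = (\<Sum>i<8. (coord x i - 1/2) * (coord y i - 1/2)) + ?s x + ?s y - 2"
      by (simp only: sum.distrib sum_subtractf sum_divide_distrib) simp
    finally have *: "(\<Sum>i<8. coord x i * coord y i) =
      (\<Sum>i<8. (coord x i - 1/2) * (coord y i - 1/2)) + ?s x + ?s y - 2" .
    have "(\<Sum>i<8. (coord x i - 1/2) * (coord y i - 1/2)) \<in> \<int>" using that by (intro Ints_sum Ints_mult) auto
    then show ?thesis unfolding * using s by (intro Ints_diff Ints_add) auto
  qed
  have "x \<bullet> y = (\<Sum>i<8. coord x i * coord y i)"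
    using assms(1) by (intro inner_lessThan_8) (simp add: lattice_E8_def)
  moreover have "(\<Sum>i<8. coord x i * coord y i) \<in> \<int>"
  proof -
    consider "\<forall>i<8. coord x i \<in> \<int>" "\<forall>i<8. coord y i \<in> \<int>"
      | "\<forall>i<8. coord x i \<in> \<int>" "\<forall>i<8. coord y i - 1/2 \<in> \<int>"
      | "\<forall>i<8. coord x i - 1/2 \<in> \<int>" "\<forall>i<8. coord y i \<in> \<int>"
      | "\<forall>i<8. coord x i - 1/2 \<in> \<int>" "\<forall>i<8. coord y i - 1/2 \<in> \<int>"
      using assms unfolding lattice_E8_def by blast
    then show ?thesis
    proof cases
      case 1
      then show ?thesis by (intro Ints_sum Ints_mult) auto
    next
      case 3
      then show ?thesis using mixed[of y x] s by (simp add: mult.commute)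
    qed (use mixed halves s in auto)
  qed
  ultimately show ?thesis by simp
qed

lemma half_values:
  fixes a :: real
  assumes "a \<in> {-1/2, 1/2}"
  shows "a - 1/2 \<in> \<int>" "a * a = 1/4" "2 * a \<in> \<int>" "a \<noteq> 0"
proof -
  have a: "a = -1/2 \<or> a = 1/2" using assms by blast
  show "a - 1/2 \<in> \<int>" using a by (elim disjE; hypsubst; simp)
  show "a * a = 1/4" using a by (elim disjE; hypsubst; simp)
  show "2 * a \<in> \<int>" using a by (elim disjE; hypsubst; simp)
  show "a \<noteq> 0" using a by (elim disjE; hypsubst; simp)
qed

text \<open>This turns the parity of the number of minus signs into the condition on the coordinate
  sum in the lattice.\<close>

lemma half_sum:
  assumes "\<forall>i<8. coord x i \<in> {-1/2, 1/2}"
  shows "(\<Sum>i<8. coord x i) = 4 - real (card {i. i < 8 \<and> coord x i < 0})"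
proof -
  have "(\<Sum>i<8. coord x i) = (\<Sum>i<8. 1/2 - (if coord x i < 0 then 1 else 0))"
    by (intro sum.cong) (use assms in auto)
  also have "\<dots> = 4 - (\<Sum>i<8. if coord x i < 0 then 1 else 0)" by (simp add: sum_subtractf)
  also have "(\<Sum>i<8. if coord x i < 0 then 1 else 0 :: real) = real (card {i. i < 8 \<and> coord x i < 0})"
    by (simp add: sum.If_cases Int_def)
  finally show ?thesis .
qed

lemma even_half_Ints: "even n \<longleftrightarrow> (4 - real n) / 2 \<in> \<int>"
proof
  assume "even n"
  then obtain m where "n = 2 * m" by blast
  then have "(4 - real n) / 2 = 2 - of_nat m" by simp
  then show "(4 - real n) / 2 \<in> \<int>" by (metis Ints_diff Ints_numeral Ints_of_nat)
next
  assume "(4 - real n) / 2 \<in> \<int>"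
  then obtain k where "(4 - real n) / 2 = of_int k" by (auto elim: Ints_cases)
  then have "real_of_int (int n) = of_int (4 - 2 * k)" by simp
  then have "int n = 4 - 2 * k" by (simp only: of_int_eq_iff)
  then show "even n" by presburger
qed

text \<open>An integral vector of norm 2 has exactly two nonzero coordinates, each 1 or -1. In the
  half-integral case all eight squares are at least 1/4 and add up to 2, so each equals 1/4.\<close>

lemma root_E8_lattice: "root_E8 = {x \<in> lattice_E8. x \<bullet> x = 2}"
proof (intro set_eqI iffI)
  fix x assume "x \<in> root_E8"
  then consider "x \<in> root_D 8"
    | "\<forall>i<8. coord x i \<in> {-1/2, 1/2}" "\<forall>i\<ge>8. coord x i = 0" "even (card {i. coord x i < 0})"
    unfolding root_E8_def by blast
  then show "x \<in> {x \<in> lattice_E8. x \<bullet> x = 2}"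
  proof cases
    case 1
    then obtain s t i j where x: "x = s *\<^sub>R basis_vec i + t *\<^sub>R basis_vec j"
      and st: "s \<in> {-1, 1}" "t \<in> {-1, 1}" and ij: "i < j" "j < 8" unfolding root_D_def by blast
    have "(\<Sum>k<8. coord x k) = s + t"
      using ij by (simp add: x sum.distrib sum_distrib_left[symmetric])
    moreover have "(s + t) / 2 \<in> \<int>" using st by auto
    moreover have "coord x k \<in> \<int>" for k using st by (auto simp: x)
    moreover have "coord x k = 0" if "k \<ge> 8" for k using that ij by (simp add: x)
    ultimately have "x \<in> lattice_E8" by (simp add: lattice_E8_def)
    moreover have "x \<bullet> x = 2"
      using st ij by (auto simp: x inner_add_left inner_add_right inner_basis_basis)
    ultimately show ?thesis by simp
  next
    case 2
    have "{i. coord x i < 0} = {i. i < 8 \<and> coord x i < 0}"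
      using 2(2) by (metis less_irrefl linorder_not_le)
    then have "(\<Sum>i<8. coord x i) / 2 \<in> \<int>"
      unfolding half_sum[OF 2(1)] using 2(3) even_half_Ints by simp
    moreover have "coord x i - 1/2 \<in> \<int>" if "i < 8" for i
      using 2(1) that half_values(1) by blast
    ultimately have "x \<in> lattice_E8" using 2(2) by (simp add: lattice_E8_def)
    moreover have "x \<bullet> x = (\<Sum>i<(8::nat). 1/4)"
      unfolding inner_lessThan_8[OF 2(2)]
    proof (intro sum.cong refl)
      fix i :: nat assume "i \<in> {..<8}"
      then show "coord x i * coord x i = 1/4" using 2(1) half_values(2) by blast
    qed
    ultimately show ?thesis by simp
  qed
next
  fix x assume "x \<in> {x \<in> lattice_E8. x \<bullet> x = 2}"
  then have x: "x \<in> lattice_E8" "x \<bullet> x = 2" by auto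
  have 0: "\<forall>i\<ge>8. coord x i = 0" using x by (simp add: lattice_E8_def)
  have n: "(\<Sum>i<8. coord x i * coord x i) = 2" using x(2) inner_lessThan_8[OF 0] by simp
  from x(1) consider "\<forall>i<8. coord x i \<in> \<int>" | "\<forall>i<8. coord x i - 1/2 \<in> \<int>"
    unfolding lattice_E8_def by blast
  then show "x \<in> root_E8"
  proof cases
    case 1
    have val: "coord x i \<in> {-1, 0, 1}" if i: "i < 8" for i
    proof -
      obtain k where k: "coord x i = of_int k" using 1 i by (auto elim: Ints_cases)
      have "coord x i * coord x i \<le> (\<Sum>i<8. coord x i * coord x i)"
        by (rule member_le_sum) (use i in auto)
      then have "real_of_int (k * k) \<le> 2" using n k by simp
      then have "k \<in> {-1, 0, 1}" by (intro square_less_4) linarith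
      then show ?thesis using k by auto
    qed
    let ?S = "{i. i < 8 \<and> coord x i \<noteq> 0}"
    have "(\<Sum>i<8. coord x i * coord x i) = (\<Sum>i<(8::nat). if coord x i \<noteq> 0 then 1 else 0)"
      by (intro sum.cong) (use val in fastforce)+
    also have "\<dots> = real (card ?S)" by (simp add: sum.If_cases Int_def)
    finally have "card ?S = 2" using n by simp
    then obtain i' j' where "?S = {i', j'}" "i' \<noteq> j'" unfolding card_2_iff by blast
    then have "?S = {min i' j', max i' j'}" "min i' j' < max i' j'" by (auto simp: min_def max_def)
    then obtain i j where ij: "?S = {i, j}" "i < j" by blast
    then have m: "i < 8" "j < 8" "coord x i \<noteq> 0" "coord x j \<noteq> 0" by blast+
    have z: "coord x k = 0" if "k \<noteq> i" "k \<noteq> j" for k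
    proof (cases "k < 8")
      case True
      then show ?thesis using ij(1) that by blast
    qed (use 0 in simp)
    have "x = coord x i *\<^sub>R basis_vec i + coord x j *\<^sub>R basis_vec j"
      by (rule fsvec_eqI) (use z ij(2) in auto)
    moreover have "coord x i \<in> {-1, 1}" "coord x j \<in> {-1, 1}" using val m by blast+
    ultimately have "x \<in> root_D 8" using ij(2) m unfolding root_D_def by blast
    then show ?thesis by (simp add: root_E8_def)
  next
    case 2
    have sq: "coord x i * coord x i \<ge> 1/4" if i: "i < 8" for i
    proof -
      obtain k where "coord x i - 1/2 = of_int k" using 2 i by (auto elim: Ints_cases)
      then have k: "coord x i = of_int k + 1/2" by simp
      have "k * (k + 1) \<ge> 0" by (cases "k \<ge> 0") (auto simp: zero_le_mult_iff)
      then have "real_of_int (k * (k + 1)) \<ge> 0" by (simp only: of_int_0_le_iff)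
      then show ?thesis by (simp add: k algebra_simps)
    qed
    have "(\<Sum>i<8. coord x i * coord x i - 1/4) = 0" using n by (simp add: sum_subtractf)
    then have "\<forall>i\<in>{..<8}. coord x i * coord x i - 1/4 = 0"
      by (subst (asm) sum_nonneg_eq_0_iff) (use sq in auto)
    then have h: "\<forall>i<8. coord x i \<in> {-1/2, 1/2}"
    proof (intro allI impI)
      fix i :: nat assume *: "\<forall>i\<in>{..<8}. coord x i * coord x i - 1/4 = 0" and "i < 8"
      then have "(coord x i - 1/2) * (coord x i + 1/2) = 0" by (simp add: algebra_simps)
      then show "coord x i \<in> {-1/2, 1/2}" by auto
    qed
    have "{i. coord x i < 0} = {i. i < 8 \<and> coord x i < 0}"
      using 0 by (metis less_irrefl linorder_not_le)
    moreover have "(4 - real (card {i. i < 8 \<and> coord x i < 0})) / 2 \<in> \<int>"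
      using x(1) half_sum[OF h] by (simp add: lattice_E8_def)
    ultimately have "even (card {i. coord x i < 0})" using even_half_Ints by simp
    then show ?thesis using h 0 by (simp add: root_E8_def)
  qed
qed

lemma root_E8_cases:
  assumes "x \<in> root_E8"
  obtains s t i j where "x = s *\<^sub>R basis_vec i + t *\<^sub>R basis_vec j" "s \<in> {-1, 1}" "t \<in> {-1, 1}" "i < j" "j < 8"
  | "\<And>i. i < 8 \<Longrightarrow> coord x i \<in> {-1/2, 1/2}"
  using assms unfolding root_E8_def root_D_def by blast

lemma finite_root_E8: "finite root_E8"
proof -
  let ?F = "\<lambda>x. \<lambda>i\<in>{..<8}. coord x i"
  have c: "coord x i \<in> {-1, -1/2, 0, 1/2, 1}" if "x \<in> root_E8" "i < 8" for x i
    using that(1)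
  proof (cases rule: root_E8_cases)
    case (1 s t k l)
    then show ?thesis by auto
  next
    case 2
    then show ?thesis using that(2) by blast
  qed
  have z: "coord x i = 0" if "x \<in> root_E8" "i \<ge> 8" for x i
    using that by (auto simp: root_E8_lattice lattice_E8_def)
  have "?F ` root_E8 \<subseteq> (\<Pi>\<^sub>E i\<in>{..<8}. {-1, -1/2, 0, 1/2, 1})"
    by (intro image_subsetI) (simp only: restrict_PiE_iff, use c in blast)
  moreover have "inj_on ?F root_E8"
  proof (rule inj_onI)
    fix x y assume xy: "x \<in> root_E8" "y \<in> root_E8" "?F x = ?F y"
    show "x = y"
    proof (rule fsvec_eqI)
      show "coord x i = coord y i" for i
        using fun_cong[OF xy(3), of i] z xy(1,2) by (cases "i < 8") auto
    qed
  qed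
  ultimately show ?thesis
    by (meson finite.emptyI finite.insertI finite_PiE finite_lessThan finite_subset inj_on_finite)
qed

text \<open>The linear condition cuts out a sublattice of the E8 lattice. The models of E6, D5 and
  A4 then need no separate check, being successive parts of degree 0.\<close>

lemma slrs_root_E7: "slrs root_E7"
proof (rule slrs_lattice)
  show "finite root_E7" using finite_root_E8 by (auto simp: root_E7_def intro: finite_subset)
  show "root_E7 = {x \<in> {x \<in> lattice_E8. coord x 6 = - coord x 7}. x \<bullet> x = 2}"
    by (auto simp: root_E7_def root_E8_lattice)
qed (auto simp: lattice_E8_diff lattice_E8_inner)

subsection \<open>The frame of the coordinate model\<close>

definition std_frame :: "nat \<Rightarrow> fsvec" where
  "std_frame i =
    [basis_vec 7 - basis_vec 6,
     (1/2) *\<^sub>R (basis_vec 0 + basis_vec 1 + basis_vec 2 + basis_vec 3 + basis_vec 4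
       - basis_vec 5 - basis_vec 6 + basis_vec 7),
     basis_vec 0 + basis_vec 1, basis_vec 1 - basis_vec 2, basis_vec 1 - basis_vec 0,
     basis_vec 3 - basis_vec 2, basis_vec 4 - basis_vec 2] ! i"

text \<open>On E7 the first one is \<open>x_5 - x_6\<close>, which vanishes exactly on E6; on E6 the
  second is \<open>- 2 * x_5\<close>, which vanishes exactly on D5. The third is the half-spin
  weight of D5, and the fourth separates the indices 0, 1 from 2, 3, 4.\<close>

definition std_weight :: "nat \<Rightarrow> fsvec" where
  "std_weight j =
    [basis_vec 5 - (1/2) *\<^sub>R basis_vec 6 + (1/2) *\<^sub>R basis_vec 7,
     - (2/3) *\<^sub>R (basis_vec 5 + basis_vec 6 - basis_vec 7),
     (1/2) *\<^sub>R (basis_vec 0 + basis_vec 1 + basis_vec 2 + basis_vec 3 + basis_vec 4),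
     (3/5) *\<^sub>R (basis_vec 0 + basis_vec 1) - (2/5) *\<^sub>R (basis_vec 2 + basis_vec 3 + basis_vec 4)] ! j"

lemma std_frame_simps:
  "std_frame 0 = basis_vec 7 - basis_vec 6"
  "std_frame (Suc 0) = (1/2) *\<^sub>R (basis_vec 0 + basis_vec 1 + basis_vec 2 + basis_vec 3 + basis_vec 4
       - basis_vec 5 - basis_vec 6 + basis_vec 7)"
  "std_frame 2 = basis_vec 0 + basis_vec 1" "std_frame 3 = basis_vec 1 - basis_vec 2"
  "std_frame 4 = basis_vec 1 - basis_vec 0" "std_frame 5 = basis_vec 3 - basis_vec 2"
  "std_frame 6 = basis_vec 4 - basis_vec 2"
  by (simp_all add: std_frame_def)

lemma std_weight_inner:
  "std_weight 0 \<bullet> x = coord x 5 - coord x 6 / 2 + coord x 7 / 2"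
  "std_weight (Suc 0) \<bullet> x = - (2/3) * (coord x 5 + coord x 6 - coord x 7)"
  "std_weight 2 \<bullet> x = (coord x 0 + coord x 1 + coord x 2 + coord x 3 + coord x 4) / 2"
  "std_weight 3 \<bullet> x = (3/5) * (coord x 0 + coord x 1) - (2/5) * (coord x 2 + coord x 3 + coord x 4)"
  by (simp_all add: std_weight_def inner_add_left inner_diff_left basis_vec_inner algebra_simps)

lemma gram_std_frame: "gram std_frame"
  unfolding gram_def
proof (intro allI impI)
  fix i j :: nat assume "i < 7" "j < 7"
  then show "std_frame i \<bullet> std_frame j =
     (if i = j then 2
      else if (i, j) \<in> {(0, 1), (1, 2), (2, 3), (3, 4), (3, 5), (3, 6), (5, 6)} \<or>
        (j, i) \<in> {(0, 1), (1, 2), (2, 3), (3, 4), (3, 5), (3, 6), (5, 6)} then 1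
      else 0)"
    unfolding nat_less_7
    by (elim insertE emptyE) (simp_all add: std_frame_simps inner_add_left inner_diff_left basis_vec_inner)
qed

lemma layer_root_E7: "layer root_E7 (std_weight 0) 0 = root_E6"
  by (auto simp: layer_def root_E7_def root_E6_def std_weight_inner)

lemma root_D_mono: "m \<le> n \<Longrightarrow> root_D m \<subseteq> root_D n"
  unfolding root_D_def by fastforce

lemma root_D_coord: "x \<in> root_D n \<Longrightarrow> i \<ge> n \<Longrightarrow> coord x i = 0"
  by (auto simp: root_D_def)

lemma root_D_I: "i < n \<Longrightarrow> j < n \<Longrightarrow> i \<noteq> j \<Longrightarrow> s \<in> {-1, 1} \<Longrightarrow> t \<in> {-1, 1} \<Longrightarrow>
    s *\<^sub>R basis_vec i + t *\<^sub>R basis_vec j \<in> root_D n"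
proof (cases "i < j")
  assume "i < n" "j < n" "i \<noteq> j" "s \<in> {-1, 1}" "t \<in> {-1, 1}" "\<not> i < j"
  then have "j < i" "s *\<^sub>R basis_vec i + t *\<^sub>R basis_vec j = t *\<^sub>R basis_vec j + s *\<^sub>R basis_vec i"
    by (simp_all add: add.commute)
  then show ?thesis using \<open>i < n\<close> \<open>s \<in> _\<close> \<open>t \<in> _\<close> unfolding root_D_def by blast
qed (auto simp: root_D_def)

lemma layer_root_E6: "layer root_E6 (std_weight (Suc 0)) 0 = root_D 5"
proof (intro set_eqI iffI)
  fix x assume "x \<in> layer root_E6 (std_weight (Suc 0)) 0"
  then have x: "x \<in> root_E8" "coord x 5 = 0" "coord x 6 = 0" "coord x 7 = 0"
    by (auto simp: layer_def root_E6_def std_weight_inner)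
  from x(1) show "x \<in> root_D 5"
  proof (cases rule: root_E8_cases)
    case (1 s t i j)
    have "coord x j \<noteq> 0" using 1 by auto
    then have "j \<noteq> 5" "j \<noteq> 6" "j \<noteq> 7" using x by metis+
    then have "j < 5" using 1(5) by linarith
    then show ?thesis using 1 unfolding root_D_def by blast
  next
    case 2
    then show ?thesis using 2[of 5] x by simp
  qed
next
  fix x assume x: "x \<in> root_D 5"
  then have "x \<in> root_E8" using root_D_mono[of 5 8] by (auto simp: root_E8_def)
  then show "x \<in> layer root_E6 (std_weight (Suc 0)) 0"
    using root_D_coord[OF x] by (simp add: layer_def root_E6_def std_weight_inner)
qed

lemma root_A_I: "i \<le> n \<Longrightarrow> j \<le> n \<Longrightarrow> i \<noteq> j \<Longrightarrow> basis_vec i - basis_vec j \<in> root_A n"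
  unfolding root_A_def by blast

lemma root_A_E:
  assumes "x \<in> root_A n"
  obtains i j where "x = basis_vec i - basis_vec j" "i \<le> n" "j \<le> n" "i \<noteq> j"
  using assms unfolding root_A_def by blast

lemma root_A_root_D: "root_A 4 \<subseteq> root_D 5"
proof
  fix x assume "x \<in> root_A 4"
  then obtain i j where "x = basis_vec i - basis_vec j" "i \<le> 4" "j \<le> 4" "i \<noteq> j" by (auto simp: root_A_def)
  then show "x \<in> root_D 5" using root_D_I[of i 5 j 1 "-1"] by simp
qed

lemma less_5: "i < 5 \<longleftrightarrow> i \<in> {0, 1, 2, 3, 4 :: nat}"
  by auto

lemma std_weight_2_basis: "i < 5 \<Longrightarrow> std_weight 2 \<bullet> basis_vec i = 1/2"
  unfolding less_5 by (auto simp: std_weight_inner)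

lemma layer_root_D: "layer (root_D 5) (std_weight 2) 0 = root_A 4"
proof (intro set_eqI iffI)
  fix x assume "x \<in> layer (root_D 5) (std_weight 2) 0"
  then obtain s t i j where x: "x = s *\<^sub>R basis_vec i + t *\<^sub>R basis_vec j" "s \<in> {-1, 1}" "t \<in> {-1, 1}" "i < j" "j < 5"
    and "std_weight 2 \<bullet> x = 0" by (auto simp: layer_def root_D_def)
  then have "t = - s" by (simp add: inner_add_right std_weight_2_basis)
  then have "x = basis_vec i - basis_vec j \<or> x = basis_vec j - basis_vec i" using x by auto
  then show "x \<in> root_A 4" using x(4,5) unfolding root_A_def by fastforce
next
  fix x assume x: "x \<in> root_A 4"
  then obtain i j where "x = basis_vec i - basis_vec j" "i \<le> 4" "j \<le> 4" by (auto simp: root_A_def)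
  then have "std_weight 2 \<bullet> x = 0" by (simp add: inner_diff_right std_weight_2_basis)
  then show "x \<in> layer (root_D 5) (std_weight 2) 0" using x root_A_root_D by (auto simp: layer_def)
qed

section \<open>Irreducibility of the coordinate models\<close>

text \<open>A root orthogonal to \<open>e_0 - e_1\<close> avoids the indices 0 and 1, and
  \<open>e_0 - e_i\<close> with \<open>i\<close> one of its indices links the two.\<close>

lemma irreducible_root_A: "irreducible_system (root_A 4)"
proof -
  let ?a = "basis_vec 0 - basis_vec 1"
  have a: "?a \<in> root_A 4" unfolding root_A_def by force
  have one: "Y = {}" if XY: "root_A 4 = X \<union> Y" "\<forall>x\<in>X. \<forall>y\<in>Y. x \<bullet> y = 0" and aX: "?a \<in> X" for X Y
  proof (rule ccontr)
    assume "Y \<noteq> {}"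
    then obtain y where y: "y \<in> Y" by blast
    then have "y \<in> root_A 4" using XY(1) by blast
    then obtain i j where ij: "y = basis_vec i - basis_vec j" "i \<le> 4" "j \<le> 4" "i \<noteq> j"
      by (rule root_A_E)
    have "?a \<bullet> y = 0" using XY(2) aX y by blast
    then have i: "i \<noteq> 0" "i \<noteq> 1" "j \<noteq> 0" "j \<noteq> 1"
      using ij by (auto simp: inner_diff_left basis_vec_inner split: if_splits)
    let ?c = "basis_vec 0 - basis_vec i"
    have "?c \<in> root_A 4" using ij i unfolding root_A_def by force
    moreover have "?a \<bullet> ?c = 1" using i by (simp add: inner_diff_left basis_vec_inner)
    ultimately have "?c \<in> X" using XY aX by fastforce
    then have "?c \<bullet> y = 0" using XY(2) y by blast
    then show False using ij i by (simp add: inner_diff_left basis_vec_inner)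
  qed
  show ?thesis
    unfolding irreducible_system_def
  proof (intro conjI notI)
    assume "root_A 4 = {}" then show False using a by auto
  next
    assume "\<exists>X Y. X \<noteq> {} \<and> Y \<noteq> {} \<and> root_A 4 = X \<union> Y \<and> (\<forall>x\<in>X. \<forall>y\<in>Y. x \<bullet> y = 0)"
    then obtain X Y where XY: "X \<noteq> {}" "Y \<noteq> {}" "root_A 4 = X \<union> Y" "\<forall>x\<in>X. \<forall>y\<in>Y. x \<bullet> y = 0"
      by blast
    have "root_A 4 = Y \<union> X" "\<forall>x\<in>Y. \<forall>y\<in>X. x \<bullet> y = 0" using XY by (blast, metis inner_commute)
    then show False using one[OF XY(3,4)] one[of Y X] XY(1-3) a by blast
  qed
qed

text \<open>The products with \<open>e_i + e_k\<close> and \<open>e_i - e_k\<close> are the sum and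
  difference of two coordinates, and cannot both vanish if the first coordinate does not.\<close>

lemma root_D_nonorth:
  assumes "i < 5" "coord x i \<noteq> 0"
  shows "\<exists>\<alpha>\<in>root_D 5. \<alpha> \<bullet> x \<noteq> 0"
proof -
  obtain k :: nat where k: "k < 5" "k \<noteq> i" using assms(1) by (metis one_less_numeral_iff semiring_norm(77) zero_less_numeral zero_neq_one)
  have m: "1 *\<^sub>R basis_vec i + 1 *\<^sub>R basis_vec k \<in> root_D 5" "1 *\<^sub>R basis_vec i + (-1) *\<^sub>R basis_vec k \<in> root_D 5"
    by (intro root_D_I; use assms k in simp)+
  have "(1 *\<^sub>R basis_vec i + 1 *\<^sub>R basis_vec k) \<bullet> x = coord x i + coord x k"
    "(1 *\<^sub>R basis_vec i + (-1) *\<^sub>R basis_vec k) \<bullet> x = coord x i - coord x k"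
    by (simp_all add: inner_add_left inner_diff_left basis_vec_inner)
  then have "(1 *\<^sub>R basis_vec i + 1 *\<^sub>R basis_vec k) \<bullet> x \<noteq> 0 \<or> (1 *\<^sub>R basis_vec i + (-1) *\<^sub>R basis_vec k) \<bullet> x \<noteq> 0"
    using assms(2) by linarith
  then show ?thesis using m by blast
qed

lemma irreducible_root_D: "irreducible_system (root_D 5)"
proof (rule irreducible_grow[OF irreducible_root_A root_A_root_D])
  fix x assume x: "x \<in> root_D 5" "x \<notin> root_A 4"
  then obtain s t i j where ij: "x = s *\<^sub>R basis_vec i + t *\<^sub>R basis_vec j" "s \<in> {-1, 1}" "t \<in> {-1, 1}" "i < j" "j < 5"
    by (auto simp: root_D_def)
  obtain k :: nat where k: "k < 5" "k \<noteq> i" "k \<noteq> j"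
  proof -
    have "card {i, j} < card {..<5 :: nat}" using ij(4) by simp
    then have "\<not> {..<5} \<subseteq> {i, j}" using card_mono[of "{i, j}" "{..<5 :: nat}"] by fastforce
    then show ?thesis using that by blast
  qed
  have "basis_vec i - basis_vec k \<in> root_A 4"
    unfolding root_A_def using ij k by force
  moreover have "(basis_vec i - basis_vec k) \<bullet> x = s" using ij k by (simp add: inner_diff_left basis_vec_inner)
  ultimately show "\<exists>\<alpha>\<in>root_A 4. \<alpha> \<bullet> x \<noteq> 0" using ij(2) by force
qed

lemma root_D_root_E6: "root_D 5 \<subseteq> root_E6"
  unfolding layer_root_E6[symmetric] by (auto simp: layer_def)

lemma irreducible_root_E6: "irreducible_system root_E6"
proof (rule irreducible_grow[OF irreducible_root_D root_D_root_E6])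
  fix x assume x: "x \<in> root_E6" "x \<notin> root_D 5"
  then have x8: "x \<in> root_E8" and e: "coord x 5 = coord x 6" "coord x 6 = - coord x 7" by (auto simp: root_E6_def)
  from x8 show "\<exists>\<alpha>\<in>root_D 5. \<alpha> \<bullet> x \<noteq> 0"
  proof (cases rule: root_E8_cases)
    case (1 s t i j)
    have "i < 5"
    proof (rule ccontr)
      assume "\<not> i < 5"
      then have "(i, j) \<in> {(5, 6), (5, 7), (6, 7)}" using 1(4,5) by auto
      then show False using e 1(1-3) by auto
    qed
    moreover have "coord x i \<noteq> 0" using 1 by auto
    ultimately show ?thesis by (rule root_D_nonorth)
  next
    case 2
    show ?thesis by (rule root_D_nonorth[of 0]) (use 2[of 0] in auto)
  qed
qed

lemma root_E6_root_E7: "root_E6 \<subseteq> root_E7"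
  by (auto simp: root_E6_def root_E7_def)

lemma std_frame_1_root_E6: "std_frame (Suc 0) \<in> root_E6"
proof -
  let ?x = "std_frame (Suc 0)"
  have c: "coord ?x i = (if i < 5 \<or> i = 7 then 1/2 else if i < 8 then -1/2 else 0)" for i
  proof -
    consider "i \<in> {0, 1, 2, 3, 4, 5, 6, 7}" | "i \<ge> 8" by force
    then show ?thesis by cases (auto simp: std_frame_simps)
  qed
  have "{i. coord ?x i < 0} = {5, 6}" by (auto simp: c)
  then have "even (card {i. coord ?x i < 0})" by simp
  then show ?thesis by (simp add: root_E6_def root_E8_def c)
qed

text \<open>Roots with a nonzero coordinate among the first five are seen by D5. The multiples of
  \<open>e_6 - e_7\<close> are orthogonal to D5 and are instead seen by the half-integral root
  \<open>std_frame 1\<close> of E6.\<close>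

lemma irreducible_root_E7: "irreducible_system root_E7"
proof (rule irreducible_grow[OF irreducible_root_E6 root_E6_root_E7])
  fix x assume x: "x \<in> root_E7" "x \<notin> root_E6"
  then have x8: "x \<in> root_E8" and e: "coord x 6 = - coord x 7" by (auto simp: root_E7_def)
  from x8 show "\<exists>\<alpha>\<in>root_E6. \<alpha> \<bullet> x \<noteq> 0"
  proof (cases rule: root_E8_cases)
    case (1 s t i j)
    show ?thesis
    proof (cases "i < 5")
      case True
      moreover have "coord x i \<noteq> 0" using 1 by auto
      ultimately show ?thesis using root_D_nonorth[of i x] root_D_root_E6 by blast
    next
      case False
      then have "(i, j) \<in> {(5, 6), (5, 7), (6, 7)}" using 1(4,5) by auto
      moreover have "std_frame (Suc 0) \<bullet> x = (coord x 0 + coord x 1 + coord x 2 + coord x 3 + coord x 4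
          - coord x 5 - coord x 6 + coord x 7) / 2"
        by (simp add: std_frame_simps inner_add_left inner_diff_left basis_vec_inner)
      ultimately have "std_frame (Suc 0) \<bullet> x \<noteq> 0" using e 1(2,3) unfolding 1(1) by auto
      then show ?thesis using std_frame_1_root_E6 by blast
    qed
  next
    case 2
    have "coord x 0 \<noteq> 0" using half_values(4)[OF 2[of 0]] by simp
    then show ?thesis using root_D_nonorth[of 0 x] root_D_root_E6 by force
  qed
qed

text \<open>By the Cauchy-Schwarz inequality, an integral weight of norm less than 2 is minuscule.\<close>

lemma gradedI:
  assumes "slrs \<Phi>" "irreducible_system \<Phi>" "q \<bullet> q < 2" "\<And>\<alpha>. \<alpha> \<in> \<Phi> \<Longrightarrow> q \<bullet> \<alpha> \<in> \<int>" "\<alpha> \<in> \<Phi>" "q \<bullet> \<alpha> \<noteq> 0"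
  shows "graded \<Phi> q"
proof -
  have "q \<bullet> x \<in> {-1, 0, 1}" if x: "x \<in> \<Phi>" for x
  proof -
    obtain k where k: "q \<bullet> x = of_int k" using assms(4)[OF x] by (auto elim: Ints_cases)
    have "(q \<bullet> x)\<^sup>2 \<le> (q \<bullet> q) * (x \<bullet> x)" by (rule Cauchy_Schwarz_ineq)
    then have "real_of_int (k * k) < 4"
      using root_norm[OF assms(1) x] assms(3) k by (simp add: power2_eq_square)
    then have "k \<in> {-1, 0, 1}" by (intro square_less_4) linarith
    then show ?thesis using k by auto
  qed
  then show ?thesis using assms by (auto simp: graded_def)
qed

lemma std_weight_norm: "j < 4 \<Longrightarrow> std_weight j \<bullet> std_weight j < 2"
  unfolding nat_less_4
  by (auto simp: std_weight_inner) (simp_all add: std_weight_def)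

definition std_part :: "nat \<Rightarrow> fsvec set" where
  "std_part j = [root_E7, root_E6, root_D 5, root_A 4, layer (root_A 4) (std_weight 3) 0] ! j"

lemma std_part_simps:
  "std_part 0 = root_E7" "std_part (Suc 0) = root_E6" "std_part 2 = root_D 5" "std_part 3 = root_A 4"
  "std_part 4 = layer (root_A 4) (std_weight 3) 0"
  by (simp_all add: std_part_def)

lemma std_frame_part:
  "std_frame 0 \<in> root_E7" "std_frame 2 \<in> root_D 5" "std_frame 3 \<in> root_A 4"
  "std_frame 4 \<in> root_A 4" "std_frame 5 \<in> root_A 4" "std_frame 6 \<in> root_A 4"
proof -
  have "(-1) *\<^sub>R basis_vec 6 + 1 *\<^sub>R basis_vec 7 \<in> root_D 8" by (rule root_D_I) auto
  then show "std_frame 0 \<in> root_E7" by (simp add: std_frame_simps root_E7_def root_E8_def)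
  have "1 *\<^sub>R basis_vec 0 + 1 *\<^sub>R basis_vec 1 \<in> root_D 5" by (rule root_D_I) auto
  then show "std_frame 2 \<in> root_D 5" by (simp add: std_frame_simps)
  show "std_frame 3 \<in> root_A 4" "std_frame 4 \<in> root_A 4" "std_frame 5 \<in> root_A 4" "std_frame 6 \<in> root_A 4"
    unfolding std_frame_simps by (intro root_A_I; simp)+
qed

lemma std_weight_frame:
  assumes "j < 4" "j \<le> i" "i < 7"
  shows "std_weight j \<bullet> std_frame i = (if i = j then 1 else 0)"
  using assms unfolding nat_less_4 nat_less_7
  by (elim insertE emptyE) (simp_all add: std_weight_inner std_frame_simps)

lemma root_A_or_E:
  assumes "x \<in> root_A 1 \<union> {basis_vec i - basis_vec j | i j. i \<in> {2, 3, 4} \<and> j \<in> {2, 3, 4} \<and> i \<noteq> j}"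
  obtains i j where "x = basis_vec i - basis_vec j" "i \<noteq> j"
    "(i \<in> {0, 1} \<and> j \<in> {0, 1}) \<or> (i \<in> {2, 3, 4} \<and> j \<in> {2, 3, 4 :: nat})"
  using assms
proof
  assume "x \<in> root_A 1"
  then obtain i j where ij: "x = basis_vec i - basis_vec j" "i \<le> 1" "j \<le> 1" "i \<noteq> j" by (rule root_A_E)
  then have "i \<in> {0, 1}" "j \<in> {0, 1}" by auto
  then show ?thesis using that ij by blast
qed (use that in blast)

lemma root_A_factors:
  "layer (root_A 4) (std_weight 3) 0 =
    root_A 1 \<union> {basis_vec i - basis_vec j | i j. i \<in> {2, 3, 4} \<and> j \<in> {2, 3, 4} \<and> i \<noteq> j}"
  (is "_ = _ \<union> ?Y")
proof (intro set_eqI iffI)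
  fix x assume "x \<in> layer (root_A 4) (std_weight 3) 0"
  then obtain i j where ij: "x = basis_vec i - basis_vec j" "i \<le> 4" "j \<le> 4" "i \<noteq> j" "std_weight 3 \<bullet> x = 0"
    by (auto simp: layer_def root_A_def)
  have w: "std_weight 3 \<bullet> basis_vec k = (if k \<le> 1 then 3/5 else -2/5)" if "k \<le> 4" for k
  proof -
    have "k \<in> {0, 1, 2, 3, 4}" using that by auto
    then show ?thesis by (auto simp: std_weight_inner)
  qed
  have "i \<le> 1 \<longleftrightarrow> j \<le> 1" using ij w[of i] w[of j] by (auto simp: inner_diff_right split: if_splits)
  then consider "i \<le> 1" "j \<le> 1" | "i \<in> {2, 3, 4}" "j \<in> {2, 3, 4}" using ij by force
  then show "x \<in> root_A 1 \<union> ?Y" using ij(1,4) unfolding root_A_def by cases blast+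
next
  fix x assume "x \<in> root_A 1 \<union> ?Y"
  then obtain i j where ij: "x = basis_vec i - basis_vec j" "i \<noteq> j"
    "(i \<in> {0, 1} \<and> j \<in> {0, 1}) \<or> (i \<in> {2, 3, 4} \<and> j \<in> {2, 3, 4})"
    by (rule root_A_or_E)
  then have "std_weight 3 \<bullet> x = 0" by (elim disjE) (auto simp: std_weight_inner)
  moreover have "x \<in> root_A 4" using ij unfolding root_A_def by force
  ultimately show "x \<in> layer (root_A 4) (std_weight 3) 0" by (simp add: layer_def)
qed

lemma factor_E:
  assumes "x \<in> layer (root_A 4) (std_weight 3) 0"
  obtains i j where "x = basis_vec i - basis_vec j" "i \<noteq> j"
    "(i \<in> {0, 1} \<and> j \<in> {0, 1}) \<or> (i \<in> {2, 3, 4} \<and> j \<in> {2, 3, 4 :: nat})"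
  using assms unfolding root_A_factors by (rule root_A_or_E)

lemma std_frame:
  "frame root_E7 std_frame" "\<And>j. j \<le> 4 \<Longrightarrow> part root_E7 std_frame j = std_part j"
proof -
  have sl6: "slrs root_E6" using slrs_layer_0[OF slrs_root_E7] layer_root_E7 by metis
  have sl5: "slrs (root_D 5)" using slrs_layer_0[OF sl6] layer_root_E6 by metis
  have sl4: "slrs (root_A 4)" using slrs_layer_0[OF sl5] layer_root_D by metis
  have wf: "std_weight j \<bullet> std_frame j \<noteq> 0" if "j < 4" for j using std_weight_frame[of j j] that by simp
  have lat: "x \<in> lattice_E8" if "x \<in> root_E8" for x using that by (simp add: root_E8_lattice)
  have int2: "2 * coord x i \<in> \<int>" if "x \<in> root_E8" "i < 8" for x i
    using that(1)
  proof (cases rule: root_E8_cases)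
    case 2
    then show ?thesis using that(2) half_values(3) by blast
  qed auto
  have int56: "coord x 5 - coord x 6 \<in> \<int>" if "x \<in> root_E8" for x
    using that
  proof (cases rule: root_E8_cases)
    case 2
    have "(coord x 5 - 1/2) - (coord x 6 - 1/2) \<in> \<int>"
      by (intro Ints_diff half_values(1) 2) simp_all
    then show ?thesis by simp
  qed auto
  have g0: "graded root_E7 (std_weight 0)"
  proof (rule gradedI[OF slrs_root_E7 irreducible_root_E7 std_weight_norm _ std_frame_part(1) wf])
    show "std_weight 0 \<bullet> \<alpha> \<in> \<int>" if a: "\<alpha> \<in> root_E7" for \<alpha>
    proof -
      have "std_weight 0 \<bullet> \<alpha> = coord \<alpha> 5 - coord \<alpha> 6" using a by (simp add: std_weight_inner root_E7_def)
      then show ?thesis using int56[of \<alpha>] a by (simp add: root_E7_def)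
    qed
  qed simp_all
  have g1: "graded root_E6 (std_weight (Suc 0))"
  proof (rule gradedI[OF sl6 irreducible_root_E6 std_weight_norm _ std_frame_1_root_E6 wf])
    show "std_weight (Suc 0) \<bullet> \<alpha> \<in> \<int>" if a: "\<alpha> \<in> root_E6" for \<alpha>
    proof -
      have "std_weight (Suc 0) \<bullet> \<alpha> = - (2 * coord \<alpha> 5)" using a by (simp add: std_weight_inner root_E6_def)
      moreover have "- (2 * coord \<alpha> 5) \<in> \<int>" using int2[of \<alpha> 5] a by (intro Ints_minus) (simp add: root_E6_def)
      ultimately show ?thesis by simp
    qed
  qed simp_all
  have g2: "graded (root_D 5) (std_weight 2)"
  proof (rule gradedI[OF sl5 irreducible_root_D std_weight_norm _ std_frame_part(2) wf])
    show "std_weight 2 \<bullet> \<alpha> \<in> \<int>" if "\<alpha> \<in> root_D 5" for \<alpha>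
      using that by (auto simp: root_D_def inner_add_right inner_diff_right std_weight_2_basis)
  qed simp_all
  have g3: "graded (root_A 4) (std_weight 3)"
  proof (rule gradedI[OF sl4 irreducible_root_A std_weight_norm _ std_frame_part(3) wf])
    show "std_weight 3 \<bullet> \<alpha> \<in> \<int>" if a: "\<alpha> \<in> root_A 4" for \<alpha>
    proof -
      obtain i j where "\<alpha> = basis_vec i - basis_vec j" "i \<le> 4" "j \<le> 4" "i \<noteq> j"
        using a by (rule root_A_E)
      moreover from this have "i \<in> {0, 1, 2, 3, 4}" "j \<in> {0, 1, 2, 3, 4}" by auto
      ultimately show ?thesis by (elim insertE emptyE) (simp_all add: std_weight_inner)
    qed
  qed simp_all
  have S: "Suc 1 = 2" "Suc 2 = 3" "Suc 3 = 4" "Suc (Suc 0) = 2" by simp_all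
  have gr: "graded (std_part j) (std_weight j)" if "j < 4" for j
    using that g0 g1 g2 g3 unfolding nat_less_4 by (elim insertE emptyE) (simp_all add: std_part_simps)
  have layer: "layer (std_part j) (std_weight j) 0 = std_part (Suc j)" if "j < 4" for j
    using that layer_root_E7 layer_root_E6 layer_root_D unfolding nat_less_4
    by (elim insertE emptyE) (simp_all add: std_part_simps S)
  have base: "std_frame i \<in> std_part i" if "i < 4" for i
    using that std_frame_part std_frame_1_root_E6 unfolding nat_less_4
    by (elim insertE emptyE) (simp_all add: std_part_simps)
  have base4: "{std_frame 4, std_frame 5, std_frame 6} \<subseteq> std_part 4"
    using std_frame_part std_weight_frame[of 3] by (simp add: std_part_simps layer_def)
  have span4: "std_part 4 \<subseteq> zspan {std_frame 4, std_frame 5, std_frame 6}"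
  proof
    fix x assume "x \<in> std_part 4"
    then obtain i j where ij: "x = basis_vec i - basis_vec j" "i \<noteq> j"
      "(i \<in> {0, 1} \<and> j \<in> {0, 1}) \<or> (i \<in> {2, 3, 4} \<and> j \<in> {2, 3, 4})"
      unfolding std_part_simps by (rule factor_E)
    let ?Z = "zspan {std_frame 4, std_frame 5, std_frame 6}"
    have z: "std_frame 4 \<in> ?Z" "std_frame 5 \<in> ?Z" "std_frame 6 \<in> ?Z" by (auto intro: zspan_base)
    have "x \<in> {std_frame 4, - std_frame 4, std_frame 5, - std_frame 5, std_frame 6, - std_frame 6,
        std_frame 5 - std_frame 6, std_frame 6 - std_frame 5}"
      using ij by (elim disjE conjE insertE emptyE) (simp_all add: std_frame_simps)
    then show "x \<in> ?Z" using z zspan_minus zspan_diff by blast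
  qed
  have "frame (std_part 0) std_frame"
    by (rule frameI(1)[of std_frame std_part std_weight];
        (rule gram_std_frame gr layer std_weight_frame base base4 span4; assumption?))
  then show "frame root_E7 std_frame" by (simp add: std_part_simps)
  fix j :: nat assume j: "j \<le> 4"
  have "part (std_part 0) std_frame j = std_part j"
    by (rule frameI(2)[of std_frame std_part std_weight];
        (rule gram_std_frame gr layer std_weight_frame base base4 span4 j; assumption?))
  then show "part root_E7 std_frame j = std_part j" by (simp add: std_part_simps)
qed

section \<open>The last term as a product\<close>

lemma root_isomorphic_refl: "root_isomorphic \<Phi> \<Phi>"
  unfolding root_isomorphic_def root_isomorphism_iff using isometry_on_id by (intro exI[of _ "\<lambda>x. x"]) auto

text \<open>The A2 factor occupies the indices 2, 3, 4, while the standard model uses 0, 1, 2.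
  Shifting the indices is linear on the whole space and isometric on the span of the three basis
  vectors, which is all that an isomorphism of root systems requires.\<close>

lift_definition shift_2 :: "fsvec \<Rightarrow> fsvec" is "\<lambda>f i. f (i + 2)"
proof -
  fix f :: "nat \<Rightarrow> real" assume "finite {i. f i \<noteq> 0}"
  then have "finite ((\<lambda>i. i + 2) -` {i. f i \<noteq> 0})" by (rule finite_vimageI) (simp add: inj_on_def)
  then show "finite {i. f (i + 2) \<noteq> 0}" by (simp add: vimage_def)
qed

lemma product_A1_A2: "isomorphic_to_product (std_part 4) (root_A 1) (root_A 2)"
proof -
  let ?Y = "{basis_vec i - basis_vec j | i j. i \<in> {2, 3, 4} \<and> j \<in> {2, 3, 4} \<and> i \<noteq> j}"
  have lin: "linear shift_2"
    by (rule linearI) (auto intro!: fsvec_eqI simp: shift_2.rep_eq)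
  have sh: "shift_2 (basis_vec (k + 2)) = basis_vec k" for k
    by (rule fsvec_eqI) (simp add: shift_2.rep_eq)
  have sh': "shift_2 (basis_vec i) = basis_vec (i - 2)" if "i \<in> {2, 3, 4}" for i
  proof -
    have "i = (i - 2) + 2" using that by auto
    then show ?thesis using sh by metis
  qed
  have "isometry_on shift_2 (basis_vec ` {2, 3, 4})"
  proof (rule isometry_onI[OF lin])
    fix \<alpha> \<beta> assume "\<alpha> \<in> basis_vec ` {2, 3, 4}" "\<beta> \<in> basis_vec ` {2, 3, 4}"
    then obtain i j where ij: "i \<in> {2, 3, 4}" "j \<in> {2, 3, 4}" "\<alpha> = basis_vec i" "\<beta> = basis_vec j" by blast
    have "i - 2 = j - 2 \<longleftrightarrow> i = j" using ij(1,2) by auto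
    then show "shift_2 \<alpha> \<bullet> shift_2 \<beta> = \<alpha> \<bullet> \<beta>"
      unfolding ij(3,4) sh'[OF ij(1)] sh'[OF ij(2)] inner_basis_basis by simp
  qed
  moreover have "?Y \<subseteq> span (basis_vec ` {2, 3, 4})"
    by (auto intro!: span_diff intro: span_base)
  ultimately have iso: "isometry_on shift_2 ?Y" by (rule isometry_on_subset)
  have "shift_2 ` ?Y = root_A 2"
  proof (intro set_eqI iffI)
    fix x assume "x \<in> shift_2 ` ?Y"
    then obtain i j where ij: "x = shift_2 (basis_vec i - basis_vec j)" "i \<in> {2, 3, 4}" "j \<in> {2, 3, 4}" "i \<noteq> j" by blast
    then have "x = basis_vec (i - 2) - basis_vec (j - 2)" using sh' by (simp only: linear_diff[OF lin])
    moreover have "i - 2 \<le> 2" "j - 2 \<le> 2" "i - 2 \<noteq> j - 2" using ij by auto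
    ultimately show "x \<in> root_A 2" unfolding root_A_def by blast
  next
    fix x assume "x \<in> root_A 2"
    then obtain i j where ij: "x = basis_vec i - basis_vec j" "i \<le> 2" "j \<le> 2" "i \<noteq> j" by (auto simp: root_A_def)
    then have "x = shift_2 (basis_vec (i + 2) - basis_vec (j + 2))" by (simp only: linear_diff[OF lin] sh)
    moreover have "i + 2 \<in> {2, 3, 4}" "j + 2 \<in> {2, 3, 4}" "i + 2 \<noteq> j + 2" using ij by auto
    ultimately show "x \<in> shift_2 ` ?Y" by blast
  qed
  then have "root_isomorphic ?Y (root_A 2)"
    using iso unfolding root_isomorphic_def root_isomorphism_iff by blast
  moreover have "\<forall>x\<in>root_A 1. \<forall>y\<in>?Y. x \<bullet> y = 0"
  proof (intro ballI)
    fix x y assume "x \<in> root_A 1" "y \<in> ?Y"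
    then obtain i j k l where "x = basis_vec i - basis_vec j" "i \<le> 1" "j \<le> 1"
      "y = basis_vec k - basis_vec l" "k \<in> {2, 3, 4}" "l \<in> {2, 3, 4}"
      unfolding root_A_def by blast
    then show "x \<bullet> y = 0" by (auto simp: inner_diff_left basis_vec_inner)
  qed
  ultimately show ?thesis
    unfolding isomorphic_to_product_def std_part_simps root_A_factors
    by (intro exI[of _ "root_A 1"] exI[of _ ?Y] conjI refl root_isomorphic_refl)
qed

theorem theorem4p1:
  "\<exists>(\<Phi>\<^sub>4 :: fsvec set) \<Phi>\<^sub>3 \<Phi>\<^sub>2 \<Phi>\<^sub>1 \<Phi>\<^sub>0 Gs.
     root_isomorphic \<Phi>\<^sub>4 root_E7 \<and>
     root_isomorphic \<Phi>\<^sub>3 root_E6 \<and>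
     root_isomorphic \<Phi>\<^sub>2 (root_D 5) \<and>
     root_isomorphic \<Phi>\<^sub>1 (root_A 4) \<and>
     isomorphic_to_product \<Phi>\<^sub>0 (root_A 1) (root_A 2) \<and>
     nested_sequence [\<Phi>\<^sub>4, \<Phi>\<^sub>3, \<Phi>\<^sub>2, \<Phi>\<^sub>1, \<Phi>\<^sub>0] Gs \<and>
     local_sequence Gs \<and>
     maximal_sequence [\<Phi>\<^sub>4, \<Phi>\<^sub>3, \<Phi>\<^sub>2, \<Phi>\<^sub>1, \<Phi>\<^sub>0] Gs \<and>
     \<not> embeddable [\<Phi>\<^sub>4, \<Phi>\<^sub>3, \<Phi>\<^sub>2, \<Phi>\<^sub>1, \<Phi>\<^sub>0] Gs \<and>
     (\<forall>(\<Psi>s :: fsvec set list) Hs.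
        nested_sequence \<Psi>s Hs \<and> local_sequence Hs \<and> maximal_sequence \<Psi>s Hs \<and>
        \<not> embeddable \<Psi>s Hs \<longrightarrow>
        sequence_isomorphic [\<Phi>\<^sub>4, \<Phi>\<^sub>3, \<Phi>\<^sub>2, \<Phi>\<^sub>1, \<Phi>\<^sub>0] Gs \<Psi>s Hs)"
proof -
  \<comment> \<open>The explicit list of models is the sequence of the standard frame, so each
    conjunct becomes an instance of a general fact about frames.\<close>
  have parts: "[root_E7, root_E6, root_D 5, root_A 4, std_part 4] = frame_parts root_E7 std_frame"
    using std_frame(2) by (simp add: frame_parts_def std_part_simps)
  show ?thesis
    by (rule exI[of _ root_E7], rule exI[of _ root_E6], rule exI[of _ "root_D 5"], rule exI[of _ "root_A 4"],
        rule exI[of _ "std_part 4"], rule exI[of _ "frame_gradings root_E7 std_frame"], unfold parts,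
        intro conjI allI impI root_isomorphic_refl product_A1_A2 frame_nested frame_local frame_maximal
          frame_not_embeddable frame_unique std_frame(1); blast)
qed

end
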